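(* Let $P$ be a branching program of length $T$ and width $W$ on Boolean inputs $x_1,\dots,x_n$, where Alice holds $x_1,\dots,x_{n/2}$ and Bob holds $x_{n/2+1},\dots,x_n$. For every $\epsilon>0$ there is a computationally efficient interactive (IP) communication protocol for checking whether $P$ accepts $x_1,\dots,x_n$, in which: (1) Merlin and Alice exchange $O(\log^2W\log^2T\cdot(\log\log W+\log\log T+\log\epsilon^{-1}))$ bits; (2) Alice tosses $O(\log^2W\log^2T\cdot(\log\log W+\log\log T+\log\epsilon^{-1}))$ public coins; (3) Bob sends $O(\log\log W+\log\log T+\log\epsilon^{-1})$ bits to Alice; (4) Alice accepts or rejects at the end. If $P$ accepts the input then (with Merlin behaving honestly) Alice always accepts; otherwise, whatever Merlin does, Alice rejects with probability at least $1-\epsilon$.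
   Context: A (nondeterministic) branching program of length $T$ and width $W$ on Boolean inputs $x_1,\dots,x_n$ is a layered directed graph with $T$ layers of $W$ nodes; all nodes of layer $i<T$ are labelled by one variable $x_{f(i)}$; edges go between consecutive layers and are marked $0$ or $1$; it accepts $x$ iff there is a path from the first node of layer $1$ to the first node of layer $T$ using only edges whose mark equals the value of the variable labelling their starting node. In an IP communication protocol, Alice and Bob each hold part of the input, an untrusted prover Merlin knows the whole input, and Alice's public coin tosses are visible to Merlin and Bob. *)

theory Defs
  imports "HOL-Probability.Probability_Mass_Function"
begin

type_synonym bits = "bool list"

section \<open>Branching programs\<close>

text \<open>
  Layers, nodes and variables are numbered from 0.  An edge \<open>(i, u, b, v)\<close> leads from node \<open>u\<close> of
  layer \<open>i\<close> to node \<open>v\<close> of layer \<open>i + 1\<close> and carries the mark \<open>b\<close>.  Several edges may leave a node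
  with the same mark, so the programs are nondeterministic.
\<close>

record branching_program =
  bp_vars :: nat
  bp_length :: nat
  bp_width :: nat
  bp_label :: "nat \<Rightarrow> nat"
  bp_edges :: "(nat \<times> nat \<times> bool \<times> nat) set"

definition wf_bp :: "branching_program \<Rightarrow> bool" where
  "wf_bp P \<longleftrightarrow>
     1 \<le> bp_length P \<and> 1 \<le> bp_width P \<and>
     (\<forall>i. Suc i < bp_length P \<longrightarrow> bp_label P i < bp_vars P) \<and>
     (\<forall>(i, u, b, v) \<in> bp_edges P. Suc i < bp_length P \<and> u < bp_width P \<and> v < bp_width P)"

definition bp_accepts :: "branching_program \<Rightarrow> bits \<Rightarrow> bool" where
  "bp_accepts P x \<longleftrightarrow>
     (\<exists>p. length p = bp_length P \<and> p ! 0 = 0 \<and> p ! (bp_length P - 1) = 0 \<and>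
        (\<forall>i. Suc i < bp_length P \<longrightarrow> (i, p ! i, x ! bp_label P i, p ! Suc i) \<in> bp_edges P))"

definition alice_part :: "branching_program \<Rightarrow> bits \<Rightarrow> bits" where
  "alice_part P x = take (bp_vars P div 2) x"

definition bob_part :: "branching_program \<Rightarrow> bits \<Rightarrow> bits" where
  "bob_part P x = drop (bp_vars P div 2) x"


section \<open>IP communication protocols\<close>

text \<open>
  In each round Alice tosses fresh public coins, sends Merlin a message, and Merlin replies.  A
  transcript lists the triples (coins, message of Alice, reply of Merlin) of the rounds played so
  far.  A strategy for Merlin maps the transcript of the earlier rounds together with the coins and
  Alice's message of the current round to his reply; he does not see coins of later rounds.
\<close>

type_synonym transcript = "(bits \<times> bits \<times> bits) list"
type_synonym strategy = "transcript \<Rightarrow> bits \<Rightarrow> bits \<Rightarrow> bits"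

text \<open>
  The schedule gives, for each round, the number of coins tossed and the number of bits Alice reads
  from Merlin.  Alice's message depends on her own input, the transcript of the earlier rounds and
  the fresh coins.  After the last round Bob, who has seen all the coins but not the messages
  between Alice and Merlin, sends one message to Alice, who then decides.  The component
  \<open>ip_merlin\<close> is the honest strategy; it depends on the whole input.
\<close>

record ip_protocol =
  ip_schedule :: "(nat \<times> nat) list"
  ip_alice :: "bits \<Rightarrow> transcript \<Rightarrow> bits \<Rightarrow> bits"
  ip_bob :: "bits \<Rightarrow> bits list \<Rightarrow> bits"
  ip_verdict :: "bits \<Rightarrow> transcript \<Rightarrow> bits \<Rightarrow> bool"
  ip_merlin :: "bits \<Rightarrow> strategy"

definition coin_space :: "ip_protocol \<Rightarrow> bits list set" where
  "coin_space \<pi> = {cs. map length cs = map fst (ip_schedule \<pi>)}"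

definition coin_count :: "ip_protocol \<Rightarrow> nat" where
  "coin_count \<pi> = sum_list (map fst (ip_schedule \<pi>))"

definition strategies :: "ip_protocol \<Rightarrow> strategy set" where
  "strategies \<pi> = {m. \<forall>tr c a. length tr < length (ip_schedule \<pi>) \<longrightarrow>
     length (m tr c a) = snd (ip_schedule \<pi> ! length tr)}"

definition play :: "ip_protocol \<Rightarrow> bits \<Rightarrow> strategy \<Rightarrow> bits list \<Rightarrow> transcript" where
  "play \<pi> xa m cs =
     foldl (\<lambda>tr c. let a = ip_alice \<pi> xa tr c in tr @ [(c, a, m tr c a)]) [] cs"

definition exchanged_bits :: "transcript \<Rightarrow> nat" where
  "exchanged_bits tr = (\<Sum>(c, a, w) \<leftarrow> tr. length a + length w)"

definition alice_accepts :: "ip_protocol \<Rightarrow> bits \<Rightarrow> bits \<Rightarrow> strategy \<Rightarrow> bits list \<Rightarrow> bool" where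
  "alice_accepts \<pi> xa xb m cs \<longleftrightarrow> ip_verdict \<pi> xa (play \<pi> xa m cs) (ip_bob \<pi> xb cs)"


section \<open>Polynomial time\<close>

text \<open>
  The machine model is the WHILE language of N. D. Jones (Computability and Complexity from a
  Programming Perspective): imperative programs on binary trees in which every elementary
  operation costs one unit of time.  Trees can be stored with sharing, and there is no equality
  test other than against the atom, so polynomial time in this model coincides with polynomial
  time on Turing machines.
\<close>

datatype sexp = Atom | Dot sexp sexp

datatype expr = EAtom | EVar nat | EDot expr expr | EHd expr | ETl expr

datatype com =
    Skip
  | Assign nat expr
  | Seq com com
  | If expr com com
  | While expr com

type_synonym store = "nat \<Rightarrow> sexp"

fun eval :: "expr \<Rightarrow> store \<Rightarrow> sexp" where
  "eval EAtom s = Atom"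
| "eval (EVar v) s = s v"
| "eval (EDot d e) s = Dot (eval d s) (eval e s)"
| "eval (EHd e) s = (case eval e s of Atom \<Rightarrow> Atom | Dot a b \<Rightarrow> a)"
| "eval (ETl e) s = (case eval e s of Atom \<Rightarrow> Atom | Dot a b \<Rightarrow> b)"

fun cost :: "expr \<Rightarrow> nat" where
  "cost EAtom = 1"
| "cost (EVar v) = 1"
| "cost (EDot d e) = cost d + cost e + 1"
| "cost (EHd e) = cost e + 1"
| "cost (ETl e) = cost e + 1"

text \<open>\<open>exec c s t s'\<close>: started in \<open>s\<close>, the command \<open>c\<close> terminates in \<open>s'\<close> after \<open>t\<close> steps.\<close>

inductive exec :: "com \<Rightarrow> store \<Rightarrow> nat \<Rightarrow> store \<Rightarrow> bool" where
  "exec Skip s 1 s"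
| "exec (Assign v e) s (cost e + 1) (s(v := eval e s))"
| "exec c s t s' \<Longrightarrow> exec d s' t' s'' \<Longrightarrow> exec (Seq c d) s (t + t') s''"
| "eval e s \<noteq> Atom \<Longrightarrow> exec c s t s' \<Longrightarrow> exec (If e c d) s (cost e + t + 1) s'"
| "eval e s = Atom \<Longrightarrow> exec d s t s' \<Longrightarrow> exec (If e c d) s (cost e + t + 1) s'"
| "eval e s = Atom \<Longrightarrow> exec (While e c) s (cost e + 1) s"
| "eval e s \<noteq> Atom \<Longrightarrow> exec c s t s' \<Longrightarrow> exec (While e c) s' t' s'' \<Longrightarrow>
     exec (While e c) s (cost e + t + t' + 1) s''"

text \<open>Variable 0 holds the input and the output; the other variables start with the atom.\<close>

definition runs :: "com \<Rightarrow> sexp \<Rightarrow> nat \<Rightarrow> sexp \<Rightarrow> bool" where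
  "runs c inp t out \<longleftrightarrow> (\<exists>s. exec c ((\<lambda>_. Atom)(0 := inp)) t s \<and> s 0 = out)"

text \<open>
  A set of pairs (input, output) is polynomial-time computable if one single program produces
  every output from its input within a number of steps polynomial in the size of the input.
\<close>

definition poly_time :: "(sexp \<times> sexp) set \<Rightarrow> bool" where
  "poly_time R \<longleftrightarrow>
     (\<exists>c d. \<forall>(inp, out) \<in> R. \<exists>t. t \<le> d * (size inp + 1) ^ d \<and> runs c inp t out)"


section \<open>Encodings\<close>

definition code_bool :: "bool \<Rightarrow> sexp" where
  "code_bool b = (if b then Dot Atom Atom else Atom)"

definition code_list :: "('a \<Rightarrow> sexp) \<Rightarrow> 'a list \<Rightarrow> sexp" where
  "code_list f xs = foldr (\<lambda>x. Dot (f x)) xs Atom"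

text \<open>Numbers are in unary.\<close>

definition code_nat :: "nat \<Rightarrow> sexp" where
  "code_nat n = (Dot Atom ^^ n) Atom"

abbreviation code_bits :: "bits \<Rightarrow> sexp" where
  "code_bits \<equiv> code_list code_bool"

definition code_transcript :: "transcript \<Rightarrow> sexp" where
  "code_transcript =
     code_list (\<lambda>(c, a, w). Dot (code_bits c) (Dot (code_bits a) (code_bits w)))"

definition code_schedule :: "(nat \<times> nat) list \<Rightarrow> sexp" where
  "code_schedule = code_list (\<lambda>(k, l). Dot (code_nat k) (code_nat l))"

text \<open>
  A program is given by its parameters and, for each layer but the last, the label of the layer and
  a table that tells for all \<open>u\<close> and \<open>v\<close> whether there are edges with mark 0 and with mark 1.
\<close>

definition code_bp :: "branching_program \<Rightarrow> sexp" where
  "code_bp P =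
     Dot (code_nat (bp_vars P)) (Dot (code_nat (bp_length P)) (Dot (code_nat (bp_width P))
       (code_list (\<lambda>i. Dot (code_nat (bp_label P i))
          (code_list (\<lambda>u. code_list (\<lambda>v.
              Dot (code_bool ((i, u, False, v) \<in> bp_edges P))
                  (code_bool ((i, u, True, v) \<in> bp_edges P)))
            [0..<bp_width P]) [0..<bp_width P]))
        [0..<bp_length P - 1])))"

text \<open>
  The real number \<open>\<epsilon>\<close> is given to the parties as the unary number \<open>\<lceil>log 2 (1/\<epsilon>)\<rceil>\<close>, so polynomial time
  means polynomial in the size of the branching program and in \<open>log (1/\<epsilon>)\<close>.
\<close>

definition code_instance :: "branching_program \<Rightarrow> real \<Rightarrow> sexp" where
  "code_instance P \<epsilon> = Dot (code_bp P) (code_nat (nat \<lceil>log 2 (1 / \<epsilon>)\<rceil>))"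


section \<open>Computationally efficient protocols\<close>

text \<open>
  A family of protocols, one for each branching program and each error bound, is efficient if
  everything that Alice and Bob do is computable in uniform polynomial time.  Merlin is unbounded.
\<close>

definition efficient :: "(branching_program \<Rightarrow> real \<Rightarrow> ip_protocol) \<Rightarrow> bool" where
  "efficient F \<longleftrightarrow>
     poly_time {(code_instance P \<epsilon>, code_schedule (ip_schedule (F P \<epsilon>))) | P \<epsilon>.
        wf_bp P \<and> \<epsilon> > 0} \<and>
     poly_time {(Dot (code_instance P \<epsilon>)
                   (Dot (code_bits xa) (Dot (code_transcript tr) (code_bits c))),
                 code_bits (ip_alice (F P \<epsilon>) xa tr c)) | P \<epsilon> xa tr c.
        wf_bp P \<and> \<epsilon> > 0 \<and> length xa = bp_vars P div 2} \<and>
     poly_time {(Dot (code_instance P \<epsilon>)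
                   (Dot (code_bits xa) (Dot (code_transcript tr) (code_bits w))),
                 code_bool (ip_verdict (F P \<epsilon>) xa tr w)) | P \<epsilon> xa tr w.
        wf_bp P \<and> \<epsilon> > 0 \<and> length xa = bp_vars P div 2} \<and>
     poly_time {(Dot (code_instance P \<epsilon>) (Dot (code_bits xb) (code_list code_bits cs)),
                 code_bits (ip_bob (F P \<epsilon>) xb cs)) | P \<epsilon> xb cs.
        wf_bp P \<and> \<epsilon> > 0 \<and> length xb = bp_vars P - bp_vars P div 2}"


section \<open>The complexity bounds\<close>

text \<open>
  The logarithms are cut off below at 1, so that the bounds also make sense for \<open>W = 1\<close>, \<open>T = 1\<close> and
  \<open>\<epsilon> \<ge> 1\<close>.  For \<open>W \<ge> 4\<close>, \<open>T \<ge> 4\<close> and \<open>\<epsilon> \<le> 1/2\<close> they are the ordinary logarithms.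
\<close>

definition lg :: "real \<Rightarrow> real" where
  "lg z = max 1 (log 2 z)"

definition bob_bound :: "real \<Rightarrow> real \<Rightarrow> real \<Rightarrow> real" where
  "bob_bound W T \<epsilon> = lg (lg W) + lg (lg T) + lg (1 / \<epsilon>)"

definition alice_bound :: "real \<Rightarrow> real \<Rightarrow> real \<Rightarrow> real" where
  "alice_bound W T \<epsilon> = (lg W)\<^sup>2 * (lg T)\<^sup>2 * bob_bound W T \<epsilon>"

end

theory Submission
  imports Defs "HOL-Computational_Algebra.Primes" "HOL-Number_Theory.Cong" "HOL-Library.More_List"
    "HOL-Library.Log_Nat"
begin

text \<open>
  Savitch's recursion writes acceptance as a quantified formula over the bits of the layer index and
  of the nodes: \<open>reach\<^sub>k\<^sub>+\<^sub>1(s, t)\<close> holds iff there is a midpoint \<open>w\<close> such that for both values of the next index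
  bit \<open>b\<close> the half selected by \<open>b\<close> leads from \<open>b ? w : s\<close> to \<open>b ? t : w\<close>.  The formula is evaluated by
  Shamir's protocol in Shen's form: quantifiers and multiplexers become operators on polynomials,
  each followed by a linearization of every variable, so every univariate restriction is quadratic
  and is sent as three field elements.  The innermost polynomial is the multilinear extension of the
  table of edges; it is the sum of a part known to Alice and a part known to Bob, and Bob only has to
  send the value of his part at a point that depends on the coins alone.

  There are \<open>N = O(log\<^sup>2 W log\<^sup>2 T)\<close> operators.  To find the field in polynomial time, it is taken to be a
  prime field of size polynomial in \<open>N\<close>, which gives error at most \<open>2\<^sup>-\<^sup>h\<close> with \<open>h = O(log N)\<close>, and the
  protocol is repeated about \<open>log (1/\<epsilon>) / h\<close> times in sequence; the costs then add up to
  \<open>O(h + log (1/\<epsilon>))\<close> bits per operator.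
\<close>

section \<open>Primes in short intervals\<close>

lemma dvd_if_inverse_diff:
  fixes a b c d :: "'a::idom"
  assumes "a \<noteq> 0" "b \<noteq> 0" and harmonic: "b * c = a * (b + c)" and "a dvd d" "b dvd d"
  shows "c dvd d"
proof -
  obtain x where x: "d = a * x" using \<open>a dvd d\<close> ..
  obtain y where y: "d = b * y" using \<open>b dvd d\<close> ..
  have "a * b * (c * (x - y)) = b * c * (a * x) - a * c * (b * y)" by (simp add: algebra_simps)
  also have "\<dots> = (b * c - a * c) * d" by (simp only: x[symmetric] y[symmetric] left_diff_distrib)
  also have "\<dots> = a * b * d" by (simp add: harmonic algebra_simps)
  finally have "d = c * (x - y)" using assms(1,2) by simp
  then show ?thesis by simp
qed

lemma times_binomial_dvd_Lcm:
  fixes n k :: nat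
  assumes "1 \<le> k" "k \<le> n"
  shows "k * (n choose k) dvd Lcm {1..n}"
  using assms
proof (induction k arbitrary: n)
  case (Suc k)
  show ?case
  proof (cases "k = 0")
    case True
    then show ?thesis using Suc.prems by auto
  next
    case False
    define a b c where "a = k * ((n - 1) choose k)" and "b = k * (n choose k)"
      and "c = Suc k * (n choose Suc k)"
    have "a dvd Lcm {1..n - 1}" unfolding a_def by (rule Suc.IH) (use Suc.prems False in auto)
    also have "Lcm {1..n - 1} dvd Lcm {1..n}" by (rule Lcm_subset) auto
    finally have "a dvd Lcm {1..n}" .
    moreover have "b dvd Lcm {1..n}" unfolding b_def by (rule Suc.IH) (use Suc.prems False in auto)
    moreover have "a \<noteq> 0" "b \<noteq> 0" using Suc.prems False by (auto simp: a_def b_def)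
    moreover have "b * c = a * (b + c)"
    proof -
      have c: "c = (n - k) * (n choose k)"
        unfolding c_def by (simp only: binomial_absorb_comp binomial_absorption)
      have "b + c = n * (n choose k)"
        unfolding b_def c using Suc.prems by (simp flip: add_mult_distrib)
      moreover have "c = n * ((n - 1) choose k)"
        unfolding c by (rule binomial_absorb_comp)
      ultimately show ?thesis by (simp add: a_def b_def)
    qed
    ultimately have "int c dvd int (Lcm {1..n})"
      by - (rule dvd_if_inverse_diff[of "int a" "int b"],
        simp_all only: of_nat_dvd_iff of_nat_eq_0_iff not_False_eq_True flip: of_nat_mult of_nat_add)
    then show ?thesis unfolding c_def by (simp only: of_nat_dvd_iff)
  qed
qed simp

lemma four_power_le_Lcm:
  assumes "m > 0"
  shows "4 ^ m \<le> 2 * Lcm {1..2 * m}"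
proof -
  have "real (4 ^ m) \<le> real (2 * (m * (2 * m choose m)))"
    using central_binomial_lower_bound[of m] assms by (simp add: field_simps)
  then have "4 ^ m \<le> 2 * (m * (2 * m choose m))" by linarith
  moreover have "m * (2 * m choose m) \<le> Lcm {1..2 * m}"
    using assms by (intro dvd_imp_le times_binomial_dvd_Lcm) (auto intro!: Nat.gr0I simp: Lcm_0_iff)
  ultimately show ?thesis by linarith
qed

lemma Lcm_atLeastAtMost_le_power_card_primes:
  fixes n :: nat
  shows "Lcm {1..n} \<le> n ^ card {p. prime p \<and> p \<le> n}"
proof (cases "n = 0")
  case False
  define S where "S = {p. prime p \<and> p \<le> n}"
  have S: "finite S" unfolding S_def by (rule finite_subset[of _ "{..n}"]) auto
  define e where "e p = Max (multiplicity p ` {1..n})" for p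
  have "Lcm {1..n} dvd (\<Prod>p\<in>S. p ^ e p)"
  proof (rule Lcm_least)
    fix i assume i: "i \<in> {1..n}"
    then have "prime_factors i \<subseteq> S"
      by (auto simp: S_def intro: order_trans[OF dvd_imp_le])
    then have "i = (\<Prod>p\<in>S. p ^ multiplicity p i)"
      using prime_factorization_nat[of i] i S
      by (subst prod.mono_neutral_right[of S "prime_factors i"])
         (auto simp: prime_factors_multiplicity S_def)
    also have "\<dots> dvd (\<Prod>p\<in>S. p ^ e p)"
      using i by (intro prod_dvd_prod le_imp_power_dvd) (auto simp: e_def)
    finally show "i dvd (\<Prod>p\<in>S. p ^ e p)" .
  qed
  then have "Lcm {1..n} \<le> (\<Prod>p\<in>S. p ^ e p)"
    by (rule dvd_imp_le) (auto simp: S_def intro!: prod_pos prime_gt_0_nat)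
  also have "\<dots> \<le> (\<Prod>p\<in>S. n)"
  proof (rule prod_mono)
    fix p
    have "e p \<in> multiplicity p ` {1..n}" unfolding e_def by (rule Max_in) (use False in auto)
    then obtain i where "i \<in> {1..n}" "e p = multiplicity p i" by blast
    then have "p ^ e p \<le> n" using dvd_imp_le[OF multiplicity_dvd[of p i]] by simp
    then show "0 \<le> p ^ e p \<and> p ^ e p \<le> n" by simp
  qed
  finally show ?thesis by (simp add: S_def)
next
  case True
  have "card {p :: nat. prime p \<and> p \<le> 0} = 0" by (auto simp: card_eq_0_iff)
  then show ?thesis unfolding True by (simp only: power_0) simp
qed

lemma two_times_square_less_power_2:
  fixes n :: nat
  assumes "n \<ge> 7"
  shows "2 * n\<^sup>2 < 2 ^ n"
  using assms
proof (induction n rule: dec_induct)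
  case (step k)
  have "4 * k + 2 \<le> 7 * k" using step by simp
  also have "\<dots> \<le> k * k" using step by (intro mult_right_mono) auto
  finally have "2 * (Suc k)\<^sup>2 \<le> 4 * k\<^sup>2" by (simp add: power2_eq_square algebra_simps)
  also have "\<dots> < 2 ^ Suc k" using step by simp
  finally show ?case .
qed simp

lemma ex_prime_between_square:
  fixes n :: nat
  assumes n: "n \<ge> 7"
  shows "\<exists>p. prime p \<and> n < p \<and> p \<le> 2 * n\<^sup>2"
proof (rule ccontr)
  assume no: "\<nexists>p. prime p \<and> n < p \<and> p \<le> 2 * n\<^sup>2"
  let ?m = "n\<^sup>2"
  have "{p. prime p \<and> p \<le> 2 * ?m} \<subseteq> {1..n}"
    using no by (auto simp: Suc_le_eq prime_gt_0_nat not_less)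
  from card_mono[OF finite_atLeastAtMost this]
  have primes: "card {p. prime p \<and> p \<le> 2 * ?m} \<le> n" by simp
  have "Lcm {1..2 * ?m} \<le> (2 * ?m) ^ card {p. prime p \<and> p \<le> 2 * ?m}"
    by (rule Lcm_atLeastAtMost_le_power_card_primes)
  also have "\<dots> \<le> (2 * ?m) ^ n" using n primes by (intro power_increasing) auto
  also have "\<dots> \<le> (2 ^ n) ^ n"
    using two_times_square_less_power_2[OF n] by (intro power_mono) auto
  finally have Lcm: "Lcm {1..2 * ?m} \<le> (2 ^ n) ^ n" .
  have "4 ^ ?m \<le> 2 * Lcm {1..2 * ?m}" using n by (intro four_power_le_Lcm) simp
  also have "\<dots> \<le> 2 * (2 ^ n) ^ n" using Lcm by simp
  also have "\<dots> = 2 ^ Suc ?m" by (simp add: power2_eq_square power_mult)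
  also have "\<dots> < 2 ^ (2 * ?m)"
  proof (rule power_strict_increasing)
    have "7 * 7 \<le> n * n" using n by (intro mult_mono) auto
    then show "Suc ?m < 2 * ?m" by (simp add: power2_eq_square)
  qed simp
  finally show False by (simp add: power_mult)
qed

section \<open>Polynomial-time functions on encodable types\<close>

subsection \<open>Encodable types\<close>

class codable =
  fixes code :: "'a \<Rightarrow> sexp"

instantiation unit :: codable
begin
definition code_unit_eq: "code = (\<lambda>_ :: unit. Atom)"
instance ..
end
instantiation bool :: codable
begin
definition code_eq_code_bool: "code = code_bool"
instance ..
end
instantiation nat :: codable
begin
definition code_eq_code_nat: "code = code_nat"
instance ..
end
instantiation list :: (codable) codable
begin
definition code_eq_code_list: "code = code_list code"
instance ..
end
instantiation prod :: (codable, codable) codable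
begin
definition code_prod_eq: "code z = Dot (code (fst z)) (code (snd z))"
instance ..
end
lemma code_unit [simp]: "code () = Atom"
  by (simp add: code_unit_eq)

lemma code_False [simp]: "code False = Atom"
  and code_True [simp]: "code True = Dot Atom Atom"
  by (simp_all add: code_eq_code_bool code_bool_def)

lemma code_0 [simp]: "code (0::nat) = Atom"
  and code_Suc [simp]: "code (Suc n) = Dot Atom (code n)"
  by (simp_all add: code_eq_code_nat code_nat_def)

lemma code_Nil [simp]: "code [] = Atom"
  and code_Cons [simp]: "code (x # xs) = Dot (code x) (code xs)"
  by (simp_all add: code_eq_code_list code_list_def)

lemma code_Pair [simp]: "code (x, y) = Dot (code x) (code y)"
  by (simp add: code_prod_eq)

lemma code_replicate_unit: "code (replicate n ()) = code n"
  by (induction n) auto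

lemma code_length_unit: "code (length xs) = code (xs :: unit list)"
  by (induction xs) auto

lemma size_code_nat [simp]: "size (code (n::nat)) = n"
  by (induction n) auto

lemma size_code_bool: "size (code (b::bool)) \<le> 1"
  by (cases b) auto

lemma size_code_append [simp]: "size (code (xs @ ys)) = size (code xs) + size (code ys)"
  by (induction xs) auto

lemma size_code_rev [simp]: "size (code (rev xs)) = size (code xs)"
  by (induction xs) auto

lemma size_code_take: "size (code (take i xs)) \<le> size (code xs)"
  by (metis append_take_drop_id le_add1 size_code_append)

lemma size_code_drop: "size (code (drop i xs)) \<le> size (code xs)"
  by (metis append_take_drop_id le_add2 size_code_append)

lemma size_code_concat: "size (code (concat xss)) \<le> size (code xss)"
  by (induction xss) auto

lemma size_code_mem: "x \<in> set xs \<Longrightarrow> size (code x) < size (code xs)"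
  by (induction xs) auto

lemma length_le_size_code: "length xs \<le> size (code xs)"
  by (induction xs) auto

lemma size_code_list_le:
  assumes "\<And>x. x \<in> set xs \<Longrightarrow> size (code x) \<le> b"
  shows "size (code xs) \<le> length xs * (b + 1)"
  using assms
proof (induction xs)
  case (Cons x xs)
  then have "size (code xs) \<le> length xs * (b + 1)" "size (code x) \<le> b" by auto
  then show ?case by simp
qed simp

lemma size_code_bits_le: "size (code (bs :: bits)) \<le> 2 * length bs"
  using size_code_list_le[of bs 1] size_code_bool by simp

subsection \<open>Polynomial bounds\<close>

definition polybounded :: "('a::codable \<Rightarrow> nat) \<Rightarrow> bool" where
  "polybounded g \<longleftrightarrow> (\<exists>d. \<forall>a. g a \<le> d * (size (code a) + 1) ^ d)"

lemma polyboundedE: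
  assumes "polybounded g"
  obtains d where "\<And>a. g a \<le> d * (size (code a) + 1) ^ d"
  using assms unfolding polybounded_def by blast

lemma polybounded_mono: "polybounded h \<Longrightarrow> (\<And>a. g a \<le> h a) \<Longrightarrow> polybounded g"
  unfolding polybounded_def by (meson order_trans)

lemma poly_bound_mono:
  fixes x d e :: nat
  assumes "d \<le> e" "x \<le> y"
  shows "d * (x + 1) ^ d \<le> e * (y + 1) ^ e"
proof -
  have "d * (x + 1) ^ d \<le> e * (x + 1) ^ e"
    using assms by (intro mult_mono power_increasing) auto
  also have "\<dots> \<le> e * (y + 1) ^ e"
    using assms by (intro mult_left_mono power_mono) auto
  finally show ?thesis .
qed

named_theorems polybounded_intros

lemma polybounded_const [polybounded_intros]: "polybounded (\<lambda>_. c)"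
proof -
  have "c \<le> c * (x + 1) ^ c" for x :: nat by simp
  then show ?thesis unfolding polybounded_def by blast
qed

lemma polybounded_size [polybounded_intros]: "polybounded (\<lambda>a. size (code a))"
  unfolding polybounded_def by (rule exI[of _ 1]) simp

lemma polybounded_mult [polybounded_intros]:
  assumes "polybounded f" "polybounded g"
  shows "polybounded (\<lambda>a. f a * g a)"
proof -
  obtain d where d: "\<And>a. f a \<le> d * (size (code a) + 1) ^ d" using polyboundedE[OF assms(1)] by blast
  obtain e where e: "\<And>a. g a \<le> e * (size (code a) + 1) ^ e" using polyboundedE[OF assms(2)] by blast
  let ?D = "d * e + d + e"
  have "f a * g a \<le> ?D * (size (code a) + 1) ^ ?D" for a
  proof -
    let ?x = "size (code a) + 1"
    have "f a * g a \<le> (d * ?x ^ d) * (e * ?x ^ e)"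
      by (intro mult_mono d e) auto
    also have "\<dots> = d * e * ?x ^ (d + e)" by (simp add: power_add)
    also have "\<dots> \<le> ?D * ?x ^ ?D" by (intro mult_mono power_increasing) auto
    finally show ?thesis .
  qed
  then show ?thesis unfolding polybounded_def by blast
qed

lemma polybounded_add [polybounded_intros]:
  assumes "polybounded f" "polybounded g"
  shows "polybounded (\<lambda>a. f a + g a)"
proof -
  obtain d where d: "\<And>a. f a \<le> d * (size (code a) + 1) ^ d" using polyboundedE[OF assms(1)] by blast
  obtain e where e: "\<And>a. g a \<le> e * (size (code a) + 1) ^ e" using polyboundedE[OF assms(2)] by blast
  have "f a + g a \<le> (d + e) * (size (code a) + 1) ^ (d + e)" for a
  proof -
    let ?x = "size (code a) + 1"
    have "d * ?x ^ d \<le> d * ?x ^ (d + e)" "e * ?x ^ e \<le> e * ?x ^ (d + e)"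
      by (intro mult_left_mono power_increasing; simp)+
    then show ?thesis using d[of a] e[of a] unfolding add_mult_distrib by linarith
  qed
  then show ?thesis unfolding polybounded_def by blast
qed

lemma polybounded_power [polybounded_intros]: "polybounded f \<Longrightarrow> polybounded (\<lambda>a. f a ^ k)"
  by (induction k) (auto intro: polybounded_intros)

lemma polybounded_comp:
  assumes "polybounded g" "polybounded (\<lambda>a. size (code (f a)))"
  shows "polybounded (\<lambda>a. g (f a))"
proof -
  obtain d where d: "\<And>a. g a \<le> d * (size (code a) + 1) ^ d" using polyboundedE[OF assms(1)] by blast
  show ?thesis
    by (rule polybounded_mono[OF _ d]) (intro polybounded_intros assms)
qed

lemma polybounded_fst: "polybounded f \<Longrightarrow> polybounded (\<lambda>z. f (fst z))"
  by (erule polybounded_comp) (rule polybounded_mono[OF polybounded_size], simp add: code_prod_eq)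

lemma polybounded_case_list:
  assumes "polybounded f" "polybounded g"
  shows "polybounded (\<lambda>z. case snd z of [] \<Rightarrow> f (fst z) | y # ys \<Rightarrow> g (fst z, y, ys))"
proof -
  obtain d where d: "\<And>a. g a \<le> d * (size (code a) + 1) ^ d" using polyboundedE[OF assms(2)] by blast
  have "polybounded (\<lambda>z :: 'a \<times> 'b list. f (fst z) + d * (size (code z) + 1) ^ d)"
    by (intro polybounded_intros polybounded_fst assms)
  then show ?thesis
  proof (rule polybounded_mono)
    fix z :: "'a \<times> 'b list"
    show "(case snd z of [] \<Rightarrow> f (fst z) | y # ys \<Rightarrow> g (fst z, y, ys)) \<le>
        f (fst z) + d * (size (code z) + 1) ^ d"
      using d[of "(fst z, hd (snd z), tl (snd z))"]
      by (cases z; cases "snd z") (auto intro: trans_le_add2)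
  qed
qed

subsection \<open>Time-bounded execution\<close>

definition runs_within :: "com \<Rightarrow> store \<Rightarrow> nat \<Rightarrow> (store \<Rightarrow> bool) \<Rightarrow> bool" where
  "runs_within c s n Q \<longleftrightarrow> (\<exists>t s'. exec c s t s' \<and> t \<le> n \<and> Q s')"

lemma runs_withinI: "exec c s t s' \<Longrightarrow> t \<le> n \<Longrightarrow> Q s' \<Longrightarrow> runs_within c s n Q"
  unfolding runs_within_def by blast

lemma runs_withinE:
  assumes "runs_within c s n Q"
  obtains t s' where "exec c s t s'" "t \<le> n" "Q s'"
  using assms unfolding runs_within_def by blast

lemma runs_within_mono:
  "runs_within c s m P \<Longrightarrow> m \<le> n \<Longrightarrow> (\<And>s'. P s' \<Longrightarrow> Q s') \<Longrightarrow> runs_within c s n Q"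
  unfolding runs_within_def by (blast intro: order_trans)

lemma runs_within_Assign:
  "cost e < n \<Longrightarrow> Q (s(v := eval e s)) \<Longrightarrow> runs_within (Assign v e) s n Q"
  by (rule runs_withinI[OF exec.intros(2)]) auto

lemma runs_within_Seq:
  assumes "runs_within c s m P" "\<And>s'. P s' \<Longrightarrow> runs_within d s' n Q"
  shows "runs_within (Seq c d) s (m + n) Q"
proof -
  obtain t s' where c: "exec c s t s'" "t \<le> m" "P s'" using assms(1) by (rule runs_withinE)
  obtain t' s'' where d: "exec d s' t' s''" "t' \<le> n" "Q s''"
    using assms(2)[OF c(3)] by (rule runs_withinE)
  show ?thesis by (rule runs_withinI[OF exec.intros(3)[OF c(1) d(1)]]) (use c d in auto)
qed

lemma runs_within_Assign_Seq:
  assumes "cost e < m" "runs_within d (s(v := eval e s)) n Q"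
  shows "runs_within (Seq (Assign v e) d) s (m + n) Q"
  by (rule runs_within_Seq[OF runs_within_Assign[where Q = "\<lambda>s'. s' = s(v := eval e s)"]])
    (use assms in auto)

lemma runs_within_If:
  assumes "eval e s \<noteq> Atom \<Longrightarrow> runs_within c s n Q" "eval e s = Atom \<Longrightarrow> runs_within d s n Q"
  shows "runs_within (If e c d) s (cost e + n + 1) Q"
proof (cases "eval e s = Atom")
  case True
  obtain t s' where "exec d s t s'" "t \<le> n" "Q s'" using assms(2)[OF True] by (rule runs_withinE)
  with True show ?thesis by (intro runs_withinI[OF exec.intros(5)]) auto
next
  case False
  obtain t s' where "exec c s t s'" "t \<le> n" "Q s'" using assms(1)[OF False] by (rule runs_withinE)
  with False show ?thesis by (intro runs_withinI[OF exec.intros(4)]) auto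
qed

lemma runs_within_While_exit:
  "eval e s = Atom \<Longrightarrow> cost e < n \<Longrightarrow> Q s \<Longrightarrow> runs_within (While e c) s n Q"
  by (rule runs_withinI[OF exec.intros(6)]) auto

lemma runs_within_While_step:
  assumes "eval e s \<noteq> Atom" "runs_within c s m P"
    and "\<And>s'. P s' \<Longrightarrow> runs_within (While e c) s' n Q"
  shows "runs_within (While e c) s (cost e + m + n + 1) Q"
proof -
  obtain t s' where c: "exec c s t s'" "t \<le> m" "P s'" using assms(2) by (rule runs_withinE)
  obtain t' s'' where w: "exec (While e c) s' t' s''" "t' \<le> n" "Q s''"
    using assms(3)[OF c(3)] by (rule runs_withinE)
  show ?thesis by (rule runs_withinI[OF exec.intros(7)[OF assms(1) c(1) w(1)]]) (use c w in auto)
qed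

fun writes :: "com \<Rightarrow> nat set" where
  "writes Skip = {}"
| "writes (Assign v e) = {v}"
| "writes (Seq c d) = writes c \<union> writes d"
| "writes (If e c d) = writes c \<union> writes d"
| "writes (While e c) = writes c"

lemma finite_writes: "finite (writes c)"
  by (induction c) auto

lemma exec_unchanged: "exec c s t s' \<Longrightarrow> v \<notin> writes c \<Longrightarrow> s' v = s v"
  by (induction rule: exec.induct) auto

lemma ex_fresh_variables:
  "\<exists>k>0. \<forall>v\<ge>k. v \<notin> writes c \<and> v \<notin> writes d"
proof -
  obtain m where "\<forall>v \<in> writes c \<union> writes d. v \<le> m"
    using finite_writes finite_nat_set_iff_bounded_le by (metis finite_UnI)
  then show ?thesis by (intro exI[of _ "Suc m"]) (auto simp: not_less_eq_eq[symmetric])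
qed

subsection \<open>Polynomial-time functions\<close>

definition computes :: "com \<Rightarrow> ('a::codable \<Rightarrow> 'b::codable) \<Rightarrow> ('a \<Rightarrow> nat) \<Rightarrow> bool" where
  "computes c f B \<longleftrightarrow> (\<forall>a s. s 0 = code a \<longrightarrow> runs_within c s (B a) (\<lambda>s'. s' 0 = code (f a)))"

lemma computesI:
  "(\<And>a s. s 0 = code a \<Longrightarrow> runs_within c s (B a) (\<lambda>s'. s' 0 = code (f a))) \<Longrightarrow> computes c f B"
  unfolding computes_def by blast

lemma runs_within_computes:
  assumes "computes c f B" "s 0 = code a" "B a \<le> n"
    and "\<And>s'. s' 0 = code (f a) \<Longrightarrow> (\<And>v. v \<notin> writes c \<Longrightarrow> s' v = s v) \<Longrightarrow> Q s'"
  shows "runs_within c s n Q"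
proof -
  have "runs_within c s (B a) (\<lambda>s'. s' 0 = code (f a))" using assms(1,2) by (simp add: computes_def)
  then obtain t s' where exec: "exec c s t s'" and "t \<le> B a" "s' 0 = code (f a)"
    by (rule runs_withinE)
  then show ?thesis using assms(3,4) exec_unchanged[OF exec] by (intro runs_withinI[OF exec]) auto
qed

lemma runs_within_computes_Seq:
  assumes "computes c f B" "s 0 = code a"
    and "\<And>s'. s' 0 = code (f a) \<Longrightarrow> (\<And>v. v \<notin> writes c \<Longrightarrow> s' v = s v) \<Longrightarrow> runs_within d s' n Q"
  shows "runs_within (Seq c d) s (B a + n) Q"
proof (rule runs_within_Seq)
  show "runs_within c s (B a) (\<lambda>s'. s' 0 = code (f a) \<and> (\<forall>v. v \<notin> writes c \<longrightarrow> s' v = s v))"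
    by (rule runs_within_computes[of c f B s a, OF assms(1,2)]) auto
qed (use assms(3) in auto)

text \<open>The size of the output has to be bounded separately: subtrees are shared, so a short run can
  build an exponentially large tree.\<close>

definition polytime :: "('a::codable \<Rightarrow> 'b::codable) \<Rightarrow> bool" where
  "polytime f \<longleftrightarrow> polybounded (\<lambda>a. size (code (f a))) \<and> (\<exists>c B. polybounded B \<and> computes c f B)"

lemma polytimeI:
  "computes c f B \<Longrightarrow> polybounded B \<Longrightarrow> polybounded (\<lambda>a. size (code (f a))) \<Longrightarrow> polytime f"
  unfolding polytime_def by blast

lemma polytimeE:
  assumes "polytime f"
  obtains c B where "computes c f B" "polybounded B"
  using assms unfolding polytime_def by blast

lemma polybounded_size_polytime: "polytime f \<Longrightarrow> polybounded (\<lambda>a. size (code (f a)))"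
  unfolding polytime_def by blast

lemma polybounded_nat: "polytime f \<Longrightarrow> polybounded (f :: _ \<Rightarrow> nat)"
  using polybounded_size_polytime[of f] by simp

lemma polybounded_length: "polytime f \<Longrightarrow> polybounded (\<lambda>a. length (f a))"
  by (rule polybounded_mono[OF polybounded_size_polytime length_le_size_code])

lemmas [polybounded_intros] = polybounded_size_polytime polybounded_nat polybounded_length

lemma polytime_cong: "polytime f \<Longrightarrow> (\<And>e. g e = f e) \<Longrightarrow> polytime g"
  by presburger

lemma polytime_same_code: "polytime f \<Longrightarrow> (\<And>a. code (g a) = code (f a)) \<Longrightarrow> polytime g"
  unfolding polytime_def computes_def by simp

lemma polytime_expr:
  assumes "\<And>a s. s 0 = code a \<Longrightarrow> eval e s = code (f a)" "polybounded (\<lambda>a. size (code (f a)))"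
  shows "polytime f"
proof (rule polytimeI[where c = "Assign 0 e" and B = "\<lambda>_. cost e + 1"])
  show "computes (Assign 0 e) f (\<lambda>_. cost e + 1)"
    by (intro computesI runs_within_Assign) (use assms(1) in auto)
qed (intro polybounded_intros assms)+

lemma polytime_ident: "polytime (\<lambda>x. x)"
  by (rule polytime_expr[where e = "EVar 0"]) (auto intro: polybounded_intros)

fun constant_expr :: "sexp \<Rightarrow> expr" where
  "constant_expr Atom = EAtom"
| "constant_expr (Dot a b) = EDot (constant_expr a) (constant_expr b)"

lemma eval_constant_expr [simp]: "eval (constant_expr a) s = a"
  by (induction a) auto

lemma polytime_const: "polytime (\<lambda>_. c)"
  by (rule polytime_expr[where e = "constant_expr (code c)"]) (auto intro: polybounded_intros)

lemma polytime_comp: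
  assumes "polytime g" "polytime f"
  shows "polytime (\<lambda>x. g (f x))"
proof -
  obtain c B where c: "computes c f B" "polybounded B" using assms(2) by (rule polytimeE)
  obtain d D where d: "computes d g D" "polybounded D" using assms(1) by (rule polytimeE)
  note size = assms[THEN polybounded_size_polytime]
  show ?thesis
  proof (rule polytimeI[where c = "Seq c d" and B = "\<lambda>x. B x + D (f x)"])
    show "computes (Seq c d) (\<lambda>x. g (f x)) (\<lambda>x. B x + D (f x))"
      by (intro computesI runs_within_computes_Seq[OF c(1)] runs_within_computes[OF d(1)]) auto
    show "polybounded (\<lambda>x. B x + D (f x))"
      by (intro polybounded_add c(2) polybounded_comp[OF d(2) size(2)])
    show "polybounded (\<lambda>x. size (code (g (f x))))"
      by (rule polybounded_comp[OF size])
  qed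
qed

lemma polytime_fst_snd: "polytime fst" "polytime snd"
  by (rule polytime_expr[where e = "EHd (EVar 0)"], simp add: code_prod_eq,
      rule polybounded_mono[OF polybounded_size], simp add: code_prod_eq)
    (rule polytime_expr[where e = "ETl (EVar 0)"], simp add: code_prod_eq,
      rule polybounded_mono[OF polybounded_size], simp add: code_prod_eq)

lemmas polytime_fst = polytime_comp[OF polytime_fst_snd(1)]
  and polytime_snd = polytime_comp[OF polytime_fst_snd(2)]

lemma polytime_Pair:
  assumes "polytime f" "polytime g"
  shows "polytime (\<lambda>x. (f x, g x))"
proof -
  obtain c B where c: "computes c f B" "polybounded B" using assms(1) by (rule polytimeE)
  obtain d D where d: "computes d g D" "polybounded D" using assms(2) by (rule polytimeE)
  obtain k where k: "0 < k" "\<forall>v\<ge>k. v \<notin> writes c \<and> v \<notin> writes d"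
    using ex_fresh_variables by blast
  let ?prog = "Seq (Assign k (EVar 0)) (Seq c (Seq (Assign (Suc k) (EVar 0))
    (Seq (Assign 0 (EVar k)) (Seq d (Assign 0 (EDot (EVar (Suc k)) (EVar 0)))))))"
  let ?time = "\<lambda>x. 2 + (B x + (2 + (2 + (D x + 4))))"
  show ?thesis
  proof (rule polytimeI[where c = ?prog and B = ?time])
    show "computes ?prog (\<lambda>x. (f x, g x)) ?time"
      by (intro computesI runs_within_Assign_Seq runs_within_computes_Seq[OF c(1)]
          runs_within_computes_Seq[OF d(1)] runs_within_Assign) (use k in auto)
    show "polybounded ?time" by (intro polybounded_intros c d)
    have "polybounded (\<lambda>x. size (code (f x)) + size (code (g x)) + 1)"
      by (intro polybounded_intros assms)
    then show "polybounded (\<lambda>x. size (code (f x, g x)))" by simp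
  qed
qed

lemma polytime_If_pair:
  assumes "polytime f" "polytime g"
  shows "polytime (\<lambda>z. if snd z then f (fst z) else g (fst z))"
proof -
  obtain c B where c: "computes c f B" "polybounded B" using assms(1) by (rule polytimeE)
  obtain d D where d: "computes d g D" "polybounded D" using assms(2) by (rule polytimeE)
  let ?prog = "Seq (Assign 1 (ETl (EVar 0))) (Seq (Assign 0 (EHd (EVar 0))) (If (EVar 1) c d))"
  let ?time = "\<lambda>z :: 'a \<times> bool. 3 + (3 + (cost (EVar 1) + (B (fst z) + D (fst z)) + 1))"
  show ?thesis
  proof (rule polytimeI[where c = ?prog and B = ?time])
    show "computes ?prog (\<lambda>z. if snd z then f (fst z) else g (fst z)) ?time"
    proof (rule computesI)
      fix z :: "'a \<times> bool" and s :: store assume s: "s 0 = code z"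
      let ?s = "s(1 := code (snd z), 0 := code (fst z))"
      have "runs_within (If (EVar 1) c d) ?s (cost (EVar 1) + (B (fst z) + D (fst z)) + 1)
        (\<lambda>s'. s' 0 = code (if snd z then f (fst z) else g (fst z)))"
      proof (rule runs_within_If)
        assume "eval (EVar 1) ?s \<noteq> Atom"
        then have "snd z" by (cases "snd z") auto
        then show "runs_within c ?s (B (fst z) + D (fst z))
            (\<lambda>s'. s' 0 = code (if snd z then f (fst z) else g (fst z)))"
          by (intro runs_within_computes[OF c(1), of _ "fst z"]) auto
      next
        assume "eval (EVar 1) ?s = Atom"
        then have "\<not> snd z" by (cases "snd z") auto
        then show "runs_within d ?s (B (fst z) + D (fst z))
            (\<lambda>s'. s' 0 = code (if snd z then f (fst z) else g (fst z)))"
          by (intro runs_within_computes[OF d(1), of _ "fst z"]) auto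
      qed
      then show "runs_within ?prog s (?time z) 
        (\<lambda>s'. s' 0 = code (if snd z then f (fst z) else g (fst z)))"
        using s by (intro runs_within_Assign_Seq) (simp_all add: code_prod_eq)
    qed
    show "polybounded ?time" by (intro polybounded_intros polybounded_fst c d)
    have "polybounded (\<lambda>z :: 'a \<times> bool. size (code (f (fst z))) + size (code (g (fst z))))"
      by (intro polybounded_add polybounded_fst polybounded_size_polytime assms)
    then show "polybounded (\<lambda>z. size (code (if snd z then f (fst z) else g (fst z))))"
      by (rule polybounded_mono) auto
  qed
qed

lemma polytime_If:
  assumes "polytime b" "polytime f" "polytime g"
  shows "polytime (\<lambda>x. if b x then f x else g x)"
  using polytime_comp[OF polytime_If_pair[OF assms(2,3)] polytime_Pair[OF polytime_ident assms(1)]]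
  unfolding fst_conv snd_conv .

lemma polytime_case_list_pair:
  assumes "polytime f" "polytime g"
  shows "polytime (\<lambda>z. case snd z of [] \<Rightarrow> f (fst z) | y # ys \<Rightarrow> g (fst z, y, ys))"
proof -
  obtain c B where c: "computes c f B" "polybounded B" using assms(1) by (rule polytimeE)
  obtain d D where d: "computes d g D" "polybounded D" using assms(2) by (rule polytimeE)
  note size = assms[THEN polybounded_size_polytime]
  let ?h = "\<lambda>z. case snd z of [] \<Rightarrow> f (fst z) | y # ys \<Rightarrow> g (fst z, y, ys)"
  let ?prog = "If (ETl (EVar 0)) d (Seq (Assign 0 (EHd (EVar 0))) c)"
  let ?T = "\<lambda>z. case snd z of [] \<Rightarrow> 3 + B (fst z) | y # ys \<Rightarrow> D (fst z, y, ys)"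
  let ?time = "\<lambda>z. cost (ETl (EVar 0)) + ?T z + 1"
  show ?thesis
  proof (rule polytimeI[where c = ?prog and B = ?time])
    show "computes ?prog ?h ?time"
    proof (intro computesI runs_within_If)
      fix z :: "'a \<times> 'c list" and s :: store assume s: "s 0 = code z"
      {
        assume "eval (ETl (EVar 0)) s \<noteq> Atom"
        then obtain y ys where "snd z = y # ys" using s by (cases "snd z") (auto simp: code_prod_eq)
        then show "runs_within d s (?T z) (\<lambda>s'. s' 0 = code (?h z))"
          using s by (intro runs_within_computes[OF d(1), of _ "(fst z, y, ys)"])
            (auto simp: code_prod_eq)
      next
        assume "eval (ETl (EVar 0)) s = Atom"
        then have "snd z = []" using s by (cases "snd z") (auto simp: code_prod_eq)
        moreover have "runs_within (Seq (Assign 0 (EHd (EVar 0))) c) s (3 + B (fst z))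
            (\<lambda>s'. s' 0 = code (f (fst z)))"
          using s by (intro runs_within_Assign_Seq runs_within_computes[OF c(1), of _ "fst z"])
            (auto simp: code_prod_eq)
        ultimately show
          "runs_within (Seq (Assign 0 (EHd (EVar 0))) c) s (?T z) (\<lambda>s'. s' 0 = code (?h z))"
          by simp
      }
    qed
    show "polybounded ?time"
      by (intro polybounded_intros polybounded_case_list c d)
    show "polybounded (\<lambda>z. size (code (?h z)))"
      by (rule polybounded_mono[OF polybounded_case_list[OF size]]) (simp split: list.split)
  qed
qed

lemma polytime_case_list:
  assumes "polytime xs" "polytime f" "polytime (\<lambda>z. g (fst z) (fst (snd z)) (snd (snd z)))"
  shows "polytime (\<lambda>x. case xs x of [] \<Rightarrow> f x | y # ys \<Rightarrow> g x y ys)"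
  using polytime_comp[OF polytime_case_list_pair[OF assms(2,3)]
    polytime_Pair[OF polytime_ident assms(1)]]
  unfolding fst_conv snd_conv .

lemma polytime_replicate_unit: "polytime n \<Longrightarrow> polytime (\<lambda>x. replicate (n x) ())"
  by (erule polytime_same_code) (rule code_replicate_unit)

lemma polytime_case_nat:
  assumes "polytime n" "polytime f" "polytime (\<lambda>z. g (fst z) (snd z))"
  shows "polytime (\<lambda>x. case n x of 0 \<Rightarrow> f x | Suc m \<Rightarrow> g x m)"
proof -
  have "polytime (\<lambda>z :: 'a \<times> unit \<times> unit list. length (snd (snd z)))"
    by (rule polytime_same_code[OF polytime_snd[OF polytime_snd[OF polytime_ident]]])
      (rule code_length_unit)
  then have "polytime (\<lambda>z :: 'a \<times> unit \<times> unit list. g (fst z) (length (snd (snd z))))"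
    using polytime_comp[OF assms(3) polytime_Pair[OF polytime_fst[OF polytime_ident]]] by simp
  then have "polytime (\<lambda>x. case replicate (n x) () of [] \<Rightarrow> f x | y # ys \<Rightarrow> g x (length ys))"
    by (intro polytime_case_list polytime_replicate_unit assms)
  then show ?thesis
    by (rule polytime_cong) (simp split: nat.split)
qed

lemma polytime_Cons: "polytime x \<Longrightarrow> polytime xs \<Longrightarrow> polytime (\<lambda>e. x e # xs e)"
  by (rule polytime_same_code[OF polytime_Pair]) auto

lemma polytime_Suc: "polytime n \<Longrightarrow> polytime (\<lambda>e. Suc (n e))"
  by (rule polytime_same_code[OF polytime_Pair[OF polytime_const[of "()"]]]) auto

lemma runs_within_foldl_loop:
  fixes xs :: "'c::codable list" and st :: "'a::codable \<Rightarrow> 'b::codable \<Rightarrow> 'c \<Rightarrow> 'b" and s :: store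
  defines "body c k \<equiv> Seq (Assign 0 (EDot (EVar k) (EDot (EVar 0) (EHd (EVar (Suc k))))))
    (Seq c (Assign (Suc k) (ETl (EVar (Suc k)))))"
  assumes k: "0 < k" "\<forall>v\<ge>k. v \<notin> writes c"
    and c: "computes c (\<lambda>z. st (fst z) (fst (snd z)) (snd (snd z))) B"
    and time: "\<And>i. i < length xs \<Longrightarrow> B (e, foldl (st e) acc (take i xs), xs ! i) \<le> n"
    and s: "s 0 = code acc" "s k = code e" "s (Suc k) = code xs"
  shows "runs_within (While (EVar (Suc k)) (body c k)) s (length xs * (n + 12) + 2)
    (\<lambda>s'. s' 0 = code (foldl (st e) acc xs))"
  using time s
proof (induction xs arbitrary: acc s)
  case Nil
  then show ?case by (intro runs_within_While_exit) auto
next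
  case (Cons x xs)
  let ?P = "\<lambda>s'. s' 0 = code (st e acc x) \<and> s' k = code e \<and> s' (Suc k) = code xs"
  have "runs_within (body c k) s (7 + (B (e, acc, x) + 3)) ?P"
    unfolding body_def using k Cons.prems(2-)
    by (intro runs_within_Assign_Seq runs_within_computes_Seq[OF c] runs_within_Assign) auto
  moreover have "runs_within (While (EVar (Suc k)) (body c k)) s' (length xs * (n + 12) + 2)
      (\<lambda>s'. s' 0 = code (foldl (st e) (st e acc x) xs))" if "?P s'" for s'
  proof (rule Cons.IH)
    show "B (e, foldl (st e) (st e acc x) (take i xs), xs ! i) \<le> n" if "i < length xs" for i
      using Cons.prems(1)[of "Suc i"] that by simp
  qed (use that in auto)
  ultimately have "runs_within (While (EVar (Suc k)) (body c k)) s
      (cost (EVar (Suc k)) + (7 + (B (e, acc, x) + 3)) + (length xs * (n + 12) + 2) + 1)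
      (\<lambda>s'. s' 0 = code (foldl (st e) (st e acc x) xs))"
    using Cons.prems(4) by (intro runs_within_While_step[where P = ?P]) auto
  then show ?case
    by (rule runs_within_mono) (use Cons.prems(1)[of 0] in auto)
qed

text \<open>The step function is given in terms of projections because \<open>intro\<close> with the rules below
  does not see through tuple patterns.\<close>

lemma polytime_foldl:
  assumes st: "polytime (\<lambda>z. st (fst z) (fst (snd z)) (snd (snd z)))"
    and "polytime init" "polytime xs" "polybounded b"
    and b: "\<And>e i. i \<le> length (xs e) \<Longrightarrow> size (code (foldl (st e) (init e) (take i (xs e)))) \<le> b e"
  shows "polytime (\<lambda>e. foldl (st e) (init e) (xs e))"
proof -
  obtain c B where c: "computes c (\<lambda>z. st (fst z) (fst (snd z)) (snd (snd z))) B"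
    and B: "polybounded B"
    using st by (rule polytimeE)
  obtain d where d: "\<And>z. B z \<le> d * (size (code z) + 1) ^ d" using polyboundedE[OF B] by blast
  have "polytime (\<lambda>e. (e, init e, xs e))" by (intro polytime_Pair polytime_ident assms)
  then obtain c0 B0 where c0: "computes c0 (\<lambda>e. (e, init e, xs e)) B0" "polybounded B0"
    by (rule polytimeE)
  obtain k where k: "0 < k" "\<forall>v\<ge>k. v \<notin> writes c"
    using ex_fresh_variables[of c c] by blast
  let ?loop = "While (EVar (Suc k))
      (Seq (Assign 0 (EDot (EVar k) (EDot (EVar 0) (EHd (EVar (Suc k))))))
    (Seq c (Assign (Suc k) (ETl (EVar (Suc k))))))"
  let ?prog = "Seq c0 (Seq (Assign k (EHd (EVar 0))) (Seq (Assign (Suc k) (ETl (ETl (EVar 0))))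
    (Seq (Assign 0 (EHd (ETl (EVar 0)))) ?loop)))"
  let ?n = "\<lambda>e. d * (size (code e) + b e + size (code (xs e)) + 3) ^ d"
  let ?time = "\<lambda>e. B0 e + (3 + (4 + (4 + (length (xs e) * (?n e + 12) + 2))))"
  have step_time: "B (e, foldl (st e) (init e) (take i (xs e)), xs e ! i) \<le> ?n e"
    if "i < length (xs e)" for e i
  proof -
    have "size (code (e, foldl (st e) (init e) (take i (xs e)), xs e ! i)) + 1 \<le>
        size (code e) + b e + size (code (xs e)) + 3"
      using b[of i e] that size_code_mem[of "xs e ! i" "xs e"] by simp
    then show ?thesis
      using d by (elim order_trans[OF _ mult_left_mono[OF power_mono], rotated]) auto
  qed
  show ?thesis
  proof (rule polytimeI[where c = ?prog and B = ?time])
    show "computes ?prog (\<lambda>e. foldl (st e) (init e) (xs e)) ?time"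
      by (intro computesI runs_within_computes_Seq[OF c0(1)] runs_within_Assign_Seq
          runs_within_foldl_loop[OF k c step_time]) (use k in auto)
    show "polybounded ?time" by (intro polybounded_intros c0 assms)
    show "polybounded (\<lambda>e. size (code (foldl (st e) (init e) (xs e))))"
      by (rule polybounded_mono[OF \<open>polybounded b\<close>]) (use b[OF order_refl] in simp)
  qed
qed

named_theorems polytime_intros

lemmas [polytime_intros] = polytime_ident polytime_const polytime_fst polytime_snd polytime_Pair
  polytime_If polytime_case_list polytime_case_nat polytime_Cons polytime_Suc polytime_replicate_unit

subsection \<open>Lists\<close>

lemma polytime_conj [polytime_intros]: "polytime a \<Longrightarrow> polytime b \<Longrightarrow> polytime (\<lambda>e. a e \<and> b e)"
  by (rule polytime_cong[OF polytime_If[of a b "\<lambda>_. False"]]) (auto intro: polytime_const)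

lemma polytime_not [polytime_intros]: "polytime a \<Longrightarrow> polytime (\<lambda>e. \<not> a e)"
  by (rule polytime_cong[OF polytime_If[of a "\<lambda>_. False" "\<lambda>_. True"]]) (auto intro: polytime_const)

lemma polytime_of_bool [polytime_intros]: "polytime a \<Longrightarrow> polytime (\<lambda>e. of_bool (a e) :: nat)"
  unfolding of_bool_def by (intro polytime_intros)

lemma foldl_Cons_eq_rev_append: "foldl (\<lambda>acc x. f x # acc) acc xs = rev (map f xs) @ acc"
  by (induction xs arbitrary: acc) auto

lemma polytime_rev_append:
  assumes "polytime xs" "polytime ys"
  shows "polytime (\<lambda>e. rev (xs e) @ ys e)"
proof -
  have "polytime (\<lambda>e. foldl (\<lambda>acc x. x # acc) (ys e) (xs e))"
  proof (rule polytime_foldl[where b = "\<lambda>e. size (code (xs e)) + size (code (ys e))"])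
    show "size (code (foldl (\<lambda>acc x. x # acc) (ys e) (take i (xs e)))) \<le>
        size (code (xs e)) + size (code (ys e))" for i e
      using size_code_take[of i "xs e"] by (simp add: foldl_Cons_eq_rev_append)
  qed (intro polytime_intros polybounded_intros assms)+
  then show ?thesis by (simp add: foldl_Cons_eq_rev_append)
qed

lemma polytime_rev [polytime_intros]: "polytime xs \<Longrightarrow> polytime (\<lambda>e. rev (xs e))"
  using polytime_rev_append[of xs "\<lambda>_. []"] by (simp add: polytime_const)

lemma polytime_append [polytime_intros]: "polytime xs \<Longrightarrow> polytime ys \<Longrightarrow> polytime (\<lambda>e. xs e @ ys e)"
  using polytime_rev_append[of "\<lambda>e. rev (xs e)" ys] by (simp add: polytime_rev)

lemma polytime_map [polytime_intros]:
  assumes f: "polytime (\<lambda>z. f (fst z) (snd z))" and xs: "polytime xs"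
  shows "polytime (\<lambda>e. map (f e) (xs e))"
proof -
  obtain d where d: "\<And>z. size (code (f (fst z) (snd z))) \<le> d * (size (code z) + 1) ^ d"
    using polyboundedE[OF polybounded_size_polytime[OF f]] by blast
  let ?m = "\<lambda>e. d * (size (code e) + size (code (xs e)) + 1 + 1) ^ d"
  have "polytime (\<lambda>e. foldl (\<lambda>acc x. f e x # acc) [] (xs e))"
  proof (rule polytime_foldl[where b = "\<lambda>e. length (xs e) * (?m e + 1)"])
    show "polybounded (\<lambda>e. length (xs e) * (?m e + 1))" by (intro polybounded_intros xs)
    fix e i
    have "size (code (map (f e) (take i (xs e)))) \<le> length (map (f e) (take i (xs e))) * (?m e + 1)"
    proof (rule size_code_list_le)
      fix y assume "y \<in> set (map (f e) (take i (xs e)))"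
      then obtain x where x: "x \<in> set (xs e)" "y = f e x" by (auto dest: in_set_takeD)
      have "size (code y) \<le> d * (size (code (e, x)) + 1) ^ d" using d[of "(e, x)"] x by simp
      also have "\<dots> \<le> ?m e" by (rule poly_bound_mono) (use size_code_mem[OF x(1)] in auto)
      finally show "size (code y) \<le> ?m e" .
    qed
    also have "\<dots> \<le> length (xs e) * (?m e + 1)" by (intro mult_right_mono) auto
    finally show "size (code (foldl (\<lambda>acc x. f e x # acc) [] (take i (xs e)))) \<le>
        length (xs e) * (?m e + 1)"
      by (simp add: foldl_Cons_eq_rev_append)
    have "polytime (\<lambda>z :: 'a \<times> 'c list \<times> 'b. f (fst z) (snd (snd z)))"
      using polytime_comp[OF f, of "\<lambda>z. (fst z, snd (snd z))"] by (simp add: polytime_intros)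
    then show "polytime (\<lambda>z :: 'a \<times> 'c list \<times> 'b. f (fst z) (snd (snd z)) # fst (snd z))"
      by (intro polytime_intros)
  qed (intro polytime_intros xs)+
  then have "polytime (\<lambda>e. rev (map (f e) (xs e)))" by (simp add: foldl_Cons_eq_rev_append)
  from polytime_rev[OF this] show ?thesis by simp
qed

lemma polytime_concat [polytime_intros]:
  assumes "polytime xss"
  shows "polytime (\<lambda>e. concat (xss e))"
proof -
  have concat: "foldl (\<lambda>acc xs. acc @ xs) acc yss = acc @ concat yss"
    for acc and yss :: "'b list list"
    by (induction yss arbitrary: acc) auto
  have "polytime (\<lambda>e. foldl (\<lambda>acc xs. acc @ xs) [] (xss e))"
  proof (rule polytime_foldl[where b = "\<lambda>e. size (code (xss e))"])
    show "size (code (foldl (\<lambda>acc xs. acc @ xs) [] (take i (xss e)))) \<le> size (code (xss e))" for i e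
      using order_trans[OF size_code_concat size_code_take] by (simp add: concat)
  qed (intro polytime_intros polybounded_intros assms)+
  then show ?thesis by (simp add: concat)
qed

lemma polytime_filter [polytime_intros]:
  assumes "polytime (\<lambda>z. P (fst z) (snd z))" "polytime xs"
  shows "polytime (\<lambda>e. filter (P e) (xs e))"
proof -
  have "polytime (\<lambda>e. concat (map (\<lambda>x. if P e x then [x] else []) (xs e)))"
    by (intro polytime_intros assms)
  moreover have "concat (map (\<lambda>x. if P e x then [x] else []) ys) = filter (P e) ys" for e ys
    by (induction ys) auto
  ultimately show ?thesis by simp
qed

lemma polytime_list_all [polytime_intros]:
  assumes "polytime (\<lambda>z. P (fst z) (snd z))" "polytime xs"
  shows "polytime (\<lambda>e. list_all (P e) (xs e))"
proof -
  have "list_all (P e) ys \<longleftrightarrow> (case filter (\<lambda>x. \<not> P e x) ys of [] \<Rightarrow> True | _ # _ \<Rightarrow> False)" for e ys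
    by (induction ys) auto
  then show ?thesis by (simp only:) (intro polytime_intros assms)
qed

lemma polytime_length [polytime_intros]: "polytime xs \<Longrightarrow> polytime (\<lambda>e. length (xs e))"
  by (rule polytime_same_code[of "\<lambda>e. map (\<lambda>_. ()) (xs e)"], intro polytime_intros)
    (assumption, metis code_length_unit length_map)

lemma polytime_replicate [polytime_intros]:
  assumes "polytime n" "polytime x"
  shows "polytime (\<lambda>e. replicate (n e) (x e))"
proof -
  have "polytime (\<lambda>e. map (\<lambda>_. x e) (replicate (n e) ()))"
    by (intro polytime_intros assms(1) assms(2)[THEN polytime_comp])
  then show ?thesis by simp
qed

lemma polytime_funpow:
  fixes f :: "'a::codable \<Rightarrow> 'b::codable \<Rightarrow> 'b"
  assumes f: "polytime (\<lambda>z. f (fst z) (snd z))" and "polytime a" "polytime n" "polybounded b"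
    and b: "\<And>e i. i \<le> n e \<Longrightarrow> size (code ((f e ^^ i) (a e))) \<le> b e"
  shows "polytime (\<lambda>e. (f e ^^ n e) (a e))"
proof -
  have foldl: "foldl (\<lambda>acc _. g acc) c (replicate m ()) = (g ^^ m) c" for g :: "'b \<Rightarrow> 'b" and c m
    by (induction m arbitrary: c) (auto simp: funpow_swap1)
  have "polytime (\<lambda>e. foldl (\<lambda>acc _. f e acc) (a e) (replicate (n e) ()))"
  proof (rule polytime_foldl[OF _ _ _ \<open>polybounded b\<close>])
    show "polytime (\<lambda>z :: 'a \<times> 'b \<times> unit. f (fst z) (fst (snd z)))"
      using polytime_comp[OF f, of "\<lambda>z. (fst z, fst (snd z))"] by (simp add: polytime_intros)
    show "size (code (foldl (\<lambda>acc _. f e acc) (a e) (take i (replicate (n e) ())))) \<le> b e"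
      if "i \<le> length (replicate (n e) ())" for e i
      using that b[of i e] by (simp add: foldl take_replicate min_def)
  qed (intro polytime_intros assms)+
  then show ?thesis unfolding foldl .
qed

lemma polytime_drop [polytime_intros]:
  assumes "polytime n" "polytime xs"
  shows "polytime (\<lambda>e. drop (n e) (xs e))"
proof -
  have tl: "(\<lambda>ys. case ys of [] \<Rightarrow> [] | _ # zs \<Rightarrow> zs) = (tl :: 'b list \<Rightarrow> 'b list)"
    by (auto simp: fun_eq_iff split: list.split)
  have drop: "(tl ^^ n) ys = drop n ys" for n and ys :: "'b list"
    by (induction n) (auto simp: drop_Suc tl_drop)
  have "polytime (\<lambda>e. ((\<lambda>ys. case ys of [] \<Rightarrow> [] | _ # zs \<Rightarrow> zs) ^^ n e) (xs e))"
    by (rule polytime_funpow[where b = "\<lambda>e. size (code (xs e))"])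
      ((intro polytime_intros polybounded_intros assms)+, simp add: tl drop size_code_drop)
  then show ?thesis unfolding tl drop .
qed

lemma polytime_nth_default [polytime_intros]:
  assumes "polytime d" "polytime xs" "polytime n"
  shows "polytime (\<lambda>e. nth_default (d e) (xs e) (n e))"
proof -
  have "nth_default d ys n = (case drop n ys of [] \<Rightarrow> d | y # _ \<Rightarrow> y)" for d n and ys :: "'b list"
    by (auto simp: nth_default_def Cons_nth_drop_Suc[symmetric] split: list.split)
  then show ?thesis by (simp only:) (intro polytime_intros assms)
qed

subsection \<open>Arithmetic\<close>

lemma polytime_add [polytime_intros]:
  assumes "polytime f" "polytime g"
  shows "polytime (\<lambda>e. f e + g e :: nat)"
proof -
  have Suc: "(Suc ^^ n) m = m + n" for m n by (induction n) auto
  have "polytime (\<lambda>e. (Suc ^^ g e) (f e))"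
    by (rule polytime_funpow[where b = "\<lambda>e. f e + g e"])
      ((intro polytime_intros polybounded_intros assms)+, simp add: Suc)
  then show ?thesis unfolding Suc .
qed

lemma polytime_mult [polytime_intros]:
  assumes "polytime f" "polytime g"
  shows "polytime (\<lambda>e. f e * g e :: nat)"
proof -
  have mult: "((\<lambda>a. a + m) ^^ n) 0 = m * n" for m n :: nat by (induction n) auto
  have "polytime (\<lambda>e. ((\<lambda>a. a + f e) ^^ g e) 0)"
    by (rule polytime_funpow[where b = "\<lambda>e. f e * g e"])
      ((intro polytime_intros polybounded_intros assms assms(1)[THEN polytime_comp])+, simp add: mult)
  then show ?thesis unfolding mult .
qed

lemma polytime_diff [polytime_intros]:
  assumes "polytime f" "polytime g"
  shows "polytime (\<lambda>e. f e - g e :: nat)"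
proof -
  have diff: "((\<lambda>a. case a of 0 \<Rightarrow> 0 | Suc b \<Rightarrow> b) ^^ n) m = m - n" for m n :: nat
    by (induction n) (auto split: nat.split)
  have "polytime (\<lambda>e. ((\<lambda>a. case a of 0 \<Rightarrow> 0 | Suc b \<Rightarrow> b) ^^ g e) (f e))"
    by (rule polytime_funpow[where b = f])
      ((intro polytime_intros polybounded_intros assms)+, simp add: diff)
  then show ?thesis unfolding diff .
qed

lemma polytime_nat_le [polytime_intros]:
  assumes "polytime f" "polytime g"
  shows "polytime (\<lambda>e. f e \<le> (g e :: nat))"
proof -
  have "m \<le> n \<longleftrightarrow> (case m - n of 0 \<Rightarrow> True | Suc _ \<Rightarrow> False)" for m n :: nat
    by (auto split: nat.split)
  then show ?thesis by (simp only:) (intro polytime_intros assms)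
qed

lemma polytime_nat_less [polytime_intros]:
  "polytime f \<Longrightarrow> polytime g \<Longrightarrow> polytime (\<lambda>e. f e < (g e :: nat))"
  unfolding Suc_le_eq[symmetric] by (intro polytime_intros)

lemma polytime_nat_eq [polytime_intros]:
  "polytime f \<Longrightarrow> polytime g \<Longrightarrow> polytime (\<lambda>e. f e = (g e :: nat))"
  unfolding order_eq_iff by (intro polytime_intros)

lemma polytime_upt [polytime_intros]:
  assumes "polytime f" "polytime g"
  shows "polytime (\<lambda>e. [f e..<g e])"
proof -
  have upt: "((\<lambda>a. a @ [m + length a]) ^^ n) [] = [m..<m + n]" for m n :: nat
    by (induction n) auto
  let ?b = "\<lambda>e. (g e - f e) * (f e + (g e - f e) + 1)"
  have "polytime (\<lambda>e. ((\<lambda>a. a @ [f e + length a]) ^^ (g e - f e)) [])"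
  proof (rule polytime_funpow[where b = ?b])
    show "polybounded ?b" by (intro polybounded_intros polytime_intros assms)
    fix e i assume i: "i \<le> g e - f e"
    have "size (code [f e..<f e + i]) \<le> length [f e..<f e + i] * (f e + (g e - f e) + 1)"
      by (rule size_code_list_le) (use i in auto)
    also have "\<dots> \<le> ?b e" by (intro mult_right_mono) (use i in auto)
    finally show "size (code (((\<lambda>a. a @ [f e + length a]) ^^ i) [])) \<le> ?b e" unfolding upt .
  qed (intro polytime_intros assms assms(1)[THEN polytime_comp])+
  moreover have "((\<lambda>a. a @ [f e + length a]) ^^ (g e - f e)) [] = [f e..<g e]" for e
    unfolding upt by (cases "f e \<le> g e") auto
  ultimately show ?thesis by simp
qed

lemma polytime_mod [polytime_intros]:
  assumes "polytime f" "polytime g"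
  shows "polytime (\<lambda>e. f e mod g e :: nat)"
proof -
  have mod: "((\<lambda>a. if Suc a = m then 0 else Suc a) ^^ n) 0 = n mod m" for m n :: nat
    by (induction n) (auto simp: mod_Suc)
  have "polytime (\<lambda>e. ((\<lambda>a. if Suc a = g e then 0 else Suc a) ^^ f e) 0)"
  proof (rule polytime_funpow[where b = f])
    show "size (code (((\<lambda>a. if Suc a = g e then 0 else Suc a) ^^ i) 0)) \<le> f e" if "i \<le> f e" for e i
      unfolding mod using that by (simp add: order_trans[OF mod_less_eq_dividend])
  qed (intro polytime_intros polybounded_intros assms assms(2)[THEN polytime_comp])+
  then show ?thesis unfolding mod .
qed

lemma polytime_div [polytime_intros]:
  assumes "polytime f" "polytime g"
  shows "polytime (\<lambda>e. f e div g e :: nat)"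
proof -
  have div: "length (filter (\<lambda>i. Suc i mod m = 0) [0..<n]) = n div m" for m n :: nat
    by (induction n) (auto simp: div_Suc)
  have "polytime (\<lambda>e. length (filter (\<lambda>i. Suc i mod g e = 0) [0..<f e]))"
    by (intro polytime_intros assms(1) assms(2)[THEN polytime_comp])
  then show ?thesis unfolding div .
qed

lemma polytime_drop_bit [polytime_intros]:
  assumes "polytime i" "polytime n"
  shows "polytime (\<lambda>e. drop_bit (i e) (n e :: nat))"
proof -
  have drop_bit: "((\<lambda>a. a div 2) ^^ i) n = drop_bit i n" for n i :: nat
    by (induction i) (simp_all add: drop_bit_eq_div div_mult2_eq power_Suc2 del: power_Suc)
  have "polytime (\<lambda>e. ((\<lambda>a. a div 2) ^^ i e) (n e))"
    by (rule polytime_funpow[where b = n])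
      ((intro polytime_intros polybounded_intros assms)+, simp add: drop_bit drop_bit_eq_div)
  then show ?thesis unfolding drop_bit .
qed

lemma polytime_bit [polytime_intros]:
  "polytime n \<Longrightarrow> polytime i \<Longrightarrow> polytime (\<lambda>e. bit (n e :: nat) (i e))"
  unfolding bit_iff_odd_drop_bit odd_iff_mod_2_eq_one by (intro polytime_intros)

lemma less_floorlog_iff: "i < floorlog 2 n \<longleftrightarrow> 2 ^ i \<le> n"
proof (cases "n = 0")
  case False
  then have bounds: "2 ^ (floorlog 2 n - 1) \<le> n" "n < 2 ^ floorlog 2 n"
    using floorlog_bounds[of n 2] by auto
  show ?thesis
  proof
    assume "i < floorlog 2 n"
    then have "(2::nat) ^ i \<le> 2 ^ (floorlog 2 n - 1)" by (intro power_increasing) auto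
    then show "2 ^ i \<le> n" using bounds(1) by linarith
  next
    assume "2 ^ i \<le> n"
    with bounds(2) have "(2::nat) ^ i < 2 ^ floorlog 2 n" by linarith
    then show "i < floorlog 2 n" by (rule power_less_imp_less_exp[rotated]) simp
  qed
qed (simp add: floorlog_def)

lemma floorlog_le_self: "floorlog 2 n \<le> n"
proof (rule ccontr)
  assume "\<not> floorlog 2 n \<le> n"
  then have "2 ^ n \<le> n" by (simp only: less_floorlog_iff not_le)
  with less_exp[of n] show False using leD by blast
qed

lemma polytime_floorlog [polytime_intros]:
  assumes "polytime n"
  shows "polytime (\<lambda>e. floorlog 2 (n e))"
proof -
  have "length (filter (\<lambda>i. 0 < drop_bit i n) [0..<n]) = floorlog 2 n" for n :: nat
  proof -
    have nonzero: "0 < drop_bit i n \<longleftrightarrow> i < floorlog 2 n" for i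
      unfolding drop_bit_eq_div div_greater_zero_iff less_floorlog_iff by simp
    have "{i. 0 < drop_bit i n} \<inter> set [0..<n] = {..<floorlog 2 n}"
      unfolding nonzero using floorlog_le_self[of n] by auto
    then show ?thesis by (simp only: distinct_length_filter distinct_upt card_lessThan)
  qed
  moreover have "polytime (\<lambda>e. length (filter (\<lambda>i. 0 < drop_bit i (n e)) [0..<n e]))"
    by (intro polytime_intros assms[THEN polytime_comp])
  ultimately show ?thesis by (simp only:)
qed

definition pow2_above :: "nat \<Rightarrow> nat" where
  "pow2_above n = 2 ^ floorlog 2 n"

lemma less_pow2_above: "n < pow2_above n"
  using less_floorlog_iff[of "floorlog 2 n" n] by (simp add: pow2_above_def not_le)

lemma pow2_above_le: "pow2_above n \<le> 2 * n + 1"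
proof (cases "floorlog 2 n")
  case (Suc k)
  then have "2 ^ k \<le> n" using less_floorlog_iff[of k n] by simp
  then show ?thesis by (simp add: pow2_above_def Suc)
qed (simp add: pow2_above_def)

lemma polytime_pow2_above [polytime_intros]:
  assumes "polytime n"
  shows "polytime (\<lambda>e. pow2_above (n e))"
proof -
  have pow: "((\<lambda>a. a + a) ^^ i) 1 = (2::nat) ^ i" for i by (induction i) auto
  have "polytime (\<lambda>e. ((\<lambda>a. a + a) ^^ floorlog 2 (n e)) (1::nat))"
  proof (rule polytime_funpow[where b = "\<lambda>e. 2 * n e + 1"])
    show "size (code (((\<lambda>a. a + a) ^^ i) (1::nat))) \<le> 2 * n e + 1" if "i \<le> floorlog 2 (n e)" for e i
      using order_trans[OF power_increasing[OF that, of "2::nat"]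
        pow2_above_le[of "n e", unfolded pow2_above_def]]
      by (simp only: pow size_code_nat)
  qed (intro polytime_intros polybounded_intros assms)+
  then show ?thesis unfolding pow pow2_above_def .
qed

subsection \<open>Derived list functions\<close>

lemma polytime_take [polytime_intros]:
  assumes "polytime n" "polytime xs"
  shows "polytime (\<lambda>e. take (n e) (xs e))"
proof -
  have "rev (drop (length ys - n) (rev ys)) = take n ys" for n and ys :: "'b list"
    by (cases "n \<le> length ys") (simp_all add: rev_drop)
  then show ?thesis
    by (rule polytime_cong[rotated, OF sym]) (intro polytime_intros assms)
qed

lemma polytime_list_update [polytime_intros]:
  assumes "polytime xs" "polytime n" "polytime x"
  shows "polytime (\<lambda>e. (xs e)[n e := x e])"
proof -
  have "ys[n := y] = (if n < length ys then take n ys @ y # drop (Suc n) ys else ys)"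
    for n y and ys :: "'b list"
    by (auto simp: upd_conv_take_nth_drop list_update_beyond)
  then show ?thesis by (simp only:) (intro polytime_intros assms)
qed

lemma polytime_zip [polytime_intros]:
  assumes "polytime xs" "polytime ys"
  shows "polytime (\<lambda>e. zip (xs e) (ys e))"
proof -
  have zip: "zip xs ys = concat (map (\<lambda>i. case drop i xs of [] \<Rightarrow> [] | x # _ \<Rightarrow>
      (case drop i ys of [] \<Rightarrow> [] | y # _ \<Rightarrow> [(x, y)])) [0..<length xs])"
    for xs :: "'b list" and ys :: "'c list"
  proof (induction xs arbitrary: ys)
    case (Cons x xs)
    have "[0..<length (x # xs)] = 0 # map Suc [0..<length xs]"
      using upt_conv_Cons[of 0 "Suc (length xs)"] by (simp add: map_Suc_upt del: upt_Suc)
    then show ?case using Cons.IH[of "tl ys"]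
      by (cases ys) (auto simp: o_def split: list.split cong: list.case_cong)
  qed simp
  show ?thesis unfolding zip by (intro polytime_intros assms[THEN polytime_comp])
qed

subsection \<open>Binary numbers\<close>

abbreviation nat_of_bits :: "bits \<Rightarrow> nat" where
  "nat_of_bits \<equiv> horner_sum of_bool 2"

definition bits_of_nat :: "nat \<Rightarrow> nat \<Rightarrow> bits" where
  "bits_of_nat l n = map (bit n) [0..<l]"

lemma length_bits_of_nat [simp]: "length (bits_of_nat l n) = l"
  by (simp add: bits_of_nat_def)

lemma nat_of_bits_of_nat: "n < 2 ^ l \<Longrightarrow> nat_of_bits (bits_of_nat l n) = n"
  unfolding bits_of_nat_def by (simp add: horner_sum_bit_eq_take_bit take_bit_nat_eq_self)

lemma nat_of_bits_less: "nat_of_bits bs < 2 ^ length bs"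
  by (rule horner_sum_of_bool_2_less)

lemma nat_of_bits_replicate_False: "nat_of_bits (replicate n False) = 0"
  by (induction n) simp_all

lemma nat_of_bits_inj: "length bs = length cs \<Longrightarrow> nat_of_bits bs = nat_of_bits cs \<Longrightarrow> bs = cs"
proof (induction bs cs rule: list_induct2)
  case (Cons b bs c cs)
  from Cons.prems have "b = c \<and> nat_of_bits bs = nat_of_bits cs"
    by (cases b; cases c; simp; presburger)
  with Cons.IH show ?case by simp
qed simp

lemma polytime_bits_of_nat [polytime_intros]:
  assumes "polytime l" "polytime n"
  shows "polytime (\<lambda>e. bits_of_nat (l e) (n e))"
  unfolding bits_of_nat_def by (intro polytime_intros assms[THEN polytime_comp])

lemma polytime_nat_of_bits_mod [polytime_intros]:
  assumes "\<And>e. 0 < p e" "polytime p" "polytime bs"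
  shows "polytime (\<lambda>e. nat_of_bits (bs e) mod p e)"
proof -
  have "[k + 2 * (n mod m) = k + 2 * n] (mod m)" for k m n :: nat
    by (intro cong_add cong_mult) (simp_all add: cong_def)
  then have foldl: "foldl (\<lambda>a b. (of_bool b + 2 * a) mod m) 0 (rev cs) = nat_of_bits cs mod m"
    for m cs
    by (induction cs)
      (simp_all only: rev.simps foldl_append foldl.simps horner_sum_simps mod_0 cong_def)
  have "polytime (\<lambda>e. foldl (\<lambda>a b. (of_bool b + 2 * a) mod p e) 0 (rev (bs e)))"
  proof (rule polytime_foldl[where b = p])
    show "size (code (foldl (\<lambda>a b. (of_bool b + 2 * a) mod p e) 0 (take i (rev (bs e))))) \<le> p e"
      for e i
      using foldl[of "p e" "rev (take i (rev (bs e)))"] assms(1)[of e] by (simp add: less_imp_le)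
  qed (intro polytime_intros polybounded_intros assms(2,3) assms(2)[THEN polytime_comp])+
  then show ?thesis unfolding foldl .
qed

lemma polytime_nat_of_bits:
  assumes "polytime n" "polytime bs" "\<And>e. length (bs e) \<le> floorlog 2 (n e)"
  shows "polytime (\<lambda>e. nat_of_bits (bs e))"
proof -
  have less: "nat_of_bits (bs e) < pow2_above (n e)" for e
    unfolding pow2_above_def
    by (rule less_le_trans[OF nat_of_bits_less power_increasing[OF assms(3)]]) simp
  have "polytime (\<lambda>e. nat_of_bits (bs e) mod pow2_above (n e))"
    by (intro polytime_intros assms(1,2)) (simp add: pow2_above_def)
  then show ?thesis by (rule polytime_cong) (simp add: less)
qed

subsection \<open>Primes\<close>

definition primes_between :: "nat \<Rightarrow> nat \<Rightarrow> nat list" where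
  "primes_between a b = filter (\<lambda>n. 2 \<le> n \<and> list_all (\<lambda>d. 0 < n mod d) [2..<n]) [a..<b]"

lemma set_primes_between: "set (primes_between a b) = {p. prime p \<and> a \<le> p \<and> p < b}"
proof -
  have "list_all (\<lambda>d. 0 < p mod d) [2..<p] \<longleftrightarrow> (\<forall>n\<in>{1<..<p}. \<not> n dvd p)" for p
    by (auto simp: list_all_iff dvd_eq_mod_eq_0 Suc_le_eq)
  then show ?thesis
    unfolding primes_between_def prime_nat_iff' by (auto simp: Suc_le_eq)
qed

lemma polytime_primes_between [polytime_intros]:
  "polytime a \<Longrightarrow> polytime b \<Longrightarrow> polytime (\<lambda>e. primes_between (a e) (b e))"
  unfolding primes_between_def by (intro polytime_intros)

section \<open>Arithmetization of reachability\<close>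

datatype quantifier = Forall | Exists | Linearize

text \<open>Operators are listed from the outermost to the innermost one.  \<open>Mux z a c b\<close> sets variable \<open>z\<close>
  to variable \<open>c\<close> or \<open>a\<close> according to the value of variable \<open>b\<close>.  \<open>Check\<close> ends a repetition of the
  protocol: there the claim is compared with the innermost polynomial.\<close>

datatype op = Quant quantifier nat | Mux nat nat nat nat | Check

fun quant_bool :: "quantifier \<Rightarrow> bool \<Rightarrow> bool \<Rightarrow> bool \<Rightarrow> bool" where
  "quant_bool Forall t a b \<longleftrightarrow> a \<and> b"
| "quant_bool Exists t a b \<longleftrightarrow> a \<or> b"
| "quant_bool Linearize t a b \<longleftrightarrow> (if t then b else a)"

fun quant_poly :: "quantifier \<Rightarrow> int \<Rightarrow> int \<Rightarrow> int \<Rightarrow> int" where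
  "quant_poly Forall t a b = a * b"
| "quant_poly Exists t a b = a + (1 - a) * b"
| "quant_poly Linearize t a b = (1 - t) * a + t * b"

definition mux_poly :: "nat \<Rightarrow> nat \<Rightarrow> nat \<Rightarrow> int list \<Rightarrow> int" where
  "mux_poly a c b r = (1 - r ! b) * r ! a + r ! b * r ! c"

fun holds :: "(bits \<Rightarrow> bool) \<Rightarrow> op list \<Rightarrow> bits \<Rightarrow> bool" where
  "holds G [] y \<longleftrightarrow> G y"
| "holds G (Quant Q j # os) y \<longleftrightarrow>
     quant_bool Q (y ! j) (holds G os (y[j := False])) (holds G os (y[j := True]))"
| "holds G (Mux z a c b # os) y \<longleftrightarrow> holds G os (y[z := (if y ! b then y ! c else y ! a)])"
| "holds G (Check # os) y \<longleftrightarrow> G y"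

fun arith :: "(int list \<Rightarrow> int) \<Rightarrow> op list \<Rightarrow> int list \<Rightarrow> int" where
  "arith g [] r = g r"
| "arith g (Quant Q j # os) r =
    quant_poly Q (r ! j) (arith g os (r[j := 0])) (arith g os (r[j := 1]))"
| "arith g (Mux z a c b # os) r = arith g os (r[z := mux_poly a c b r])"
| "arith g (Check # os) r = g r"

fun op_below :: "nat \<Rightarrow> op \<Rightarrow> bool" where
  "op_below n (Quant Q j) \<longleftrightarrow> j < n"
| "op_below n (Mux z a c b) \<longleftrightarrow> z < n \<and> a < n \<and> c < n \<and> b < n"
| "op_below n Check \<longleftrightarrow> True"

lemma arith_append_Check: "Check \<notin> set os \<Longrightarrow> arith g (os @ Check # rest) = arith g os"
proof (induction os)
  case (Cons x os)
  then show ?case by (cases x) (auto simp: fun_eq_iff)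
qed (simp add: fun_eq_iff)

lemma quant_poly_of_bool:
  "quant_poly Q (of_bool t) (of_bool a) (of_bool b) = of_bool (quant_bool Q t a b)"
  by (cases Q) auto

lemma arith_of_bool:
  assumes "\<And>y. length y = n \<Longrightarrow> g (map of_bool y) = of_bool (G y)"
    and "\<forall>x \<in> set os. op_below n x" "length y = n"
  shows "arith g os (map of_bool y) = of_bool (holds G os y)"
  using assms(2,3)
proof (induction os arbitrary: y)
  case (Cons x os)
  have IH: "arith g os ((map of_bool y)[j := of_bool b]) = of_bool (holds G os (y[j := b]))" for j b
    using Cons.IH[of "y[j := b]"] Cons.prems by (simp add: map_update)
  show ?case
  proof (cases x)
    case (Quant Q j)
    have "(map of_bool y)[j := 0] = (map of_bool y)[j := of_bool False :: int]"
      "(map of_bool y)[j := 1] = (map of_bool y)[j := of_bool True :: int]" by simp_all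
    then show ?thesis
      using Quant Cons.prems
      by (simp only: arith.simps holds.simps IH quant_poly_of_bool[symmetric]) simp
  next
    case (Mux z a c b)
    then have "mux_poly a c b (map of_bool y) = of_bool (if y ! b then y ! c else y ! a)"
      using Cons.prems by (simp add: mux_poly_def)
    then show ?thesis using Mux by (simp only: arith.simps holds.simps IH)
  next
    case Check
    then show ?thesis using assms(1) Cons.prems by simp
  qed
qed (use assms(1) in simp)

subsection \<open>Congruences\<close>

definition respects_cong :: "int \<Rightarrow> nat \<Rightarrow> (int list \<Rightarrow> int) \<Rightarrow> bool" where
  "respects_cong p n f \<longleftrightarrow>
    (\<forall>r r'. length r = n \<longrightarrow> list_all2 (\<lambda>a b. [a = b] (mod p)) r r' \<longrightarrow> [f r = f r'] (mod p))"

lemma quant_poly_cong: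
  assumes "[t = t'] (mod p)" "[a = a'] (mod p)" "[b = b'] (mod p)"
  shows "[quant_poly Q t a b = quant_poly Q t' a' b'] (mod p)"
  using assms by (cases Q) (auto intro!: cong_add cong_mult cong_diff)

lemma respects_cong_arith:
  assumes "respects_cong p n g" "\<forall>x \<in> set os. op_below n x"
  shows "respects_cong p n (arith g os)"
  using assms(2)
proof (induction os)
  case Nil
  then show ?case using assms(1) by (simp add: respects_cong_def)
next
  case (Cons x os)
  show ?case unfolding respects_cong_def
  proof (intro allI impI)
    fix r r' assume r: "length r = n" "list_all2 (\<lambda>a b. [a = b] (mod p)) r r'"
    have update: "[arith g os (r[j := a]) = arith g os (r'[j := b])] (mod p)" if "[a = b] (mod p)"
      for j a b
    proof -
      have "respects_cong p n (arith g os)" using Cons by simp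
      moreover have "list_all2 (\<lambda>a b. [a = b] (mod p)) (r[j := a]) (r'[j := b])"
        using r(2) that by (rule list_all2_update_cong)
      ultimately show ?thesis using r(1) by (simp add: respects_cong_def)
    qed
    have nth: "[r ! j = r' ! j] (mod p)" if "j < n" for j
      using r that by (auto simp: list_all2_conv_all_nth)
    show "[arith g (x # os) r = arith g (x # os) r'] (mod p)"
      using Cons.prems assms(1) r
      by (cases x) (auto simp: respects_cong_def mux_poly_def
          intro!: quant_poly_cong cong_add cong_mult cong_diff update nth)
  qed
qed

subsection \<open>Degrees\<close>

definition affine_in :: "nat \<Rightarrow> (int list \<Rightarrow> int) \<Rightarrow> nat \<Rightarrow> bool" where
  "affine_in n f i \<longleftrightarrow>
    (\<forall>r X. length r = n \<longrightarrow> f (r[i := X]) = f (r[i := 0]) + X * (f (r[i := 1]) - f (r[i := 0])))"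

definition quadratic_in :: "nat \<Rightarrow> (int list \<Rightarrow> int) \<Rightarrow> nat \<Rightarrow> bool" where
  "quadratic_in n f i \<longleftrightarrow> (\<forall>r. length r = n \<longrightarrow> (\<exists>a b c. \<forall>X. f (r[i := X]) = a + b * X + c * X\<^sup>2))"

lemma affine_inD:
  "affine_in n f i \<Longrightarrow> length r = n \<Longrightarrow> 
    f (r[i := X]) = f (r[i := 0]) + X * (f (r[i := 1]) - f (r[i := 0]))"
  unfolding affine_in_def by blast

lemma quadratic_inI:
  "(\<And>r. length r = n \<Longrightarrow> \<exists>a b c. \<forall>X. f (r[i := X]) = a + b * X + c * X\<^sup>2) \<Longrightarrow> quadratic_in n f i"
  unfolding quadratic_in_def by blast

lemma affine_in_imp_quadratic_in:
  assumes "affine_in n f i"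
  shows "quadratic_in n f i"
proof (rule quadratic_inI)
  fix r :: "int list" assume r: "length r = n"
  have "f (r[i := X]) = f (r[i := 0]) + (f (r[i := 1]) - f (r[i := 0])) * X + 0 * X\<^sup>2" for X
    unfolding affine_inD[OF assms r, of X] by simp
  then show "\<exists>a b c. \<forall>X. f (r[i := X]) = a + b * X + c * X\<^sup>2" by blast
qed

lemma affine_in_update:
  assumes "affine_in n f i" "length r = n" "i \<noteq> j"
  shows "f (r[i := X, j := y]) =
      f (r[i := 0, j := y]) + X * (f (r[i := 1, j := y]) - f (r[i := 0, j := y]))"
  unfolding list_update_swap[OF assms(3)] by (rule affine_inD[OF assms(1)]) (simp add: assms(2))

lemma affine_in_Linearize_same: "j < n \<Longrightarrow> affine_in n (arith g (Quant Linearize j # os)) j"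
  unfolding affine_in_def by (auto simp: algebra_simps)

lemma affine_in_Linearize_other:
  assumes "affine_in n (arith g os) i" "i \<noteq> j"
  shows "affine_in n (arith g (Quant Linearize j # os)) i"
  unfolding affine_in_def
proof (intro allI impI)
  fix r :: "int list" and X assume "length r = n"
  note update = affine_in_update[OF assms(1) this assms(2), of X]
  show "arith g (Quant Linearize j # os) (r[i := X]) =
      arith g (Quant Linearize j # os) (r[i := 0]) +
      X * (arith g (Quant Linearize j # os) (r[i := 1]) - arith g (Quant Linearize j # os) (r[i := 0]))"
    using assms(2) by (simp add: nth_list_update update[of 0] update[of 1])
      (simp add: algebra_simps)
qed

lemma quadratic_in_Linearize_other:
  assumes "quadratic_in n (arith g os) i" "i \<noteq> j"
  shows "quadratic_in n (arith g (Quant Linearize j # os)) i"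
proof (rule quadratic_inI)
  fix r :: "int list" assume r: "length r = n"
  have "\<exists>a b c. \<forall>X. arith g os (r[i := X, j := y]) = a + b * X + c * X\<^sup>2" for y
    using assms(1) r unfolding list_update_swap[OF assms(2)] quadratic_in_def by simp
  then obtain a b c where abc: "\<And>y X. arith g os (r[i := X, j := y]) = a y + b y * X + c y * X\<^sup>2"
    by metis
  have "arith g (Quant Linearize j # os) (r[i := X]) = ((1 - r ! j) * a 0 + r ! j * a 1)
      + ((1 - r ! j) * b 0 + r ! j * b 1) * X + ((1 - r ! j) * c 0 + r ! j * c 1) * X\<^sup>2" for X
    using assms(2) abc by (simp add: nth_list_update) (simp add: algebra_simps)
  then show "\<exists>a b c. \<forall>X. arith g (Quant Linearize j # os) (r[i := X]) = a + b * X + c * X\<^sup>2" by blast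
qed

lemma quadratic_in_Forall_Exists:
  assumes "affine_in n (arith g os) i" "Q \<noteq> Linearize"
  shows "quadratic_in n (arith g (Quant Q j # os)) i"
proof (rule quadratic_inI)
  fix r :: "int list" assume r: "length r = n"
  obtain \<gamma> \<delta> where Q: "\<And>t a b. quant_poly Q t a b = \<gamma> * (a + b) + \<delta> * (a * b)"
  proof (cases Q)
    case Forall
    then show ?thesis by (intro that[of 0 1]) simp
  next
    case Exists
    then show ?thesis by (intro that[of 1 "-1"]) (simp add: algebra_simps)
  qed (use assms(2) in simp)
  define A B where "A = (\<lambda>y. arith g os (r[i := 0, j := y]))"
    and "B = (\<lambda>y. if i = j then 0
          else arith g os (r[i := 1, j := y]) - arith g os (r[i := 0, j := y]))"
  have "arith g os (r[i := X, j := y]) = A y + X * B y" for X y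
    unfolding A_def B_def using affine_in_update[OF assms(1) r, of j X y] by (cases "i = j") auto
  then have "arith g (Quant Q j # os) (r[i := X]) = (\<gamma> * (A 0 + A 1) + \<delta> * (A 0 * A 1)) +
      (\<gamma> * (B 0 + B 1) + \<delta> * (A 0 * B 1 + A 1 * B 0)) * X + \<delta> * (B 0 * B 1) * X\<^sup>2" for X
    by (simp add: Q algebra_simps power2_eq_square)
  then show "\<exists>a b c. \<forall>X. arith g (Quant Q j # os) (r[i := X]) = a + b * X + c * X\<^sup>2" by blast
qed

lemma quadratic_in_subst_same:
  assumes f: "affine_in n f i" and h: "\<And>r. length r = n \<Longrightarrow> \<exists>u v. \<forall>X. h (r[i := X]) = u + v * X"
  shows "quadratic_in n (\<lambda>r. f (r[i := h r])) i"
proof (rule quadratic_inI)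
  fix r :: "int list" assume r: "length r = n"
  obtain u v where uv: "\<And>X. h (r[i := X]) = u + v * X" using h[OF r] by blast
  let ?f0 = "f (r[i := 0])" and ?f1 = "f (r[i := 1])"
  have "f (r[i := X, i := h (r[i := X])]) =
      (?f0 + u * (?f1 - ?f0)) + v * (?f1 - ?f0) * X + 0 * X\<^sup>2" for X
    unfolding list_update_overwrite uv
    by (subst affine_inD[OF f r]) (simp add: algebra_simps)
  then show "\<exists>a b c. \<forall>X. f (r[i := X, i := h (r[i := X])]) = a + b * X + c * X\<^sup>2" by blast
qed

lemma quadratic_in_subst_other:
  assumes f: "affine_in n f i" "affine_in n f z" and "i \<noteq> z"
    and h: "\<And>r. length r = n \<Longrightarrow> \<exists>u v. \<forall>X. h (r[i := X]) = u + v * X"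
  shows "quadratic_in n (\<lambda>r. f (r[z := h r])) i"
proof (rule quadratic_inI)
  fix r :: "int list" assume r: "length r = n"
  obtain u v where uv: "\<And>X. h (r[i := X]) = u + v * X" using h[OF r] by blast
  define F where "F X Y = f (r[i := X, z := Y])" for X Y
  have in_z: "F X Y = F X 0 + Y * (F X 1 - F X 0)" for X Y
    unfolding F_def by (rule affine_inD[OF f(2)]) (simp add: r)
  have in_i: "F X Y = F 0 Y + X * (F 1 Y - F 0 Y)" for X Y
    unfolding F_def by (rule affine_in_update[OF f(1) r \<open>i \<noteq> z\<close>])
  have "F X (u + v * X) = F 0 0 + X * (F 1 0 - F 0 0) + (u + v * X) *
     ((F 0 1 + X * (F 1 1 - F 0 1)) - (F 0 0 + X * (F 1 0 - F 0 0)))" for X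
    using in_z[of X "u + v * X"] in_i[of X 0] in_i[of X 1] by simp
  then have "f (r[i := X, z := h (r[i := X])]) =
      (F 0 0 + u * (F 0 1 - F 0 0))
      + (F 1 0 - F 0 0 + u * (F 1 1 - F 0 1 - F 1 0 + F 0 0) + v * (F 0 1 - F 0 0)) * X
      + (v * (F 1 1 - F 0 1 - F 1 0 + F 0 0)) * X\<^sup>2" for X
    unfolding uv F_def[symmetric] by (simp add: algebra_simps power2_eq_square)
  then show "\<exists>a b c. \<forall>X. f (r[i := X, z := h (r[i := X])]) = a + b * X + c * X\<^sup>2" by blast
qed

lemma mux_poly_affine:
  assumes "a \<noteq> b" "c \<noteq> b" "a < length r" "b < length r" "c < length r"
  shows "\<exists>u v. \<forall>X. mux_poly a c b (r[i := X]) = u + v * X"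
proof (cases "i = b")
  case True
  have "mux_poly a c b (r[i := X]) = r ! a + (r ! c - r ! a) * X" for X
    using assms True by (simp add: mux_poly_def algebra_simps)
  then show ?thesis by blast
next
  case False
  define u v where
    "u = (if a = i then 0 else (1 - r ! b) * r ! a) + (if c = i then 0 else r ! b * r ! c)"
    and "v = (if a = i then 1 - r ! b else 0) + (if c = i then r ! b else 0)"
  have "mux_poly a c b (r[i := X]) = u + v * X" for X
    using assms False by (auto simp: mux_poly_def u_def v_def nth_list_update algebra_simps)
  then show ?thesis by blast
qed

lemma quadratic_in_Mux:
  assumes affine: "\<And>i. i < n \<Longrightarrow> affine_in n (arith g os) i" and "i < n"
    and mux: "z < n" "a < n" "c < n" "b < n" "a \<noteq> b" "c \<noteq> b"
  shows "quadratic_in n (arith g (Mux z a c b # os)) i"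
proof -
  have "arith g (Mux z a c b # os) = (\<lambda>r. arith g os (r[z := mux_poly a c b r]))"
    by (simp add: fun_eq_iff)
  moreover have "\<exists>u v. \<forall>X. mux_poly a c b (r[i := X]) = u + v * X" if "length r = n" for r
    using mux that by (intro mux_poly_affine) auto
  ultimately show ?thesis
    using quadratic_in_subst_same[OF affine[OF \<open>i < n\<close>]]
      quadratic_in_subst_other[OF affine[OF \<open>i < n\<close>] affine[OF \<open>z < n\<close>]]
    by (cases "i = z") auto
qed

text \<open>All univariate restrictions that occur in the course of the protocol are quadratic.\<close>

fun low_degree :: "nat \<Rightarrow> (int list \<Rightarrow> int) \<Rightarrow> op list \<Rightarrow> bool" where
  "low_degree n g [] \<longleftrightarrow> True"
| "low_degree n g (x # os) \<longleftrightarrow> low_degree n g os \<and> op_below n x \<and>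
     (\<forall>Q j. x = Quant Q j \<longrightarrow> quadratic_in n (arith g os) j)"

lemma low_degree_op_below: "low_degree n g os \<Longrightarrow> \<forall>x \<in> set os. op_below n x"
  by (induction os) auto

lemma low_degree_append_Check:
  "low_degree n g os \<Longrightarrow> Check \<notin> set os \<Longrightarrow> low_degree n g rest \<Longrightarrow> low_degree n g (os @ Check # rest)"
  by (induction os) (auto simp: arith_append_Check)

definition linearize :: "nat \<Rightarrow> op list \<Rightarrow> op list" where
  "linearize n os = concat (map (\<lambda>x. x # map (Quant Linearize) [0..<n]) os)"

lemma linearize_simps:
  "linearize n [] = []" "linearize n (x # os) = x # map (Quant Linearize) [0..<n] @ linearize n os"
  by (simp_all add: linearize_def)

lemma length_linearize: "length (linearize n os) = length os * (n + 1)"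
  by (induction os) (simp_all add: linearize_simps)

lemma Check_notin_linearize: "Check \<notin> set os \<Longrightarrow> Check \<notin> set (linearize n os)"
  by (auto simp: linearize_def)

lemma holds_linearize: "holds G (linearize n os) y = holds G os y"
proof -
  have "holds G (Quant Linearize j # os) y = holds G os y" for j os y
    using list_update_id[of y j] by (cases "y ! j") simp_all
  then have "holds G (map (Quant Linearize) js @ os) y = holds G os y" for js os y
    by (induction js) simp_all
  then show ?thesis
  proof (induction os arbitrary: y)
    case (Cons x os)
    then show ?case by (cases x) (auto simp: linearize_simps)
  qed (simp add: linearize_simps)
qed

lemma affine_in_linearize_from:
  assumes "\<And>i. i < n \<Longrightarrow> quadratic_in n (arith g os) i" and "low_degree n g os" and "k \<le> n"
  shows "low_degree n g (map (Quant Linearize) [k..<n] @ os) \<and>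
    (\<forall>i<n. quadratic_in n (arith g (map (Quant Linearize) [k..<n] @ os)) i) \<and>
    (\<forall>i<n. k \<le> i \<longrightarrow> affine_in n (arith g (map (Quant Linearize) [k..<n] @ os)) i)"
  using \<open>k \<le> n\<close>
proof (induction k rule: inc_induct)
  case (step k)
  have block: "map (Quant Linearize) [k..<n] @ os =
      Quant Linearize k # map (Quant Linearize) [Suc k..<n] @ os"
    using step.hyps by (simp add: upt_conv_Cons)
  let ?inner = "map (Quant Linearize) [Suc k..<n] @ os"
  note same = affine_in_Linearize_same[of k n g ?inner]
  have "affine_in n (arith g (Quant Linearize k # ?inner)) i" if "i < n" "k \<le> i" for i
    using same affine_in_Linearize_other[of n g ?inner i k] step that by (cases "i = k") auto
  moreover have "quadratic_in n (arith g (Quant Linearize k # ?inner)) i" if "i < n" for i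
    using affine_in_imp_quadratic_in[OF same] quadratic_in_Linearize_other[of n g ?inner i k] step that
    by (cases "i = k") auto
  moreover have "low_degree n g (Quant Linearize k # ?inner)" using step by simp
  ultimately show ?case unfolding block by blast
qed (use assms in auto)

fun proper_op :: "nat \<Rightarrow> op \<Rightarrow> bool" where
  "proper_op n (Quant Q j) \<longleftrightarrow> Q \<noteq> Linearize \<and> j < n"
| "proper_op n (Mux z a c b) \<longleftrightarrow> z < n \<and> a < n \<and> c < n \<and> b < n \<and> a \<noteq> b \<and> c \<noteq> b"
| "proper_op n Check \<longleftrightarrow> False"

lemma quadratic_in_proper_op:
  assumes "\<And>i. i < n \<Longrightarrow> affine_in n (arith g os) i" "proper_op n x" "i < n"
  shows "quadratic_in n (arith g (x # os)) i"
  using assms quadratic_in_Forall_Exists quadratic_in_Mux by (cases x) auto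

lemma low_degree_linearize:
  assumes "\<And>i. i < n \<Longrightarrow> affine_in n g i" and "\<forall>x \<in> set os. proper_op n x"
  shows "low_degree n g (linearize n os)"
proof -
  have "low_degree n g (linearize n os) \<and> (\<forall>i<n. quadratic_in n (arith g (linearize n os)) i)"
    using assms(2)
  proof (induction os)
    case Nil
    have "arith g [] = g" by (simp add: fun_eq_iff)
    then show ?case using assms(1) affine_in_imp_quadratic_in by (simp add: linearize_simps)
  next
    case (Cons x os)
    let ?inner = "map (Quant Linearize) [0..<n] @ linearize n os"
    have inner: "low_degree n g ?inner" "\<And>i. i < n \<Longrightarrow> affine_in n (arith g ?inner) i"
      using affine_in_linearize_from[of n g "linearize n os" 0] Cons by auto
    have "low_degree n g (x # ?inner)"
      using Cons.prems inner affine_in_imp_quadratic_in by (cases x) auto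
    moreover have "quadratic_in n (arith g (x # ?inner)) i" if "i < n" for i
      using quadratic_in_proper_op[OF inner(2)] Cons.prems that by simp
    ultimately show ?case unfolding linearize_simps by blast
  qed
  then show ?thesis ..
qed

subsection \<open>Multilinear extensions\<close>

fun multilinear_ext :: "(bits \<Rightarrow> int) \<Rightarrow> int list \<Rightarrow> int" where
  "multilinear_ext G [] = G []"
| "multilinear_ext G (x # r) =
     (1 - x) * multilinear_ext (\<lambda>y. G (False # y)) r + x * multilinear_ext (\<lambda>y. G (True # y)) r"

lemma multilinear_ext_of_bool: "multilinear_ext G (map of_bool y) = G y"
  by (induction y arbitrary: G) (auto split: if_splits)

lemma multilinear_ext_add:
  "multilinear_ext (\<lambda>y. G y + H y) r = multilinear_ext G r + multilinear_ext H r"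
  by (induction r arbitrary: G H) (auto simp: algebra_simps)

lemma multilinear_ext_cong:
  "(\<And>y. length y = length r \<Longrightarrow> G y = H y) \<Longrightarrow> multilinear_ext G r = multilinear_ext H r"
proof (induction r arbitrary: G H)
  case (Cons x r)
  have "multilinear_ext (\<lambda>y. G (b # y)) r = multilinear_ext (\<lambda>y. H (b # y)) r" for b
    by (rule Cons.IH) (simp add: Cons.prems)
  then show ?case by simp
qed simp

lemma affine_in_multilinear_ext: "affine_in n (multilinear_ext G) i"
proof -
  have "multilinear_ext G (r[i := X]) = multilinear_ext G (r[i := 0]) +
      X * (multilinear_ext G (r[i := 1]) - multilinear_ext G (r[i := 0]))" for r X
  proof (induction r arbitrary: i G)
    case (Cons x r)
    show ?case
    proof (cases i)
      case (Suc k)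
      show ?thesis
        unfolding Suc list_update.simps nat.case multilinear_ext.simps Cons.IH[where i = k]
        by (simp add: algebra_simps)
    qed (simp add: algebra_simps)
  qed simp
  then show ?thesis unfolding affine_in_def by blast
qed

lemma respects_cong_multilinear_ext: "respects_cong p n (multilinear_ext G)"
proof -
  have "[multilinear_ext G r = multilinear_ext G r'] (mod p)"
    if "list_all2 (\<lambda>a b. [a = b] (mod p)) r r'" for r r'
    using that by (induction arbitrary: G rule: list_all2_induct)
      (auto intro!: cong_add cong_mult cong_diff)
  then show ?thesis unfolding respects_cong_def by blast
qed

fun cube :: "nat \<Rightarrow> bits list" where
  "cube 0 = [[]]"
| "cube (Suc n) = map (Cons False) (cube n) @ map (Cons True) (cube n)"

lemma length_cube [simp]: "length (cube n) = 2 ^ n"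
  by (induction n) auto

lemma length_mem_cube: "y \<in> set (cube n) \<Longrightarrow> length y = n"
  by (induction n arbitrary: y) auto

fun vertex_weight :: "int list \<Rightarrow> bits \<Rightarrow> int" where
  "vertex_weight (x # r) (b # y) = (if b then x else 1 - x) * vertex_weight r y"
| "vertex_weight _ _ = 1"

lemma multilinear_ext_eq_sum_list:
  "multilinear_ext G r = (\<Sum>y\<leftarrow>cube (length r). vertex_weight r y * G y)"
  by (induction r arbitrary: G) (auto simp: o_def sum_list_const_mult mult.assoc)

subsection \<open>The operators for reachability\<close>

fun reach :: "(nat \<Rightarrow> 'a \<Rightarrow> 'a \<Rightarrow> bool) \<Rightarrow> nat \<Rightarrow> nat \<Rightarrow> 'a \<Rightarrow> 'a \<Rightarrow> bool" where
  "reach A i 0 u v \<longleftrightarrow> u = v"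
| "reach A i (Suc n) u v \<longleftrightarrow> (\<exists>w. A i u w \<and> reach A (Suc i) n w v)"

lemma reach_add: "reach A i (m + n) u v \<longleftrightarrow> (\<exists>w. reach A i m u w \<and> reach A (i + m) n w v)"
  by (induction m arbitrary: i u) auto

lemma reach_invariant:
  assumes "reach A i n u v" "Q u" "\<And>i u v. A i u v \<Longrightarrow> Q v"
  shows "Q v"
  using assms(1,2) by (induction n arbitrary: i u) (auto intro: assms(3))

lemma reach_iff_path:
  "reach A i n u v \<longleftrightarrow>
    (\<exists>p. length p = Suc n \<and> p ! 0 = u \<and> p ! n = v \<and> (\<forall>j<n. A (i + j) (p ! j) (p ! Suc j)))"
  (is "_ \<longleftrightarrow> (\<exists>p. ?path i n u p)")
proof (induction n arbitrary: i u)
  case 0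
  show ?case by (auto intro: exI[of _ "[v]"])
next
  case (Suc n)
  have "?path i (Suc n) u (x # p) \<longleftrightarrow> x = u \<and> A i u (p ! 0) \<and> ?path (Suc i) n (p ! 0) p" for x p
    by (auto simp: All_less_Suc2)
  moreover have "(\<exists>p. ?path i (Suc n) u p) \<longleftrightarrow> (\<exists>x p. ?path i (Suc n) u (x # p))"
  proof
    assume "\<exists>p. ?path i (Suc n) u p"
    then obtain p where p: "?path i (Suc n) u p" ..
    then obtain x q where "p = x # q" by (cases p) auto
    with p show "\<exists>x p. ?path i (Suc n) u (x # p)" by blast
  qed blast
  ultimately have "(\<exists>p. ?path i (Suc n) u p) \<longleftrightarrow> (\<exists>p. A i u (p ! 0) \<and> ?path (Suc i) n (p ! 0) p)"
    by simp
  also have "\<dots> \<longleftrightarrow> reach A i (Suc n) u v" using Suc.IH by auto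
  finally show ?case ..
qed

text \<open>The variables are the \<open>K\<close> bits of the layer index, least significant bit first, followed by the
  \<open>L\<close> bits each of a source \<open>s\<close>, a target \<open>t\<close> and a midpoint \<open>w\<close>.  The block says that there is a \<open>w\<close>
  such that for both values of index bit \<open>k\<close> what follows holds with \<open>s\<close> replaced by \<open>w\<close> (bit 1) or \<open>t\<close>
  replaced by \<open>w\<close> (bit 0).\<close>

definition midpoint_block :: "nat \<Rightarrow> nat \<Rightarrow> nat \<Rightarrow> op list" where
  "midpoint_block K L k = map (\<lambda>j. Quant Exists (K + 2 * L + j)) [0..<L] @ [Quant Forall k]
     @ map (\<lambda>j. Mux (K + j) (K + j) (K + 2 * L + j) k) [0..<L]
     @ map (\<lambda>j. Mux (K + L + j) (K + 2 * L + j) (K + L + j) k) [0..<L]"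

definition reach_ops :: "nat \<Rightarrow> nat \<Rightarrow> nat \<Rightarrow> op list" where
  "reach_ops K L n = concat (map (midpoint_block K L) (rev [0..<n]))"

lemma reach_ops_simps [simp]:
  "reach_ops K L 0 = []" "reach_ops K L (Suc n) = midpoint_block K L n @ reach_ops K L n"
  by (simp_all add: reach_ops_def)

lemma length_reach_ops: "length (reach_ops K L n) = n * (3 * L + 1)"
  by (induction n) (simp_all add: midpoint_block_def)

lemma proper_op_reach_ops: "n \<le> K \<Longrightarrow> \<forall>x \<in> set (reach_ops K L n). proper_op (K + 3 * L) x"
  by (induction n) (auto simp: midpoint_block_def)

lemma holds_Exists_block:
  "holds G (map (\<lambda>j. Quant Exists (length u + j)) [0..<length w] @ os) (u @ w) \<longleftrightarrow>
    (\<exists>w'. length w' = length w \<and> holds G os (u @ w'))"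
proof (induction w arbitrary: u)
  case (Cons a w)
  have block: "map (\<lambda>j. Quant Exists (length u + j)) [0..<length (a # w)] =
      Quant Exists (length u) # map (\<lambda>j. Quant Exists (length (u @ [b]) + j)) [0..<length w]" for b
    using map_upt_Suc[of "\<lambda>j. Quant Exists (length u + j)" "length w"] by simp
  have "holds G (map (\<lambda>j. Quant Exists (length u + j)) [0..<length (a # w)] @ os) (u @ a # w) \<longleftrightarrow>
      (\<exists>b. holds G (map (\<lambda>j. Quant Exists (length (u @ [b]) + j)) [0..<length w] @ os)
        ((u @ [b]) @ w))"
    unfolding block[of undefined] by (simp add: ex_bool_eq disj_commute)
  also have "\<dots> \<longleftrightarrow> (\<exists>b w'. length w' = length w \<and> holds G os (u @ b # w'))"
    unfolding Cons.IH by simp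
  also have "\<dots> \<longleftrightarrow> (\<exists>w'. length w' = length (a # w) \<and> holds G os (u @ w'))"
    by (auto simp: length_Suc_conv)
  finally show ?case .
qed simp

definition copy_block :: "nat \<Rightarrow> nat \<Rightarrow> nat \<Rightarrow> bits \<Rightarrow> bits" where
  "copy_block z d n y =
      map (\<lambda>i. if z \<le> i \<and> i < z + n then y ! (d + (i - z)) else y ! i) [0..<length y]"

lemma length_copy_block [simp]: "length (copy_block z d n y) = length y"
  by (simp add: copy_block_def)

lemma nth_copy_block:
  "i < length y \<Longrightarrow>
    copy_block z d n y ! i = (if z \<le> i \<and> i < z + n then y ! (d + (i - z)) else y ! i)"
  by (simp add: copy_block_def)

lemma copy_block_Suc:
  "z + n < length y \<Longrightarrow> copy_block z d (Suc n) y = (copy_block z d n y)[z + n := y ! (d + n)]"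
proof (rule nth_equalityI)
  fix i assume "z + n < length y" "i < length (copy_block z d (Suc n) y)"
  then show "copy_block z d (Suc n) y ! i = (copy_block z d n y)[z + n := y ! (d + n)] ! i"
    by (cases "i = z + n") (auto simp: nth_copy_block)
qed simp

lemma holds_Mux_block:
  assumes "z + n \<le> length y" "a + n \<le> length y" "c + n \<le> length y" "b < z"
    and "a = z \<or> a + n \<le> z \<or> z + n \<le> a" "c = z \<or> c + n \<le> z \<or> z + n \<le> c"
  shows "holds G (map (\<lambda>j. Mux (z + j) (a + j) (c + j) b) [0..<n] @ os) y \<longleftrightarrow>
    holds G os (copy_block z (if y ! b then c else a) n y)"
  using assms
proof (induction n arbitrary: os)
  case 0
  have "copy_block z d 0 y = y" for d by (rule nth_equalityI) (auto simp: nth_copy_block)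
  then show ?case by simp
next
  case (Suc n)
  let ?d = "if y ! b then c else a"
  let ?y = "copy_block z ?d n y"
  have "copy_block z d n y ! b = y ! b" "copy_block z d n y ! (a + n) = y ! (a + n)"
    "copy_block z d n y ! (c + n) = y ! (c + n)" for d
    using Suc.prems by (auto simp: nth_copy_block)
  then have source: "(if ?y ! b then ?y ! (c + n) else ?y ! (a + n)) = y ! (?d + n)" by simp
  have "holds G (map (\<lambda>j. Mux (z + j) (a + j) (c + j) b) [0..<Suc n] @ os) y \<longleftrightarrow>
      holds G (map (\<lambda>j. Mux (z + j) (a + j) (c + j) b) [0..<n]
        @ Mux (z + n) (a + n) (c + n) b # os) y"
    by simp
  also have "\<dots> \<longleftrightarrow> holds G (Mux (z + n) (a + n) (c + n) b # os) ?y"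
    by (rule Suc.IH) (use Suc.prems in linarith)+
  also have "\<dots> \<longleftrightarrow> holds G os (copy_block z ?d (Suc n) y)"
    unfolding holds.simps source using Suc.prems
    by (simp only: copy_block_Suc Suc_le_eq add_Suc_right)
  finally show ?case .
qed

lemma holds_midpoint_block:
  assumes "length I = K" "length s = L" "length t = L" "length w = L" "k < K"
  shows "holds G (midpoint_block K L k @ os) (I @ s @ t @ w) \<longleftrightarrow>
    (\<exists>w'. length w' = L \<and> holds G os (I[k := False] @ s @ w' @ w')
        \<and> holds G os (I[k := True] @ w' @ t @ w'))"
proof -
  let ?mux = "map (\<lambda>j. Mux (K + j) (K + j) (K + 2 * L + j) k) [0..<L]
    @ map (\<lambda>j. Mux (K + L + j) (K + 2 * L + j) (K + L + j) k) [0..<L]"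
  have mux: "holds G (?mux @ os) (J @ s @ t @ w') \<longleftrightarrow>
      holds G os (J @ (if J ! k then w' else s) @ (if J ! k then t else w') @ w')"
    if "length J = K" "length w' = L" for J w'
  proof -
    define s' t' where "s' = (if J ! k then w' else s)" and "t' = (if J ! k then t else w')"
    have len: "length s' = L" using assms that by (simp add: s'_def)
    have "(J @ s @ t @ w') ! k = J ! k" "(J @ s' @ t @ w') ! k = J ! k"
      using assms that by (simp_all add: nth_append)
    moreover have "copy_block K (if J ! k then K + 2 * L else K) L (J @ s @ t @ w') =
        J @ s' @ t @ w'"
      using assms that len by (intro nth_equalityI) (auto simp: nth_copy_block nth_append s'_def)
    moreover have "copy_block (K + L) (if J ! k then K + L else K + 2 * L) L (J @ s' @ t @ w') =
        J @ s' @ t' @ w'"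
      using assms that len by (intro nth_equalityI) (auto simp: nth_copy_block nth_append t'_def)
    ultimately show ?thesis
      unfolding append_assoc s'_def[symmetric] t'_def[symmetric]
      using assms that len by (simp add: holds_Mux_block)
  qed
  have "holds G (midpoint_block K L k @ os) (I @ s @ t @ w) \<longleftrightarrow>
      (\<exists>w'. length w' = L \<and> holds G (Quant Forall k # ?mux @ os) (I @ s @ t @ w'))"
    using holds_Exists_block[of G "I @ s @ t" w "Quant Forall k # ?mux @ os"] assms
    by (simp add: midpoint_block_def mult_2)
  also have "\<dots> \<longleftrightarrow> (\<exists>w'. length w' = L \<and> holds G os (I[k := False] @ s @ w' @ w') \<and>
      holds G os (I[k := True] @ w' @ t @ w'))"
    using mux[of "I[k := False]"] mux[of "I[k := True]"] assms
    by (simp add: list_update_append cong: conj_cong del: append_assoc)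
  finally show ?thesis .
qed

lemma holds_reach_ops:
  assumes A: "\<And>i u v. A i u v \<Longrightarrow> v < 2 ^ L"
    and G: "\<And>I s t w. length I = K \<Longrightarrow> length s = L \<Longrightarrow> length t = L \<Longrightarrow> length w = L \<Longrightarrow>
      G (I @ s @ t @ w) \<longleftrightarrow> A (nat_of_bits I) (nat_of_bits s) (nat_of_bits t)"
    and "n \<le> K" "length I = K" "length s = L" "length t = L" "length w = L"
  shows "holds G (reach_ops K L n) (I @ s @ t @ w) \<longleftrightarrow>
    reach A (nat_of_bits (replicate n False @ drop n I)) (2 ^ n) (nat_of_bits s) (nat_of_bits t)"
  using assms(3-)
proof (induction n arbitrary: I s t w)
  case 0
  then show ?case using G by simp
next
  case (Suc n)
  let ?i = "nat_of_bits (replicate (Suc n) False @ drop (Suc n) I)"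
  have i: "nat_of_bits (replicate n False @ drop n (I[n := b])) = ?i + of_bool b * 2 ^ n" for b
    using Suc.prems
    by (simp add: drop_update_cancel Cons_nth_drop_Suc[symmetric] horner_sum_append
        nat_of_bits_replicate_False)
  have "holds G (reach_ops K L (Suc n)) (I @ s @ t @ w) \<longleftrightarrow> (\<exists>w'. length w' = L \<and>
      reach A ?i (2 ^ n) (nat_of_bits s) (nat_of_bits w') \<and>
      reach A (?i + 2 ^ n) (2 ^ n) (nat_of_bits w') (nat_of_bits t))"
    using Suc i[of False] i[of True] by (simp add: holds_midpoint_block cong: conj_cong)
  also have "\<dots> \<longleftrightarrow>
      (\<exists>v. reach A ?i (2 ^ n) (nat_of_bits s) v \<and> reach A (?i + 2 ^ n) (2 ^ n) v (nat_of_bits t))"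
  proof -
    have "\<exists>w'. length w' = L \<and> nat_of_bits w' = v" if "reach A ?i (2 ^ n) (nat_of_bits s) v" for v
    proof -
      have "v < 2 ^ L"
        using reach_invariant[OF that, of "\<lambda>v. v < 2 ^ L"] A nat_of_bits_less[of s] Suc.prems
        by blast
      then show ?thesis
        by (intro exI[of _ "bits_of_nat L v"]) (simp add: nat_of_bits_of_nat)
    qed
    then show ?thesis by blast
  qed
  also have "\<dots> \<longleftrightarrow> reach A ?i (2 ^ Suc n) (nat_of_bits s) (nat_of_bits t)"
    unfolding power_Suc mult_2 reach_add ..
  finally show ?case .
qed

section \<open>The parties' computations\<close>

subsection \<open>Arithmetic modulo \<open>p\<close>\<close>

text \<open>\<open>compl_mod p x\<close> represents \<open>1 - x\<close>, avoiding truncated subtraction for \<open>x \<le> p + 1\<close>.\<close>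

definition compl_mod :: "nat \<Rightarrow> nat \<Rightarrow> nat" where
  "compl_mod p x = p + 1 - x"

abbreviation coord :: "nat list \<Rightarrow> nat \<Rightarrow> nat" where
  "coord \<equiv> nth_default 0"

definition quant_mod :: "nat \<Rightarrow> quantifier \<Rightarrow> nat \<Rightarrow> nat \<Rightarrow> nat \<Rightarrow> nat" where
  "quant_mod p Q t a b = (case Q of
     Forall \<Rightarrow> a * b
   | Exists \<Rightarrow> a + compl_mod p a * b
   | Linearize \<Rightarrow> compl_mod p t * a + t * b) mod p"

definition mux_mod :: "nat \<Rightarrow> nat \<Rightarrow> nat \<Rightarrow> nat \<Rightarrow> nat list \<Rightarrow> nat" where
  "mux_mod p a c b r = (compl_mod p (coord r b) * coord r a + coord r b * coord r c) mod p"

definition residue :: "nat \<Rightarrow> bits \<Rightarrow> nat" where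
  "residue p bs = nat_of_bits bs mod p"

definition weight_mod :: "nat \<Rightarrow> nat list \<Rightarrow> bits \<Rightarrow> nat" where
  "weight_mod p r y = foldl (\<lambda>acc (x, b). acc * (if b then x else compl_mod p x) mod p) 1 (zip r y)"

definition reply_poly :: "nat \<Rightarrow> nat \<Rightarrow> bits \<Rightarrow> nat \<Rightarrow> nat" where
  "reply_poly p l w v =
     (residue p (take l w) + residue p (take l (drop l w)) * v +
      residue p (take l (drop (2 * l) w)) * v\<^sup>2) mod p"

definition move :: "nat \<Rightarrow> op \<Rightarrow> nat \<Rightarrow> nat list \<Rightarrow> nat list" where
  "move p x v r = (case x of
     Quant Q j \<Rightarrow> r[j := v]
   | Mux z a c b \<Rightarrow> r[z := mux_mod p a c b r]
   | Check \<Rightarrow> map (\<lambda>_. 0) r)"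

text \<open>The state \<open>(ok, c, r)\<close> claims that the remaining operators take the value \<open>c\<close> at the point \<open>r\<close>.\<close>

definition round_step ::
    "nat \<Rightarrow> nat \<Rightarrow> (nat list \<Rightarrow> nat) \<Rightarrow> op \<Rightarrow> bits \<Rightarrow> bits \<Rightarrow>
      bool \<times> nat \<times> nat list \<Rightarrow> bool \<times> nat \<times> nat list" where
  "round_step p l base x cn w = (\<lambda>(ok, c, r).
     (case x of
        Quant Q j \<Rightarrow> ok \<and> quant_mod p Q (coord r j) (reply_poly p l w 0) (reply_poly p l w 1) = c
      | Mux z a c b \<Rightarrow> ok
      | Check \<Rightarrow> ok \<and> base r = c,
      case x of
        Quant Q j \<Rightarrow> reply_poly p l w (residue p cn)
      | Mux _ _ _ _ \<Rightarrow> c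
      | Check \<Rightarrow> 1,
      move p x (residue p cn) r))"

lemma round_step_simps:
  "round_step p l base (Quant Q j) cn w (ok, c, r) =
     (ok \<and> quant_mod p Q (coord r j) (reply_poly p l w 0) (reply_poly p l w 1) = c,
      reply_poly p l w (residue p cn), r[j := residue p cn])"
  "round_step p l base (Mux z a d b) cn w (ok, c, r) = (ok, c, r[z := mux_mod p a d b r])"
  "round_step p l base Check cn w (ok, c, r) = (ok \<and> base r = c, 1, map (\<lambda>_. 0) r)"
  by (simp_all add: round_step_def move_def)

definition valid_point :: "nat \<Rightarrow> nat \<Rightarrow> nat list \<Rightarrow> bool" where
  "valid_point p n r \<longleftrightarrow> length r = n \<and> (\<forall>a \<in> set r. a < p)"

lemma residue_less: "0 < p \<Longrightarrow> residue p bs < p"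
  by (simp add: residue_def)

lemma reply_poly_less: "0 < p \<Longrightarrow> reply_poly p l w v < p"
  by (simp add: reply_poly_def)

lemma length_move [simp]: "length (move p x v r) = length r"
  by (simp add: move_def split: op.split)

lemma valid_point_zeros: "0 < p \<Longrightarrow> valid_point p n (replicate n 0)"
  by (auto simp: valid_point_def)

lemma valid_point_move:
  assumes "0 < p" "valid_point p n r"
  shows "valid_point p n (move p x (residue p cn) r)"
proof -
  have "valid_point p n (r[j := a])" if "a < p" for j a
    using assms(2) that
    by (auto simp: valid_point_def dest!: set_update_subset_insert[THEN subsetD])
  moreover have "valid_point p n (map (\<lambda>_. 0) r)"
    using assms by (auto simp: valid_point_def)
  ultimately show ?thesis
    using assms(1) by (cases x) (simp_all add: move_def mux_mod_def residue_less)
qed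

subsection \<open>Alice and Bob\<close>

type_synonym table = "(nat \<times> (bool \<times> bool) list list) list"
type_synonym inst = "(nat \<times> nat \<times> nat \<times> table) \<times> nat"

definition inst_vars :: "inst \<Rightarrow> nat" where "inst_vars I = fst (fst I)"
definition inst_length :: "inst \<Rightarrow> nat" where "inst_length I = fst (snd (fst I))"
definition inst_width :: "inst \<Rightarrow> nat" where "inst_width I = fst (snd (snd (fst I)))"
definition inst_table :: "inst \<Rightarrow> table" where "inst_table I = snd (snd (snd (fst I)))"
definition inst_precision :: "inst \<Rightarrow> nat" where "inst_precision I = snd I"

definition index_bits :: "inst \<Rightarrow> nat" where "index_bits I = floorlog 2 (inst_length I)"
definition node_bits :: "inst \<Rightarrow> nat" where "node_bits I = floorlog 2 (inst_width I)"
definition point_dim :: "inst \<Rightarrow> nat" where "point_dim I = index_bits I + 3 * node_bits I"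

definition body_ops :: "inst \<Rightarrow> op list" where
  "body_ops I = linearize (point_dim I) (reach_ops (index_bits I) (node_bits I) (index_bits I))"

definition num_ops :: "inst \<Rightarrow> nat" where
  "num_ops I = index_bits I * (3 * node_bits I + 1) * (point_dim I + 1)"

text \<open>Each repetition of the protocol reduces the error probability by the factor \<open>2 ^ gain\<close>.\<close>

definition gain :: "inst \<Rightarrow> nat" where "gain I = floorlog 2 (2 * num_ops I)"
definition repetitions :: "inst \<Rightarrow> nat" where "repetitions I = Suc (inst_precision I div gain I)"

definition modulus :: "inst \<Rightarrow> nat" where
  "modulus I = (let s = pow2_above (2 * num_ops I)
      in nth_default 2 (primes_between (Suc (s\<^sup>2)) (s ^ 5)) 0)"

definition coin_bits :: "inst \<Rightarrow> nat" where "coin_bits I = 2 * gain I"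
definition elem_bits :: "inst \<Rightarrow> nat" where "elem_bits I = 5 * gain I"

definition repeat_ops :: "nat \<Rightarrow> op list \<Rightarrow> op list" where
  "repeat_ops n os = concat (replicate n (os @ [Check]))"

lemma repeat_ops_simps [simp]:
  "repeat_ops 0 os = []" "repeat_ops (Suc n) os = os @ Check # repeat_ops n os"
  by (simp_all add: repeat_ops_def)

definition all_ops :: "inst \<Rightarrow> op list" where
  "all_ops I = repeat_ops (repetitions I) (body_ops I)"

definition schedule :: "inst \<Rightarrow> (nat \<times> nat) list" where
  "schedule I = replicate (Suc (length (all_ops I))) (coin_bits I, 3 * elem_bits I)"

text \<open>A party holds the variables from \<open>off\<close> on, with values \<open>xs\<close>.  The padding layers, which are
  identity matrices, belong to the party with \<open>pad\<close> set.\<close>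

definition party_entry :: "inst \<Rightarrow> nat \<Rightarrow> bool \<Rightarrow> bits \<Rightarrow> bits \<Rightarrow> bool" where
  "party_entry I off pad xs y =
     (let K = index_bits I; L = node_bits I;
        i = nat_of_bits (take K y);
        u = nat_of_bits (take L (drop K y));
        v = nat_of_bits (take L (drop (K + L) y));
        layer = nth_default (0, []) (inst_table I) i;
        edges = nth_default (False, False) (nth_default [] (snd layer) u) v
      in if i < length (inst_table I) then
           off \<le> fst layer \<and> fst layer < off + length xs \<and>
             (if nth_default False xs (fst layer - off) then snd edges else fst edges)
         else pad \<and> u = v)"

definition party_value :: "inst \<Rightarrow> nat \<Rightarrow> bool \<Rightarrow> bits \<Rightarrow> nat list \<Rightarrow> nat" where
  "party_value I off pad xs r = foldl (\<lambda>acc y.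
       (acc + (if party_entry I off pad xs y then weight_mod (modulus I) r y else 0)) mod modulus I)
     0 (cube (point_dim I))"

abbreviation alice_value :: "inst \<Rightarrow> bits \<Rightarrow> nat list \<Rightarrow> nat" where
  "alice_value I xa \<equiv> party_value I 0 True xa"

abbreviation bob_value :: "inst \<Rightarrow> bits \<Rightarrow> nat list \<Rightarrow> nat" where
  "bob_value I xb \<equiv> party_value I (inst_vars I div 2) False xb"

definition alice_step :: "inst \<Rightarrow> bits \<Rightarrow> (bool \<times> nat \<times> nat list) \<times> bits \<Rightarrow> op \<times> bits \<times> bits \<times> bits \<Rightarrow>
    (bool \<times> nat \<times> nat list) \<times> bits" where
  "alice_step I xa = (\<lambda>(st, bs) (x, cn, _, w).
     (round_step (modulus I) (elem_bits I)
        (\<lambda>r. (alice_value I xa r + residue (modulus I) (take (elem_bits I) bs)) mod modulus I)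
          x cn w st,
      if x = Check then drop (elem_bits I) bs else bs))"

text \<open>Merlin sees the coins of a round before he replies, so his reply is tested at the point given by
  the coins of the next round.\<close>

definition verdict :: "inst \<Rightarrow> bits \<Rightarrow> transcript \<Rightarrow> bits \<Rightarrow> bool" where
  "verdict I xa tr bs = fst (fst (foldl (alice_step I xa) ((True, 1, replicate (point_dim I) 0), bs)
     (zip (all_ops I) (zip (map fst (drop 1 tr)) (map snd tr)))))"

definition bob_step :: "inst \<Rightarrow> bits \<Rightarrow> nat list \<times> bits \<Rightarrow> op \<times> bits \<Rightarrow> nat list \<times> bits" where
  "bob_step I xb = (\<lambda>(r, bs) (x, cn).
     (move (modulus I) x (residue (modulus I) cn) r,
      if x = Check then bs @ bits_of_nat (elem_bits I) (bob_value I xb r) else bs))"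

definition bob :: "inst \<Rightarrow> bits \<Rightarrow> bits list \<Rightarrow> bits" where
  "bob I xb cs = snd (foldl (bob_step I xb) (replicate (point_dim I) 0, [])
      (zip (all_ops I) (drop 1 cs)))"

subsection \<open>Polynomial running time\<close>

fun quantifier_tag :: "quantifier \<Rightarrow> nat" where
  "quantifier_tag Forall = 0"
| "quantifier_tag Exists = 1"
| "quantifier_tag Linearize = 2"

instantiation quantifier :: codable
begin
definition code_quantifier_eq: "code Q = code (quantifier_tag Q)"
instance ..
end

fun op_view :: "op \<Rightarrow> nat \<times> quantifier \<times> nat \<times> nat \<times> nat \<times> nat" where
  "op_view (Quant Q j) = (0, Q, j, 0, 0, 0)"
| "op_view (Mux z a c b) = (1, Forall, z, a, c, b)"
| "op_view Check = (2, Forall, 0, 0, 0, 0)"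

instantiation op :: codable
begin
definition code_op_eq: "code x = code (op_view x)"
instance ..
end

lemma polytime_case_quantifier [polytime_intros]:
  assumes "polytime Q" "polytime f" "polytime g" "polytime h"
  shows "polytime (\<lambda>e. case Q e of Forall \<Rightarrow> f e | Exists \<Rightarrow> g e | Linearize \<Rightarrow> h e)"
proof -
  have "polytime (\<lambda>e. quantifier_tag (Q e))"
    using assms(1) by (rule polytime_same_code) (simp add: code_quantifier_eq)
  then have "polytime (\<lambda>e. if quantifier_tag (Q e) = 0 then f e
      else if quantifier_tag (Q e) = 1 then g e else h e)"
    by (intro polytime_intros assms)
  then show ?thesis by (rule polytime_cong) (simp split: quantifier.split)
qed

lemma polytime_Quant [polytime_intros]:
  assumes "polytime Q" "polytime j"
  shows "polytime (\<lambda>e. Quant (Q e) (j e))"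
  by (rule polytime_same_code[of "\<lambda>e. (0 :: nat, Q e, j e, 0 :: nat, 0 :: nat, 0 :: nat)"],
    intro polytime_intros assms)
    (simp add: code_op_eq)

lemma polytime_Mux [polytime_intros]:
  assumes "polytime z" "polytime a" "polytime c" "polytime b"
  shows "polytime (\<lambda>e. Mux (z e) (a e) (c e) (b e))"
  by (rule polytime_same_code[of "\<lambda>e. (1 :: nat, Forall, z e, a e, c e, b e)"],
    intro polytime_intros assms)
    (simp add: code_op_eq)

lemma polytime_case_op [polytime_intros]:
  assumes x: "polytime x"
    and f: "polytime (\<lambda>z. f (fst z) (fst (snd z)) (snd (snd z)))"
    and g: "polytime (\<lambda>z. g (fst z) (fst (snd z)) (fst (snd (snd z))) (fst (snd (snd (snd z))))
        (snd (snd (snd (snd z)))))"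
    and h: "polytime h"
  shows "polytime (\<lambda>e. case x e of Quant Q j \<Rightarrow> f e Q j | Mux z a c b \<Rightarrow> g e z a c b | Check \<Rightarrow> h e)"
proof -
  define tag Q args where "tag e = fst (op_view (x e))" and "Q e = fst (snd (op_view (x e)))"
    and "args e = snd (snd (op_view (x e)))" for e
  have view: "polytime (\<lambda>e. op_view (x e))"
    using x by (rule polytime_same_code) (simp add: code_op_eq)
  have f': "polytime (\<lambda>e. f e (Q e) (fst (args e)))"
    using polytime_comp[OF f, of "\<lambda>e. (e, Q e, fst (args e))"] view
    by (simp add: Q_def args_def polytime_intros)
  have g': "polytime (\<lambda>e. g e (fst (args e)) (fst (snd (args e))) (fst (snd (snd (args e))))
      (snd (snd (snd (args e)))))"
    using polytime_comp[OF g, of "\<lambda>e. (e, args e)"] view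
    by (simp add: args_def polytime_intros)
  have "polytime tag" unfolding tag_def by (intro polytime_intros view)
  then have "polytime (\<lambda>e. if tag e = 0 then f e (Q e) (fst (args e)) else if tag e = 1
      then g e (fst (args e)) (fst (snd (args e))) (fst (snd (snd (args e)))) (snd (snd (snd (args e))))
      else h e)"
    by (intro polytime_intros f' g' h)
  then show ?thesis
    by (rule polytime_cong) (simp add: tag_def Q_def args_def split: op.split)
qed

lemma polytime_eq_Check [polytime_intros]:
  assumes "polytime x"
  shows "polytime (\<lambda>e. x e = Check)"
proof -
  have "y = Check \<longleftrightarrow> (case y of Quant Q j \<Rightarrow> False | Mux z a c b \<Rightarrow> False | Check \<Rightarrow> True)" for y
    by (cases y) auto
  then show ?thesis by (simp only:) (intro polytime_intros assms)
qed

lemma polytime_power_const [polytime_intros]: "polytime f \<Longrightarrow> polytime (\<lambda>e. f e ^ k :: nat)"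
  by (induction k) (auto intro: polytime_intros)

lemma polytime_compl_mod [polytime_intros]:
  "polytime p \<Longrightarrow> polytime x \<Longrightarrow> polytime (\<lambda>e. compl_mod (p e) (x e))"
  unfolding compl_mod_def by (intro polytime_intros)

lemma polytime_quant_mod [polytime_intros]:
  "polytime p \<Longrightarrow> polytime Q \<Longrightarrow> polytime t \<Longrightarrow> polytime a \<Longrightarrow> polytime b \<Longrightarrow>
    polytime (\<lambda>e. quant_mod (p e) (Q e) (t e) (a e) (b e))"
  unfolding quant_mod_def by (intro polytime_intros)

lemma polytime_mux_mod [polytime_intros]:
  "polytime p \<Longrightarrow> polytime a \<Longrightarrow> polytime c \<Longrightarrow> polytime b \<Longrightarrow> polytime r \<Longrightarrow>
    polytime (\<lambda>e. mux_mod (p e) (a e) (c e) (b e) (r e))"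
  unfolding mux_mod_def by (intro polytime_intros)

lemma polytime_residue [polytime_intros]:
  "(\<And>e. 0 < p e) \<Longrightarrow> polytime p \<Longrightarrow> polytime bs \<Longrightarrow> polytime (\<lambda>e. residue (p e) (bs e))"
  unfolding residue_def by (intro polytime_intros)

lemma polytime_reply_poly [polytime_intros]:
  "(\<And>e. 0 < p e) \<Longrightarrow> polytime p \<Longrightarrow> polytime l \<Longrightarrow> polytime w \<Longrightarrow> polytime v \<Longrightarrow>
    polytime (\<lambda>e. reply_poly (p e) (l e) (w e) (v e))"
  unfolding reply_poly_def by (intro polytime_intros)

lemma polytime_move [polytime_intros]:
  assumes "polytime p" "polytime x" "polytime v" "polytime r"
  shows "polytime (\<lambda>e. move (p e) (x e) (v e) (r e))"
  unfolding move_def by (intro polytime_intros assms[THEN polytime_comp])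

lemma polytime_round_step [polytime_intros]:
  assumes "\<And>e. 0 < p e" "polytime p" "polytime l" "polytime (\<lambda>z. base (fst z) (snd z))"
    "polytime x" "polytime cn" "polytime w" "polytime st"
  shows "polytime (\<lambda>e. round_step (p e) (l e) (base e) (x e) (cn e) (w e) (st e))"
proof -
  have "polytime (\<lambda>e. base e (snd (snd (st e))))"
    using polytime_comp[OF assms(4), of "\<lambda>e. (e, snd (snd (st e)))"] assms(8)
    by (simp add: polytime_intros)
  then show ?thesis
    unfolding round_step_def split_beta
    by (intro polytime_intros assms(1) assms(2-3,5-)[THEN polytime_comp])
qed

lemma foldl_invariant:
  assumes "P 0 a" "\<And>i a x. P i a \<Longrightarrow> P (Suc i) (f a x)"
  shows "P (length xs) (foldl f a xs)"
  by (induction xs rule: rev_induct) (use assms in auto)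

lemma foldl_mod_less:
  fixes p a :: nat
  assumes "a < p" "\<And>acc x. f acc x < p"
  shows "foldl f a xs < p"
  using foldl_invariant[of "\<lambda>_ acc. acc < p"] assms by blast

lemma polytime_weight_mod [polytime_intros]:
  assumes "\<And>e. 1 < p e" "polytime p" "polytime r" "polytime y"
  shows "polytime (\<lambda>e. weight_mod (p e) (r e) (y e))"
  unfolding weight_mod_def split_beta
proof (rule polytime_foldl[where b = p])
  show "size (code (foldl (\<lambda>acc z. acc * (if snd z then fst z else compl_mod (p e) (fst z)) mod p e) 1
      (take i (zip (r e) (y e))))) \<le> p e" for e i
    unfolding size_code_nat
    by (rule less_imp_le, rule foldl_mod_less) (use assms(1)[of e] in auto)
qed (intro polytime_intros polybounded_intros assms assms(2)[THEN polytime_comp])+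

lemma modulus_gt_1 [polytime_intros]: "1 < modulus I"
proof -
  let ?s = "pow2_above (2 * num_ops I)"
  let ?ps = "primes_between (Suc (?s\<^sup>2)) (?s ^ 5)"
  have "prime (hd ?ps)" if "?ps \<noteq> []"
    using hd_in_set[OF that] by (simp add: set_primes_between)
  then show ?thesis
    by (cases ?ps) (auto simp: modulus_def Let_def prime_gt_1_nat simp del: One_nat_def)
qed

lemma modulus_pos [polytime_intros]: "0 < modulus I"
  using modulus_gt_1[of I] by simp

lemma polytime_inst [polytime_intros]:
  assumes "polytime I"
  shows "polytime (\<lambda>e. inst_vars (I e))" "polytime (\<lambda>e. inst_length (I e))"
    "polytime (\<lambda>e. inst_width (I e))"
    "polytime (\<lambda>e. inst_table (I e))" "polytime (\<lambda>e. inst_precision (I e))"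
  unfolding inst_vars_def inst_length_def inst_width_def inst_table_def inst_precision_def
  by (intro polytime_intros assms)+

lemma polytime_parameters [polytime_intros]:
  assumes "polytime I"
  shows "polytime (\<lambda>e. index_bits (I e))" "polytime (\<lambda>e. node_bits (I e))"
    "polytime (\<lambda>e. point_dim (I e))"
    "polytime (\<lambda>e. num_ops (I e))" "polytime (\<lambda>e. gain (I e))" "polytime (\<lambda>e. repetitions (I e))"
    "polytime (\<lambda>e. coin_bits (I e))" "polytime (\<lambda>e. elem_bits (I e))" "polytime (\<lambda>e. modulus (I e))"
  unfolding coin_bits_def elem_bits_def modulus_def Let_def repetitions_def gain_def num_ops_def
    point_dim_def index_bits_def node_bits_def
  by (intro polytime_intros assms)+

lemma polytime_all_ops [polytime_intros]:
  assumes "polytime I"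
  shows "polytime (\<lambda>e. all_ops (I e))"
  unfolding all_ops_def repeat_ops_def body_ops_def linearize_def reach_ops_def midpoint_block_def
  by (intro polytime_intros assms[THEN polytime_comp])

lemma polytime_schedule [polytime_intros]:
  "polytime I \<Longrightarrow> polytime (\<lambda>e. schedule (I e))"
  unfolding schedule_def by (intro polytime_intros)

lemma size_code_cube: "size (code (cube n)) \<le> 2 ^ n * (2 * n + 1)"
  using size_code_list_le[of "cube n" "2 * n"] size_code_bits_le length_mem_cube by fastforce

lemma power_point_dim_le: "2 ^ point_dim I \<le> (2 * inst_length I + 1) * (2 * inst_width I + 1) ^ 3"
proof -
  have "2 ^ point_dim I = pow2_above (inst_length I) * pow2_above (inst_width I) ^ 3"
    unfolding point_dim_def index_bits_def node_bits_def pow2_above_def power_add power_mult[symmetric]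
    by (simp only: mult.commute)
  also have "\<dots> \<le> (2 * inst_length I + 1) * (2 * inst_width I + 1) ^ 3"
    by (intro mult_mono power_mono pow2_above_le) auto
  finally show ?thesis .
qed

lemma polytime_cube_point_dim [polytime_intros]:
  assumes "polytime I"
  shows "polytime (\<lambda>e. cube (point_dim (I e)))"
proof -
  let ?f = "\<lambda>c. map (Cons False) c @ map (Cons True) c"
  have cube: "(?f ^^ n) [[]] = cube n" for n by (induction n) auto
  let ?b = "\<lambda>e. (2 * inst_length (I e) + 1) * (2 * inst_width (I e) + 1) ^ 3 *
      (2 * point_dim (I e) + 1)"
  have "polytime (\<lambda>e. (?f ^^ point_dim (I e)) [[]])"
  proof (rule polytime_funpow[where b = ?b])
    show "polybounded ?b" by (intro polybounded_intros polytime_intros assms)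
    fix e i assume "i \<le> point_dim (I e)"
    then have "2 ^ i * (2 * i + 1) \<le> 2 ^ point_dim (I e) * (2 * point_dim (I e) + 1)"
      by (intro mult_mono power_increasing) auto
    also have "\<dots> \<le> ?b e" by (intro mult_right_mono power_point_dim_le) auto
    finally show "size (code ((?f ^^ i) [[]])) \<le> ?b e"
      unfolding cube by (rule order_trans[OF size_code_cube])
  qed (intro polytime_intros assms)+
  then show ?thesis unfolding cube .
qed

lemma polytime_party_entry [polytime_intros]:
  assumes I: "polytime I" and "polytime off" "polytime pad" "polytime xs" and y: "polytime y"
  shows "polytime (\<lambda>e. party_entry (I e) (off e) (pad e) (xs e) (y e))"
proof -
  have index: "polytime (\<lambda>e. nat_of_bits (take (index_bits (I e)) (y e)))"
    by (rule polytime_nat_of_bits[where n = "\<lambda>e. inst_length (I e)"], intro polytime_intros I,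
        intro polytime_intros I y) (simp add: index_bits_def)
  have node: "polytime (\<lambda>e. nat_of_bits (take (node_bits (I e)) (drop (k e) (y e))))"
    if "polytime k" for k
    by (rule polytime_nat_of_bits[where n = "\<lambda>e. inst_width (I e)"], intro polytime_intros I,
        intro polytime_intros I y that) (simp add: node_bits_def)
  show ?thesis
    unfolding party_entry_def Let_def by (intro index node polytime_intros assms)
qed

lemma party_value_less: "party_value I off pad xs r < modulus I"
  unfolding party_value_def by (rule foldl_mod_less) (simp_all add: modulus_pos)

lemma polytime_party_value [polytime_intros]:
  assumes "polytime I" "polytime off" "polytime pad" "polytime xs" "polytime r"
  shows "polytime (\<lambda>e. party_value (I e) (off e) (pad e) (xs e) (r e))"
  unfolding party_value_def
proof (rule polytime_foldl[where b = "\<lambda>e. modulus (I e)"])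
  show "size (code (foldl (\<lambda>acc y. (acc + (if party_entry (I e) (off e) (pad e) (xs e) y
      then weight_mod (modulus (I e)) (r e) y else 0)) mod modulus (I e)) 0
      (take i (cube (point_dim (I e)))))) \<le> modulus (I e)" for e i
    unfolding size_code_nat by (rule less_imp_le, rule foldl_mod_less) (simp_all add: modulus_pos)
qed (intro polytime_intros polybounded_intros assms[THEN polytime_comp])+

lemma polytime_alice_step [polytime_intros]:
  assumes "polytime I" "polytime xa" "polytime st" "polytime z"
  shows "polytime (\<lambda>e. alice_step (I e) (xa e) (st e) (z e))"
  unfolding alice_step_def split_beta by (intro polytime_intros assms[THEN polytime_comp])

lemma polytime_bob_step [polytime_intros]:
  assumes "polytime I" "polytime xb" "polytime st" "polytime z"
  shows "polytime (\<lambda>e. bob_step (I e) (xb e) (st e) (z e))"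
  unfolding bob_step_def split_beta by (intro polytime_intros assms[THEN polytime_comp])

lemma size_code_valid_point: "valid_point p n r \<Longrightarrow> size (code r) \<le> n * (p + 1)"
  using size_code_list_le[of r p] by (auto simp: valid_point_def less_imp_le)

lemma size_code_alice_state:
  "size (code (foldl (alice_step I xa) ((True, 1, replicate (point_dim I) 0), bs) zs)) \<le>
    modulus I + point_dim I * (modulus I + 1) + size (code bs) + 4"
proof -
  let ?st = "foldl (alice_step I xa) ((True, 1, replicate (point_dim I) 0), bs) zs"
  let ?P = "\<lambda>((_ :: bool, c, r), bs' :: bits).
      c \<le> modulus I \<and> valid_point (modulus I) (point_dim I) r \<and>
    size (code bs') \<le> size (code bs)"
  have "?P ?st"
  proof (rule foldl_invariant[where P = "\<lambda>_. ?P"])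
    show "?P ((True, 1, replicate (point_dim I) 0), bs)"
      using modulus_gt_1[of I] by (simp add: valid_point_zeros)
    fix st and z :: "op \<times> bits \<times> bits \<times> bits" assume st: "?P st"
    obtain ok c r bs' x cn a w where "st = ((ok, c, r), bs')" "z = (x, cn, a, w)"
      by (metis prod.exhaust)
    with st show "?P (alice_step I xa st z)"
      using modulus_gt_1[of I] order_trans[OF size_code_drop, of bs' "size (code bs)"]
      by (auto simp: alice_step_def round_step_def valid_point_move less_imp_le reply_poly_less
          split: op.split)
  qed
  moreover obtain ok c r bs' where st: "?st = ((ok, c, r), bs')" by (metis prod.exhaust)
  ultimately show ?thesis
    using size_code_valid_point[of "modulus I" "point_dim I" r] size_code_bool[of ok]
    by (simp add: st)
qed

lemma polytime_verdict [polytime_intros]: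
  assumes "polytime I" "polytime xa" "polytime tr" "polytime bs"
  shows "polytime (\<lambda>e. verdict (I e) (xa e) (tr e) (bs e))"
  unfolding verdict_def
  by (intro polytime_fst polytime_foldl[OF _ _ _ _ size_code_alice_state[unfolded take_zip]])
    (intro polytime_intros polybounded_intros assms[THEN polytime_comp])+

lemma size_code_bob_state:
  assumes "length zs \<le> n"
  shows "size (code (foldl (bob_step I xb) (replicate (point_dim I) 0, []) zs)) \<le>
    point_dim I * (modulus I + 1) + 2 * (n * elem_bits I) + 1"
proof -
  let ?st = "foldl (bob_step I xb) (replicate (point_dim I) 0, []) zs"
  let ?P = "\<lambda>i (r, bs). valid_point (modulus I) (point_dim I) r \<and>
      length (bs :: bits) \<le> i * elem_bits I"
  have inv: "?P (length zs) ?st"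
  proof (rule foldl_invariant[where P = ?P])
    show "?P 0 (replicate (point_dim I) 0, [])" by (simp add: valid_point_zeros modulus_pos)
    show "?P (Suc i) (bob_step I xb st z)" if "?P i st" for i st z
      using that by (auto simp: bob_step_def valid_point_move modulus_pos split: prod.splits)
  qed
  obtain r bs where st: "?st = (r, bs)" by (metis prod.exhaust)
  have "size (code r) \<le> point_dim I * (modulus I + 1)"
    using inv by (intro size_code_valid_point) (simp add: st)
  moreover have "length bs \<le> length zs * elem_bits I" using inv by (simp add: st)
  moreover have "\<dots> \<le> n * elem_bits I" using assms by (rule mult_right_mono) simp
  ultimately show ?thesis
    using size_code_bits_le[of bs] unfolding st code_Pair sexp.size by linarith
qed

lemma polytime_bob [polytime_intros]:
  assumes "polytime I" "polytime xb" "polytime cs"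
  shows "polytime (\<lambda>e. bob (I e) (xb e) (cs e))"
  unfolding bob_def
proof (intro polytime_snd polytime_foldl)
  show "size (code (foldl (bob_step (I e) (xb e)) (replicate (point_dim (I e)) 0, [])
      (take i (zip (all_ops (I e)) (drop 1 (cs e)))))) \<le>
    point_dim (I e) * (modulus (I e) + 1) + 2 * (length (all_ops (I e)) * elem_bits (I e)) + 1" for e i
    by (rule size_code_bob_state) simp
qed (intro polytime_intros polybounded_intros assms[THEN polytime_comp])+

section \<open>Soundness and completeness of the interaction\<close>

subsection \<open>Lists of independent uniform elements\<close>

definition list_prob :: "'a set \<Rightarrow> nat \<Rightarrow> ('a list \<Rightarrow> bool) \<Rightarrow> real" where
  "list_prob A n Q = measure_pmf.prob (pmf_of_set {xs. set xs \<subseteq> A \<and> length xs = n}) {xs. Q xs}"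

lemma list_prob_eq_card:
  assumes "finite A" "A \<noteq> {}"
  shows "list_prob A n Q = real (card {xs. set xs \<subseteq> A \<and> length xs = n \<and> Q xs}) / real (card A) ^ n"
proof -
  let ?S = "{xs. set xs \<subseteq> A \<and> length xs = n}"
  have "card ?S = card A ^ n" "finite ?S"
    using assms(1) by (rule card_lists_length_eq finite_lists_length_eq)+
  moreover have "?S \<noteq> {}"
    using assms(2) by (intro ex_in_conv[THEN iffD1] exI[of _ "replicate n (SOME x. x \<in> A)"])
      (auto intro: someI)
  moreover have "?S \<inter> {xs. Q xs} = {xs. set xs \<subseteq> A \<and> length xs = n \<and> Q xs}" by auto
  ultimately show ?thesis by (simp add: list_prob_def measure_pmf_of_set)
qed

lemma list_prob_cong:
  assumes "finite A" "A \<noteq> {}" "\<And>xs. length xs = n \<Longrightarrow> Q xs \<longleftrightarrow> R xs"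
  shows "list_prob A n Q = list_prob A n R"
  using assms(3) unfolding list_prob_eq_card[OF assms(1,2)] by (metis (no_types, lifting))

lemma list_prob_Suc:
  assumes A: "finite A" "A \<noteq> {}"
  shows "list_prob A (Suc n) Q = (\<Sum>x\<in>A. list_prob A n (\<lambda>xs. Q (x # xs))) / real (card A)"
proof -
  let ?S = "\<lambda>x. {xs. set xs \<subseteq> A \<and> length xs = n \<and> Q (x # xs)}"
  have "bij_betw (\<lambda>(x, xs). x # xs) (Sigma A ?S) {xs. set xs \<subseteq> A \<and> length xs = Suc n \<and> Q xs}"
    by (rule bij_betwI[where g = "\<lambda>xs. (hd xs, tl xs)"]) (auto simp: length_Suc_conv)
  then have "card {xs. set xs \<subseteq> A \<and> length xs = Suc n \<and> Q xs} = card (Sigma A ?S)"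
    by (simp add: bij_betw_same_card)
  also have "\<dots> = (\<Sum>x\<in>A. card (?S x))"
    using A(1) by (intro card_SigmaI ballI finite_subset[OF _ finite_lists_length_eq[of A n]]) auto
  finally show ?thesis
    unfolding list_prob_eq_card[OF A] by (simp add: sum_divide_distrib mult.commute)
qed

lemma list_prob_Suc_le:
  assumes A: "finite A" "A \<noteq> {}" and b: "\<And>x. x \<in> A \<Longrightarrow> list_prob A n (\<lambda>xs. Q (x # xs)) \<le> b"
  shows "list_prob A (Suc n) Q \<le> b"
proof -
  have "(\<Sum>x\<in>A. list_prob A n (\<lambda>xs. Q (x # xs))) \<le> (\<Sum>x\<in>A. b)" by (intro sum_mono b)
  then show ?thesis
    using A unfolding list_prob_Suc[OF A] by (simp add: field_simps card_gt_0_iff)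
qed

lemma list_prob_Suc_le_exceptional:
  assumes A: "finite A" "A \<noteq> {}" and bad: "card {x \<in> A. bad x} \<le> m" and "0 \<le> G" "0 \<le> b"
    and G: "\<And>x. x \<in> A \<Longrightarrow> list_prob A n (\<lambda>xs. Q (x # xs)) \<le> G"
    and b: "\<And>x. x \<in> A \<Longrightarrow> \<not> bad x \<Longrightarrow> list_prob A n (\<lambda>xs. Q (x # xs)) \<le> b"
  shows "list_prob A (Suc n) Q \<le> real m / real (card A) * G + b"
proof -
  have "(\<Sum>x\<in>A. list_prob A n (\<lambda>xs. Q (x # xs))) \<le> (\<Sum>x\<in>A. (if bad x then G else 0) + b)"
    using G b \<open>0 \<le> b\<close> by (intro sum_mono) (auto simp: add_increasing2)
  also have "\<dots> = real (card {x \<in> A. bad x}) * G + real (card A) * b"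
    using A(1) by (simp add: sum.distrib sum.If_cases Int_def)
  also have "\<dots> \<le> real m * G + real (card A) * b"
    using bad \<open>0 \<le> G\<close> by (intro add_right_mono mult_right_mono) auto
  finally show ?thesis
    using A unfolding list_prob_Suc[OF A] by (simp add: field_simps card_gt_0_iff)
qed

definition coins :: "nat \<Rightarrow> bits set" where
  "coins k = {cn. length cn = k}"

lemma finite_coins: "finite (coins k)"
  and card_coins: "card (coins k) = 2 ^ k"
  and coins_nonempty: "coins k \<noteq> {}"
proof -
  have "coins k = {xs. set xs \<subseteq> UNIV \<and> length xs = k}" by (auto simp: coins_def)
  then show "finite (coins k)" and card: "card (coins k) = 2 ^ k"
    using finite_lists_length_eq[of "UNIV :: bool set" k]
      card_lists_length_eq[of "UNIV :: bool set" k] by auto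
  from card show "coins k \<noteq> {}" by auto
qed

subsection \<open>Arithmetic modulo \<open>p\<close> as integer arithmetic\<close>

lemma int_compl_mod: "x \<le> p + 1 \<Longrightarrow> [int (compl_mod p x) = 1 - int x] (mod int p)"
proof -
  assume "x \<le> p + 1"
  then have "int (compl_mod p x) = (1 - int x) + int p" by (simp add: compl_mod_def of_nat_diff)
  then show ?thesis by (simp only: cong_def mod_add_self2)
qed

lemma int_mod_cong: "[int (a mod p) = int a] (mod int p)"
  by (simp add: cong_def zmod_int)

lemma mod_eq_iff_cong: "c < p \<Longrightarrow> a mod p = c \<longleftrightarrow> [int c = int a] (mod int p)"
  using cong_int_iff[of c a p] by (auto simp: cong_def)

lemma int_quant_mod:
  assumes "t < p" "a < p"
  shows "[int (quant_mod p Q t a b) = quant_poly Q (int t) (int a) (int b)] (mod int p)"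
  unfolding quant_mod_def
  by (rule cong_trans[OF int_mod_cong])
    (use assms in \<open>cases Q; auto intro!: cong_add cong_mult int_compl_mod\<close>)

lemma valid_point_coord:
  "valid_point p n r \<Longrightarrow> j < n \<Longrightarrow> coord r j = r ! j \<and> r ! j < p"
  by (auto simp: valid_point_def nth_default_nth)

lemma int_mux_mod:
  assumes "valid_point p n r" "a < n" "c < n" "b < n"
  shows "[int (mux_mod p a c b r) = mux_poly a c b (map int r)] (mod int p)"
proof -
  note coord = assms(2-)[THEN valid_point_coord[OF assms(1)]]
  have "length r = n" using assms(1) by (simp add: valid_point_def)
  then show ?thesis
    unfolding mux_mod_def mux_poly_def using coord assms(2-)
    by (intro cong_trans[OF int_mod_cong]) (auto intro!: cong_add cong_mult int_compl_mod)
qed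

lemma int_reply_poly:
  "[int (reply_poly p l w v) =
      int (residue p (take l w)) + int (residue p (take l (drop l w))) * int v
     + int (residue p (take l (drop (2 * l) w))) * (int v)\<^sup>2] (mod int p)"
  unfolding reply_poly_def by (rule cong_trans[OF int_mod_cong]) simp

lemma card_quadratic_roots_le_2:
  fixes a b c :: int
  assumes p: "prime p"
    and nonzero: "\<not> ([a = 0] (mod int p) \<and> [b = 0] (mod int p) \<and> [c = 0] (mod int p))"
  shows "card {v. v < p \<and> [a + b * int v + c * (int v)\<^sup>2 = 0] (mod int p)} \<le> 2"
proof (rule ccontr)
  let ?S = "{v. v < p \<and> [a + b * int v + c * (int v)\<^sup>2 = 0] (mod int p)}"
  assume "\<not> card ?S \<le> 2"
  then have "3 \<le> card ?S" by simp
  then obtain T where "T \<subseteq> ?S" "card T = 3" by (meson obtain_subset_with_card_n)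
  then obtain x y z where xyz: "x \<in> ?S" "y \<in> ?S" "z \<in> ?S" "x \<noteq> y" "x \<noteq> z" "y \<noteq> z"
    by (auto simp: card_3_iff)
  have p': "prime (int p)" using p by simp
  have diff: "\<not> int p dvd int u - int v" if "u \<in> ?S" "v \<in> ?S" "u \<noteq> v" for u v
    using that by (auto simp: cong_iff_dvd_diff[symmetric] cong_int_iff cong_less_modulus_unique_nat)
  have slope: "int p dvd b + c * (int u + int v)" if "u \<in> ?S" "v \<in> ?S" "u \<noteq> v" for u v
  proof -
    have "int p dvd (a + b * int u + c * (int u)\<^sup>2) - (a + b * int v + c * (int v)\<^sup>2)"
      using that by (intro dvd_diff) (auto simp: cong_0_iff)
    also have "\<dots> = (int u - int v) * (b + c * (int u + int v))"
      by (simp add: algebra_simps power2_eq_square)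
    finally show ?thesis using diff[OF that] p' by (simp add: prime_dvd_mult_iff)
  qed
  have "int p dvd (b + c * (int x + int y)) - (b + c * (int x + int z))"
    using slope xyz by (intro dvd_diff) auto
  also have "\<dots> = c * (int y - int z)" by (simp add: algebra_simps)
  finally have c: "int p dvd c" using diff xyz p' by (simp add: prime_dvd_mult_iff)
  have b: "int p dvd b" using slope[of x y] xyz c by (simp add: dvd_add_left_iff)
  have "int p dvd a" using xyz(1) b c by (simp add: cong_0_iff dvd_add_left_iff add.assoc)
  then show False using nonzero b c by (simp add: cong_0_iff)
qed

subsection \<open>The game\<close>

definition claim_true :: "nat \<Rightarrow> (int list \<Rightarrow> int) \<Rightarrow> nat \<Rightarrow> nat list \<Rightarrow> op list \<Rightarrow> bool" where
  "claim_true p g c r os \<longleftrightarrow> [int c = arith g os (map int r)] (mod int p)"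

text \<open>The run of Alice's verdict with Bob's messages replaced by direct access to \<open>base\<close>.  Merlin is
  represented by the function \<open>\<sigma>\<close> from the coins that are yet to come to his replies; his first reply
  \<open>\<sigma> []\<close> is fixed before the coins of the first step.\<close>

fun run ::
    "nat \<Rightarrow> nat \<Rightarrow> (nat list \<Rightarrow> nat) \<Rightarrow> (bits list \<Rightarrow> bits) \<Rightarrow>
      bool \<times> nat \<times> nat list \<Rightarrow> op list \<Rightarrow> bits list \<Rightarrow> bool" where
  "run p l base \<sigma> st (x # os) (cn # cs) =
     run p l base (\<lambda>h. \<sigma> (cn # h)) (round_step p l base x cn (\<sigma> []) st) os cs"
| "run p l base \<sigma> st [] cs = fst st"
| "run p l base \<sigma> st os [] = fst st"

lemma run_rejected: "\<not> fst st \<Longrightarrow> \<not> run p l base \<sigma> st os cs"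
  by (induction p l base \<sigma> st os cs rule: run.induct)
    (auto simp: round_step_def split: op.split prod.split)

definition good_reply ::
    "nat \<Rightarrow> nat \<Rightarrow> (int list \<Rightarrow> int) \<Rightarrow> op \<Rightarrow> op list \<Rightarrow> nat list \<Rightarrow> bits \<Rightarrow> bool" where
  "good_reply p l g x os r w \<longleftrightarrow> (\<forall>Q j. x = Quant Q j \<longrightarrow>
     (\<forall>v. [int (reply_poly p l w v) = arith g os ((map int r)[j := int v])] (mod int p)))"

fun honest ::
    "nat \<Rightarrow> nat \<Rightarrow> (int list \<Rightarrow> int) \<Rightarrow> (bits list \<Rightarrow> bits) \<Rightarrow> op list \<Rightarrow> nat list \<Rightarrow> bool" where
  "honest p l g \<sigma> [] r \<longleftrightarrow> True"
| "honest p l g \<sigma> (x # os) r \<longleftrightarrow> good_reply p l g x os r (\<sigma> []) \<and>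
     (\<forall>cn. honest p l g (\<lambda>h. \<sigma> (cn # h)) os (move p x (residue p cn) r))"

fun op_var :: "op \<Rightarrow> nat" where
  "op_var (Quant Q j) = j"
| "op_var (Mux z a c b) = z"
| "op_var Check = 0"

text \<open>The coefficients of a quadratic polynomial are interpolated from its values at 0, 1 and -1.\<close>

definition honest_reply ::
    "nat \<Rightarrow> nat \<Rightarrow> (int list \<Rightarrow> int) \<Rightarrow> op \<Rightarrow> op list \<Rightarrow> nat list \<Rightarrow> bits" where
  "honest_reply p l g x os r =
     (let f = \<lambda>X. arith g os ((map int r)[op_var x := X]); c = (f 1 + f (- 1)) div 2 - f 0
      in concat (map (\<lambda>a. bits_of_nat l (nat (a mod int p))) [f 0, f 1 - f 0 - c, c]))"

fun merlin_reply ::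
    "nat \<Rightarrow> nat \<Rightarrow> (int list \<Rightarrow> int) \<Rightarrow> op list \<Rightarrow> nat list \<Rightarrow> bits list \<Rightarrow> bits" where
  "merlin_reply p l g (x # os) r [] = honest_reply p l g x os r"
| "merlin_reply p l g (x # os) r (cn # h) = merlin_reply p l g os (move p x (residue p cn) r) h"
| "merlin_reply p l g [] r h = replicate (3 * l) False"

lemma length_merlin_reply: "length (merlin_reply p l g os r h) = 3 * l"
  by (induction p l g os r h rule: merlin_reply.induct) (simp_all add: honest_reply_def Let_def)

locale game =
  fixes p k l n :: nat and g :: "int list \<Rightarrow> int" and base :: "nat list \<Rightarrow> nat"
  assumes prime: "prime p" and coins_le: "2 ^ k \<le> p" and room: "p \<le> 2 ^ l"
    and respects_cong: "respects_cong (int p) n g"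
    and base_less: "base r < p"
    and int_base: "valid_point p n r \<Longrightarrow> [int (base r) = g (map int r)] (mod int p)"
begin

lemma p_gt_1: "1 < p"
  using prime by (rule prime_gt_1_nat)

lemma p_pos: "0 < p"
  using p_gt_1 by simp

abbreviation "valid \<equiv> valid_point p n"
abbreviation "zeros \<equiv> replicate n (0::nat)"
abbreviation "true \<equiv> claim_true p g"

lemma length_valid: "valid r \<Longrightarrow> length r = n"
  by (simp add: valid_point_def)

lemma valid_update: "valid r \<Longrightarrow> valid (r[j := residue p cn])"
  using valid_point_move[OF p_pos, of n r "Quant Forall j" cn] by (simp add: move_def)

lemma valid_mux: "valid r \<Longrightarrow> valid (r[z := mux_mod p a c b r])"
  using valid_point_move[OF p_pos, of n r "Mux z a c b"] by (simp add: move_def)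

lemma map_zero_eq_zeros: "length r = n \<Longrightarrow> map (\<lambda>_. 0) r = zeros"
  by (simp add: map_replicate_const)

lemma quant_test_iff:
  assumes "valid r" "j < n" "s0 < p" "c < p"
    and s0: "[int s0 = arith g os ((map int r)[j := 0])] (mod int p)"
    and s1: "[int s1 = arith g os ((map int r)[j := 1])] (mod int p)"
  shows "quant_mod p Q (coord r j) s0 s1 = c \<longleftrightarrow> true c r (Quant Q j # os)"
proof -
  have r: "coord r j = r ! j" "r ! j < p" "map int r ! j = int (r ! j)"
    using valid_point_coord[OF assms(1,2)] assms(1,2) by (auto simp: valid_point_def)
  have "[int (quant_mod p Q (r ! j) s0 s1) =
      quant_poly Q (int (r ! j)) (int s0) (int s1)] (mod int p)"
    using r(2) assms(3) by (rule int_quant_mod)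
  also have "[quant_poly Q (int (r ! j)) (int s0) (int s1) =
      arith g (Quant Q j # os) (map int r)] (mod int p)"
    using s0 s1 by (simp add: r quant_poly_cong)
  finally have quant:
    "[int (quant_mod p Q (r ! j) s0 s1) = arith g (Quant Q j # os) (map int r)] (mod int p)" .
  have "quant_mod p Q (r ! j) s0 s1 = c \<longleftrightarrow> [int c = int (quant_mod p Q (r ! j) s0 s1)] (mod int p)"
    using mod_eq_iff_cong[OF assms(4), of "quant_mod p Q (r ! j) s0 s1"]
    by (simp add: quant_mod_def)
  also have "\<dots> \<longleftrightarrow> true c r (Quant Q j # os)"
    unfolding claim_true_def using quant by (meson cong_sym cong_trans)
  finally show ?thesis by (simp add: r)
qed

lemma true_Mux_iff:
  assumes "valid r" "op_below n (Mux z a d b)" "\<forall>y \<in> set os. op_below n y"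
  shows "true c (r[z := mux_mod p a d b r]) os \<longleftrightarrow> true c r (Mux z a d b # os)"
proof -
  have "list_all2 (\<lambda>a b. [a = b] (mod int p)) (map int (r[z := mux_mod p a d b r]))
      ((map int r)[z := mux_poly a d b (map int r)])"
    using assms(1,2)
    by (auto simp: map_update intro!: list_all2_update_cong list.rel_refl int_mux_mod)
  moreover have "length (map int (r[z := mux_mod p a d b r])) = n" using assms(1)
    by (simp add: length_valid)
  ultimately have "[arith g os (map int (r[z := mux_mod p a d b r])) =
      arith g (Mux z a d b # os) (map int r)] (mod int p)"
    using respects_cong_arith[OF respects_cong assms(3)] unfolding respects_cong_def arith.simps
    by blast
  then show ?thesis unfolding claim_true_def by (meson cong_sym cong_trans)
qed

lemma true_imp_base_eq:
  assumes "valid r" "c < p" "true c r []"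
  shows "base r = c"
proof -
  have "[int c = int (base r)] (mod int p)"
    using assms(3) int_base[OF assms(1)] unfolding claim_true_def arith.simps
    by (meson cong_sym cong_trans)
  then show ?thesis using mod_eq_iff_cong[OF assms(2), of "base r"] base_less[of r] by simp
qed

lemma base_eq_imp_true: "valid r \<Longrightarrow> base r = c \<Longrightarrow> true c r []"
  using int_base[of r] by (auto simp: claim_true_def)

subsection \<open>Soundness\<close>

lemma card_true_claims_le_2:
  assumes "valid r" "j < n" "quadratic_in n (arith g os) j" "c < p" "\<not> true c r (Quant Q j # os)"
    and test: "quant_mod p Q (coord r j) (reply_poly p l w 0) (reply_poly p l w 1) = c"
  shows "card {v. v < p \<and> true (reply_poly p l w v) (r[j := v]) os} \<le> 2"
proof -
  obtain A B C where ABC: "\<And>X. arith g os ((map int r)[j := X]) = A + B * X + C * X\<^sup>2"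
    using assms(1,3) unfolding quadratic_in_def by (metis length_map length_valid)
  define a b c' where "a = int (residue p (take l w))" and "b = int (residue p (take l (drop l w)))"
    and "c' = int (residue p (take l (drop (2 * l) w)))"
  have reply: "[int (reply_poly p l w v) = a + b * int v + c' * (int v)\<^sup>2] (mod int p)" for v
    unfolding a_def b_def c'_def by (rule int_reply_poly)
  have "\<not> ([a - A = 0] (mod int p) \<and> [b - B = 0] (mod int p) \<and> [c' - C = 0] (mod int p))"
  proof
    assume "[a - A = 0] (mod int p) \<and> [b - B = 0] (mod int p) \<and> [c' - C = 0] (mod int p)"
    then have "[a = A] (mod int p)" "[b = B] (mod int p)" "[c' = C] (mod int p)"
      by (auto simp: cong_diff_iff_cong_0)
    then have "[int (reply_poly p l w v) = arith g os ((map int r)[j := int v])] (mod int p)" for v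
      unfolding ABC by (intro cong_trans[OF reply] cong_add cong_mult cong_refl)
    from this[of 0] this[of 1] have "true c r (Quant Q j # os)"
      by (intro quant_test_iff[OF assms(1,2) reply_poly_less[OF p_pos] assms(4), THEN iffD1, OF _ _ test])
        simp_all
    then show False using assms(5) by blast
  qed
  from card_quadratic_roots_le_2[OF prime this]
  have "card {v. v < p \<and> [(a - A) + (b - B) * int v + (c' - C) * (int v)\<^sup>2 = 0] (mod int p)} \<le> 2" .
  moreover have "true (reply_poly p l w v) (r[j := v]) os \<longleftrightarrow>
      [(a - A) + (b - B) * int v + (c' - C) * (int v)\<^sup>2 = 0] (mod int p)" for v
  proof -
    have "true (reply_poly p l w v) (r[j := v]) os \<longleftrightarrow>
        [a + b * int v + c' * (int v)\<^sup>2 = A + B * int v + C * (int v)\<^sup>2] (mod int p)"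
      unfolding claim_true_def map_update ABC using reply[of v] by (meson cong_sym cong_trans)
    also have "\<dots> \<longleftrightarrow>
        [(a + b * int v + c' * (int v)\<^sup>2) - (A + B * int v + C * (int v)\<^sup>2) = 0] (mod int p)"
      by (rule cong_diff_iff_cong_0[symmetric])
    finally show ?thesis by (simp add: algebra_simps)
  qed
  ultimately show ?thesis by simp
qed

abbreviation "step \<equiv> round_step p l base"

definition accept_prob :: "(bits list \<Rightarrow> bits) \<Rightarrow> bool \<times> nat \<times> nat list \<Rightarrow> op list \<Rightarrow> real" where
  "accept_prob \<sigma> st os = list_prob (coins k) (length os) (run p l base \<sigma> st os)"

lemma accept_prob_le_1: "accept_prob \<sigma> st os \<le> 1"
  unfolding accept_prob_def list_prob_def by (rule measure_pmf.prob_le_1)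

lemma accept_prob_rejected: "\<not> fst st \<Longrightarrow> accept_prob \<sigma> st os = 0"
  using run_rejected[of st p l base \<sigma> os] by (simp add: accept_prob_def list_prob_def)

lemma accept_prob_Cons_le:
  assumes "\<And>cn. accept_prob (\<lambda>h. \<sigma> (cn # h)) (step x cn (\<sigma> []) st) os \<le> b"
  shows "accept_prob \<sigma> st (x # os) \<le> b"
  unfolding accept_prob_def list.size(4) add_Suc_right add_0_right
  by (rule list_prob_Suc_le[OF finite_coins coins_nonempty])
    (use assms in \<open>simp add: accept_prob_def\<close>)

lemma accept_prob_Cons_le_exceptional:
  assumes "card {cn \<in> coins k. bad cn} \<le> 2" "0 \<le> G" "0 \<le> b"
    and "\<And>cn. accept_prob (\<lambda>h. \<sigma> (cn # h)) (step x cn (\<sigma> []) st) os \<le> G"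
    and "\<And>cn. \<not> bad cn \<Longrightarrow> accept_prob (\<lambda>h. \<sigma> (cn # h)) (step x cn (\<sigma> []) st) os \<le> b"
  shows "accept_prob \<sigma> st (x # os) \<le> 2 / 2 ^ k * G + b"
  using list_prob_Suc_le_exceptional[OF finite_coins coins_nonempty assms(1-3),
      of "length os" "run p l base \<sigma> st (x # os)"]
    assms(4,5) by (simp add: accept_prob_def card_coins)

lemma inj_on_residue_coins: "inj_on (residue p) (coins k)"
proof (rule inj_onI)
  fix xs ys assume xy: "xs \<in> coins k" "ys \<in> coins k" "residue p xs = residue p ys"
  have "residue p cn = nat_of_bits cn" if "cn \<in> coins k" for cn
    using nat_of_bits_less[of cn] that coins_le by (simp add: coins_def residue_def)
  then show "xs = ys" using xy by (intro nat_of_bits_inj) (auto simp: coins_def)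
qed

lemma accept_prob_le_after_Check:
  assumes "\<And>\<sigma> ok. accept_prob \<sigma> (ok, 1, zeros) rest \<le> G" and "length r = n" "Check \<notin> set os"
  shows "accept_prob \<sigma> (ok, c, r) (os @ Check # rest) \<le> G"
  using assms(2-)
proof (induction os arbitrary: \<sigma> ok c r)
  case Nil
  then show ?case
    using assms(1) unfolding append_Nil
    by (intro accept_prob_Cons_le) (simp only: round_step_simps map_zero_eq_zeros)
next
  case (Cons x os)
  then show ?case
    unfolding append_Cons by (intro accept_prob_Cons_le) (auto simp: round_step_def)
qed

lemma accept_prob_Quant_le:
  assumes "valid r" "j < n" "quadratic_in n (arith g os) j" "c < p" "\<not> true c r (Quant Q j # os)"
    and any: "\<And>\<sigma> ok c r. length r = n \<Longrightarrow> accept_prob \<sigma> (ok, c, r) ops \<le> G"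
    and false: "\<And>\<sigma> ok c r. valid r \<Longrightarrow> c < p \<Longrightarrow> \<not> true c r os \<Longrightarrow> accept_prob \<sigma> (ok, c, r) ops \<le> b"
    and "0 \<le> G" "0 \<le> b"
  shows "accept_prob \<sigma> (ok, c, r) (Quant Q j # ops) \<le> 2 / 2 ^ k * G + b"
proof (cases "quant_mod p Q (coord r j) (reply_poly p l (\<sigma> []) 0) (reply_poly p l (\<sigma> []) 1) = c")
  case False
  then have "accept_prob \<sigma> (ok, c, r) (Quant Q j # ops) \<le> 0"
    by (intro accept_prob_Cons_le) (simp add: round_step_simps accept_prob_rejected)
  also have "0 \<le> 2 / 2 ^ k * G + b" using \<open>0 \<le> G\<close> \<open>0 \<le> b\<close> by simp
  finally show ?thesis .
next
  case True
  let ?c = "\<lambda>v. reply_poly p l (\<sigma> []) v"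
  let ?bad = "\<lambda>cn. true (?c (residue p cn)) (r[j := residue p cn]) os"
  show ?thesis
  proof (rule accept_prob_Cons_le_exceptional[where bad = ?bad])
    have "card {cn \<in> coins k. ?bad cn} \<le> card {v. v < p \<and> true (?c v) (r[j := v]) os}"
    proof (rule card_inj_on_le)
      show "inj_on (residue p) {cn \<in> coins k. ?bad cn}"
        by (rule inj_on_subset[OF inj_on_residue_coins]) auto
    qed (auto simp: residue_less[OF p_pos])
    also have "\<dots> \<le> 2" by (rule card_true_claims_le_2[OF assms(1-5) True])
    finally show "card {cn \<in> coins k. ?bad cn} \<le> 2" .
    show "accept_prob (\<lambda>h. \<sigma> (cn # h)) (step (Quant Q j) cn (\<sigma> []) (ok, c, r)) ops \<le> G" for cn
      unfolding round_step_simps by (rule any) (simp add: length_valid[OF assms(1)])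
    show "accept_prob (\<lambda>h. \<sigma> (cn # h)) (step (Quant Q j) cn (\<sigma> []) (ok, c, r)) ops \<le> b"
      if "\<not> ?bad cn" for cn
      unfolding round_step_simps
      by (rule false[OF valid_update[OF assms(1)] reply_poly_less[OF p_pos] that])
  qed fact+
qed

lemma accept_prob_false_claim_le:
  assumes rest: "\<And>\<sigma> ok. accept_prob \<sigma> (ok, 1, zeros) rest \<le> G" and "0 \<le> G"
    and "valid r" "c < p" "low_degree n g os" "Check \<notin> set os" "\<not> true c r os"
  shows "accept_prob \<sigma> (ok, c, r) (os @ Check # rest) \<le> real (length os) * (2 / 2 ^ k * G)"
  using assms(3-)
proof (induction os arbitrary: \<sigma> ok c r)
  case Nil
  then have "base r \<noteq> c" using base_eq_imp_true by blast
  then show ?case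
    unfolding append_Nil
    by (intro accept_prob_Cons_le) (simp add: round_step_simps accept_prob_rejected)
next
  case (Cons x os)
  let ?b = "real (length os) * (2 / 2 ^ k * G)"
  have "0 \<le> ?b" using \<open>0 \<le> G\<close> by simp
  have IH: "accept_prob \<sigma> (ok, c, r) (os @ Check # rest) \<le> ?b" if "valid r" "c < p" "\<not> true c r os"
    for \<sigma> ok c r
    using Cons.IH Cons.prems that by simp
  have "accept_prob \<sigma> (ok, c, r) (x # os @ Check # rest) \<le> 2 / 2 ^ k * G + ?b"
  proof (cases x)
    case (Quant Q j)
    show ?thesis unfolding Quant
    proof (rule accept_prob_Quant_le)
      show "accept_prob \<sigma> (ok, c, r) (os @ Check # rest) \<le> G" if "length r = n" for \<sigma> ok c r
        by (rule accept_prob_le_after_Check[OF rest that]) (use Cons.prems in simp)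
    qed (use Cons.prems IH Quant \<open>0 \<le> G\<close> \<open>0 \<le> ?b\<close> in auto)
  next
    case (Mux z a d b)
    have "\<not> true c (r[z := mux_mod p a d b r]) os"
      using Cons.prems Mux true_Mux_iff low_degree_op_below[of n g os] by simp
    then have "accept_prob \<sigma> (ok, c, r) (x # os @ Check # rest) \<le> ?b"
      unfolding Mux using Cons.prems
      by (intro accept_prob_Cons_le) (simp only: round_step_simps IH valid_mux not_False_eq_True)
    also have "?b \<le> 2 / 2 ^ k * G + ?b" using \<open>0 \<le> G\<close> by simp
    finally show ?thesis .
  qed (use Cons.prems in simp)
  also have "\<dots> = real (length (x # os)) * (2 / 2 ^ k * G)"
    by (simp add: distrib_right add_divide_distrib)
  finally show ?case by simp
qed

lemma accept_prob_repeat_ops_le: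
  assumes "low_degree n g os" "Check \<notin> set os" "\<not> true 1 zeros os"
  shows "accept_prob \<sigma> (ok, 1, zeros) (repeat_ops m os) \<le> (real (length os) * (2 / 2 ^ k)) ^ m"
proof (induction m arbitrary: \<sigma> ok)
  case 0
  then show ?case by (simp add: accept_prob_le_1)
next
  case (Suc m)
  have "accept_prob \<sigma> (ok, 1, zeros) (os @ Check # repeat_ops m os)
      \<le> real (length os) * (2 / 2 ^ k * (real (length os) * (2 / 2 ^ k)) ^ m)"
    by (rule accept_prob_false_claim_le[OF Suc.IH _ valid_point_zeros[OF p_pos] p_gt_1 assms]) simp
  then show ?case by (simp add: mult.assoc)
qed

subsection \<open>Completeness\<close>

lemma good_reply_honest_reply:
  assumes "valid r" "low_degree n g (x # os)"
  shows "good_reply p l g x os r (honest_reply p l g x os r)"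
  unfolding good_reply_def
proof (intro allI impI)
  fix Q j v assume x: "x = Quant Q j"
  then have "quadratic_in n (arith g os) j" using assms(2) by simp
  then obtain A B C where ABC: "\<And>X. arith g os ((map int r)[j := X]) = A + B * X + C * X\<^sup>2"
    using assms(1) unfolding quadratic_in_def by (metis length_map length_valid)
  define enc where "enc a = bits_of_nat l (nat (a mod int p))" for a
  have len: "length (enc a) = l" for a by (simp add: enc_def)
  have enc: "[int (residue p (enc a)) = a] (mod int p)" for a
  proof -
    have a: "0 \<le> a mod int p" "a mod int p < int p" using p_pos by simp_all
    then have less: "nat (a mod int p) < p" by linarith
    then have "residue p (enc a) = nat (a mod int p)"
      using less_le_trans[OF less room] by (simp add: enc_def residue_def nat_of_bits_of_nat)
    then show ?thesis using a(1) by (simp add: cong_def)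
  qed
  have reply: "honest_reply p l g x os r = enc A @ enc B @ enc C"
    by (simp add: honest_reply_def Let_def x ABC enc_def)
  have "[int (reply_poly p l (enc A @ enc B @ enc C) v) = int (residue p (enc A)) +
      int (residue p (enc B)) * int v + int (residue p (enc C)) * (int v)\<^sup>2] (mod int p)"
    using int_reply_poly[of p l "enc A @ enc B @ enc C" v] by (simp add: len mult_2)
  also have "[int (residue p (enc A)) + int (residue p (enc B)) * int v +
      int (residue p (enc C)) * (int v)\<^sup>2
      = A + B * int v + C * (int v)\<^sup>2] (mod int p)"
    by (intro cong_add cong_mult enc cong_refl)
  finally show "[int (reply_poly p l (honest_reply p l g x os r) v) =
      arith g os ((map int r)[j := int v])] (mod int p)"
    unfolding reply ABC .
qed

lemma honest_merlin_reply:
  "valid r \<Longrightarrow> low_degree n g os \<Longrightarrow> honest p l g (merlin_reply p l g os r) os r"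
proof (induction os arbitrary: r)
  case (Cons x os)
  then show ?case
    using good_reply_honest_reply valid_point_move[OF p_pos] by auto
qed simp

lemma step_true_claim:
  assumes "valid r" "c < p" "low_degree n g (x # os)" "x \<noteq> Check" "true c r (x # os)"
    and good: "good_reply p l g x os r w"
  obtains c' where "step x cn w (True, c, r) = (True, c', move p x (residue p cn) r)" "c' < p"
    "true c' (move p x (residue p cn) r) os"
proof (cases x)
  case (Quant Q j)
  have reply: "[int (reply_poly p l w v) = arith g os ((map int r)[j := int v])] (mod int p)" for v
    using good unfolding good_reply_def Quant by blast
  have "quant_mod p Q (coord r j) (reply_poly p l w 0) (reply_poly p l w 1) = c"
    using reply[of 0] reply[of 1] assms(1-5) Quant
    by (intro quant_test_iff[THEN iffD2]) (auto simp: reply_poly_less p_pos)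
  then show ?thesis
    using that[of "reply_poly p l w (residue p cn)"] reply[of "residue p cn"]
    by (simp add: Quant round_step_simps move_def reply_poly_less[OF p_pos] claim_true_def map_update)
next
  case (Mux z a d b)
  then show ?thesis
    using that[of c] assms true_Mux_iff[of r z a d b os c] low_degree_op_below[of n g os]
    by (simp add: round_step_simps move_def)
qed (use assms in simp)

lemma run_accepts_until_Check:
  assumes rest: "\<And>\<sigma> cs. honest p l g \<sigma> rest zeros \<Longrightarrow> length cs = length rest \<Longrightarrow>
      run p l base \<sigma> (True, 1, zeros) rest cs"
    and "honest p l g \<sigma> (os @ Check # rest) r" "length cs = length (os @ Check # rest)"
    and "valid r" "c < p" "low_degree n g os" "Check \<notin> set os" "true c r os"
  shows "run p l base \<sigma> (True, c, r) (os @ Check # rest) cs"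
  using assms(2-)
proof (induction os arbitrary: \<sigma> c r cs)
  case Nil
  then obtain cn cs' where cs: "cs = cn # cs'" "length cs' = length rest" by (cases cs) auto
  have "base r = c" using Nil by (intro true_imp_base_eq)
  moreover have zeros: "map (\<lambda>_. 0) r = zeros" using Nil(3)
    by (simp add: map_zero_eq_zeros length_valid)
  moreover have "honest p l g (\<lambda>h. \<sigma> (cn # h)) rest zeros" using Nil(1) zeros
    by (simp add: move_def)
  ultimately show ?case using rest cs by (simp add: round_step_simps)
next
  case (Cons x os)
  then obtain cn cs' where cs: "cs = cn # cs'" "length cs' = length (os @ Check # rest)"
    by (cases cs) auto
  have "good_reply p l g x os r (\<sigma> [])"
    using Cons.prems by (simp add: good_reply_def arith_append_Check)
  then obtain c' where "step x cn (\<sigma> []) (True, c, r) = (True, c', move p x (residue p cn) r)"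
    "c' < p"
      "true c' (move p x (residue p cn) r) os"
    using step_true_claim[of r c x os "\<sigma> []" cn] Cons.prems by auto
  then show ?case
    using Cons.IH[of "\<lambda>h. \<sigma> (cn # h)" "move p x (residue p cn) r" cs' c'] Cons.prems cs
      valid_point_move[OF p_pos] by simp
qed

lemma run_accepts_repeat_ops:
  assumes "low_degree n g os" "Check \<notin> set os" "true 1 zeros os"
    and "honest p l g \<sigma> (repeat_ops m os) zeros" "length cs = length (repeat_ops m os)"
  shows "run p l base \<sigma> (True, 1, zeros) (repeat_ops m os) cs"
  using assms(4,5)
proof (induction m arbitrary: \<sigma> cs)
  case (Suc m)
  then show ?case
    using run_accepts_until_Check[OF Suc.IH, of \<sigma> os zeros cs 1] assms(1-3)
      valid_point_zeros[OF p_pos] p_gt_1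
    by simp
qed simp

lemma low_degree_repeat_ops:
  "low_degree n g os \<Longrightarrow> Check \<notin> set os \<Longrightarrow> low_degree n g (repeat_ops m os)"
  by (induction m) (simp_all add: low_degree_append_Check)

end

section \<open>From transcripts to the game\<close>

fun replies :: "strategy \<Rightarrow> transcript \<Rightarrow> bits list \<Rightarrow> transcript" where
  "replies m tr [] = []"
| "replies m tr (c # cs) = (c, [], m tr c []) # replies m (tr @ [(c, [], m tr c [])]) cs"

lemma play_eq_replies:
  assumes "\<And>xa tr c. ip_alice \<pi> xa tr c = []"
  shows "play \<pi> xa m cs = replies m [] cs"
proof -
  have "foldl (\<lambda>tr c. let a = ip_alice \<pi> xa tr c in tr @ [(c, a, m tr c a)]) tr cs =
      tr @ replies m tr cs" for tr
    by (induction cs arbitrary: tr) (simp_all add: assms Let_def)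
  then show ?thesis unfolding play_def by simp
qed

lemma exchanged_bits_replies:
  assumes "\<And>tr c a. length tr < n \<Longrightarrow> length (m tr c a) = k" "length tr + length cs \<le> n"
  shows "exchanged_bits (replies m tr cs) = length cs * k"
  using assms(2)
proof (induction cs arbitrary: tr)
  case (Cons c cs)
  have "exchanged_bits (replies m (tr @ [(c, [], m tr c [])]) cs) = length cs * k"
    by (rule Cons.IH) (use Cons.prems in simp)
  then show ?case using assms(1)[of tr] Cons.prems by (simp add: exchanged_bits_def)
qed (simp add: exchanged_bits_def)

fun response :: "strategy \<Rightarrow> transcript \<Rightarrow> bits \<Rightarrow> bits list \<Rightarrow> bits" where
  "response m tr c [] = m tr c []"
| "response m tr c (cn # h) = response m (tr @ [(c, [], m tr c [])]) cn h"

lemma response_of_coins: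
  "response (\<lambda>tr c a. f (tl (map fst tr @ [c]))) tr c h = f (tl (map fst tr @ [c]) @ h)"
proof (induction h arbitrary: tr c)
  case (Cons cn h)
  have "tl (map fst tr @ [c] @ [cn]) @ h = tl (map fst tr @ [c]) @ cn # h"
    by (cases tr) simp_all
  then show ?case using Cons.IH[of "tr @ [(c, [], f (tl (map fst tr @ [c])))]" cn] by simp
qed simp

fun bob_messages :: "inst \<Rightarrow> bits \<Rightarrow> nat list \<Rightarrow> op list \<Rightarrow> bits list \<Rightarrow> bits" where
  "bob_messages I xb r (x # os) (cn # cs) =
     (if x = Check then bits_of_nat (elem_bits I) (bob_value I xb r) else [])
     @ bob_messages I xb (move (modulus I) x (residue (modulus I) cn) r) os cs"
| "bob_messages I xb r [] cs = []"
| "bob_messages I xb r os [] = []"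

lemma bob_eq_bob_messages:
  "bob I xb cs = bob_messages I xb (replicate (point_dim I) 0) (all_ops I) (drop 1 cs)"
proof -
  have "snd (foldl (bob_step I xb) (r, bs) (zip os cs)) = bs @ bob_messages I xb r os cs"
    for r bs os cs
    by (induction I xb r os cs arbitrary: bs rule: bob_messages.induct) (simp_all add: bob_step_def)
  then show ?thesis unfolding bob_def by simp
qed

lemma length_bob_messages:
  "length os = length cs \<Longrightarrow>
    length (bob_messages I xb r os cs) = length (filter (\<lambda>x. x = Check) os) * elem_bits I"
  by (induction os cs arbitrary: r rule: list_induct2) auto

definition joint_value :: "inst \<Rightarrow> bits \<Rightarrow> bits \<Rightarrow> nat list \<Rightarrow> nat" where
  "joint_value I xa xb r = (alice_value I xa r + bob_value I xb r) mod modulus I"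

lemma verdict_eq_run:
  assumes room: "modulus I \<le> 2 ^ elem_bits I" and "length cs = length (all_ops I)"
  shows "verdict I xa (replies m [] (c0 # cs)) (bob I xb (c0 # cs)) \<longleftrightarrow>
    run (modulus I) (elem_bits I) (joint_value I xa xb) (response m [] c0)
      (True, 1, replicate (point_dim I) 0) (all_ops I) cs"
proof -
  have bob: "residue (modulus I) (bits_of_nat (elem_bits I) (bob_value I xb r)) = bob_value I xb r"
    for r
    using less_le_trans[OF party_value_less room]
    by (simp add: residue_def nat_of_bits_of_nat party_value_less)
  have step: "alice_step I xa ((ok, c, r), bob_messages I xb r (x # os) (cn # cs)) (x, cn, a, w) =
      (round_step (modulus I) (elem_bits I) (joint_value I xa xb) x cn w (ok, c, r),
       bob_messages I xb (move (modulus I) x (residue (modulus I) cn) r) os cs)"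
     for ok c r x os cn cs a w
    by (cases x) (simp_all add: alice_step_def round_step_def joint_value_def bob)
  have "fst (fst (foldl (alice_step I xa) ((ok, c, r), bob_messages I xb r os cs)
      (zip os (zip (map fst (drop 1 (replies m tr (c0 # cs))))
        (map snd (replies m tr (c0 # cs))))))) \<longleftrightarrow>
    run (modulus I) (elem_bits I) (joint_value I xa xb) (response m tr c0) (ok, c, r) os cs"
    if "length os = length cs" for os cs tr c0 ok c r
    using that
  proof (induction os cs arbitrary: tr c0 ok c r rule: list_induct2)
    case (Cons x os cn cs)
    let ?w = "m tr c0 []"
    obtain ok' c' where
      "round_step (modulus I) (elem_bits I) (joint_value I xa xb) x cn ?w (ok, c, r) =
        (ok', c', move (modulus I) x (residue (modulus I) cn) r)"
      by (simp add: round_step_def)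
    then show ?case
      using Cons.IH[where tr = "tr @ [(c0, [], ?w)]"] step[of ok c r x os cn cs "[]" ?w] by simp
  qed simp
  from this[of "all_ops I" cs True 1 "replicate (point_dim I) 0" "[]" c0] show ?thesis
    unfolding verdict_def bob_eq_bob_messages using assms(2) by simp
qed

section \<open>The parties' values as a multilinear extension\<close>

lemma int_weight_mod:
  assumes "\<forall>a \<in> set r. a < p"
  shows "[int (weight_mod p r y) = vertex_weight (map int r) y] (mod int p)"
proof -
  let ?f = "\<lambda>acc (x, b). acc * (if b then x else compl_mod p x) mod p"
  have "[int (foldl ?f a (zip r y)) = int a * vertex_weight (map int r) y] (mod int p)" for a
    using assms
  proof (induction r y arbitrary: a rule: list_induct2')
    case (4 x r b y)
    have "[int (?f a (x, b)) = int a * (if b then int x else 1 - int x)] (mod int p)"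
      using int_compl_mod[of x p] 4(2)
      by (simp only: split_conv) (rule cong_trans[OF int_mod_cong], auto intro!: cong_mult)
    then have "[int (?f a (x, b)) * vertex_weight (map int r) y =
        int a * (if b then int x else 1 - int x) * vertex_weight (map int r) y] (mod int p)"
      by (rule cong_mult) (rule cong_refl)
    moreover have "[int (foldl ?f (?f a (x, b)) (zip r y)) =
        int (?f a (x, b)) * vertex_weight (map int r) y] (mod int p)"
      using 4(2) by (intro 4(1)) simp
    ultimately have "[int (foldl ?f (?f a (x, b)) (zip r y)) =
        int a * (if b then int x else 1 - int x) * vertex_weight (map int r) y] (mod int p)"
      by (rule cong_trans[rotated])
    then show ?case by (simp add: mult.assoc)
  qed simp_all
  from this[of 1] show ?thesis unfolding weight_mod_def by simp
qed

lemma int_foldl_add_mod: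
  assumes "\<And>y. [int (f y) = h y] (mod int p)"
  shows "[int (foldl (\<lambda>acc y. (acc + f y) mod p) a ys) = int a + (\<Sum>y\<leftarrow>ys. h y)] (mod int p)"
proof (induction ys arbitrary: a)
  case (Cons y ys)
  have "[int ((a + f y) mod p) = int (a + f y)] (mod int p)" by (rule int_mod_cong)
  also have "[int (a + f y) = int a + h y] (mod int p)"
    unfolding of_nat_add by (rule cong_add[OF cong_refl assms])
  finally have "[int ((a + f y) mod p) + (\<Sum>y\<leftarrow>ys. h y) = int a + h y + (\<Sum>y\<leftarrow>ys. h y)] (mod int p)"
    by (rule cong_add) (rule cong_refl)
  from cong_trans[OF Cons.IH this] show ?case by (simp add: add.assoc)
qed simp

lemma int_party_value:
  assumes "valid_point (modulus I) (point_dim I) r"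
  shows "[int (party_value I off pad xs r) =
    multilinear_ext (\<lambda>y. of_bool (party_entry I off pad xs y)) (map int r)] (mod int (modulus I))"
proof -
  have r: "length r = point_dim I" "\<forall>a \<in> set r. a < modulus I" using assms
    by (auto simp: valid_point_def)
  have "[int (if party_entry I off pad xs y then weight_mod (modulus I) r y else 0) =
      vertex_weight (map int r) y * of_bool (party_entry I off pad xs y)]
      (mod int (modulus I))" for y
    using int_weight_mod[OF r(2), of y] by auto
  from int_foldl_add_mod[OF this, where a = 0 and ys = "cube (point_dim I)"] show ?thesis
    unfolding party_value_def multilinear_ext_eq_sum_list by (simp add: r(1))
qed

section \<open>The instance of a branching program\<close>

definition inst_of :: "branching_program \<Rightarrow> real \<Rightarrow> inst" where
  "inst_of P \<epsilon> = ((bp_vars P, bp_length P, bp_width P,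
      map (\<lambda>i. (bp_label P i, map (\<lambda>u. map (\<lambda>v.
          ((i, u, False, v) \<in> bp_edges P, (i, u, True, v) \<in> bp_edges P))
        [0..<bp_width P]) [0..<bp_width P])) [0..<bp_length P - 1]),
    nat \<lceil>log 2 (1 / \<epsilon>)\<rceil>)"

lemma code_map: "code (map f xs) = code_list (\<lambda>x. code (f x)) xs"
  by (induction xs) (simp_all add: code_list_def)

lemma code_inst_of: "code (inst_of P \<epsilon>) = code_instance P \<epsilon>"
  unfolding inst_of_def code_instance_def code_bp_def code_Pair code_map
  by (simp add: code_eq_code_nat code_eq_code_bool)

lemma inst_of_simps [simp]:
  "inst_vars (inst_of P \<epsilon>) = bp_vars P" "inst_length (inst_of P \<epsilon>) = bp_length P"
  "inst_width (inst_of P \<epsilon>) = bp_width P" "inst_precision (inst_of P \<epsilon>) = nat \<lceil>log 2 (1 / \<epsilon>)\<rceil>"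
  "index_bits (inst_of P \<epsilon>) = floorlog 2 (bp_length P)"
    "node_bits (inst_of P \<epsilon>) = floorlog 2 (bp_width P)"
  by (simp_all add: inst_of_def inst_vars_def inst_length_def inst_width_def inst_precision_def
      index_bits_def node_bits_def)

text \<open>Identity layers pad the length of the program to a power of two.\<close>

definition entry :: "branching_program \<Rightarrow> bits \<Rightarrow> nat \<Rightarrow> nat \<Rightarrow> nat \<Rightarrow> bool" where
  "entry P x i u v \<longleftrightarrow> (if i < bp_length P - 1 then (i, u, x ! bp_label P i, v) \<in> bp_edges P
     else u = v \<and> u < pow2_above (bp_width P))"

definition entry_at :: "branching_program \<Rightarrow> bits \<Rightarrow> bits \<Rightarrow> bool" where
  "entry_at P x y = (let K = floorlog 2 (bp_length P); L = floorlog 2 (bp_width P) in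
     entry P x (nat_of_bits (take K y)) (nat_of_bits (take L (drop K y)))
       (nat_of_bits (take L (drop (K + L) y))))"

lemma entry_target_less:
  assumes "wf_bp P" "entry P x i u v"
  shows "v < pow2_above (bp_width P)"
  using assms less_pow2_above[of "bp_width P"]
  unfolding entry_def wf_bp_def by (auto split: if_splits intro: less_trans)

lemma party_entry_inst_of:
  fixes P y
  defines "i \<equiv> nat_of_bits (take (floorlog 2 (bp_length P)) y)"
    and "u \<equiv> nat_of_bits (take (floorlog 2 (bp_width P)) (drop (floorlog 2 (bp_length P)) y))"
    and "v \<equiv> nat_of_bits (take (floorlog 2 (bp_width P))
        (drop (floorlog 2 (bp_length P) + floorlog 2 (bp_width P)) y))"
  assumes "wf_bp P"
  shows "party_entry (inst_of P \<epsilon>) off pad xs y \<longleftrightarrow> (if i < bp_length P - 1 then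
      off \<le> bp_label P i \<and> bp_label P i < off + length xs \<and>
        (i, u, nth_default False xs (bp_label P i - off), v) \<in> bp_edges P
    else pad \<and> u = v)"
proof -
  define row where
    "row i = map (\<lambda>u. map (\<lambda>v. ((i, u, False, v) \<in> bp_edges P, (i, u, True, v) \<in> bp_edges P))
       [0..<bp_width P]) [0..<bp_width P]" for i
  have table: "inst_table (inst_of P \<epsilon>) = map (\<lambda>i. (bp_label P i, row i)) [0..<bp_length P - 1]"
    by (simp add: inst_table_def inst_of_def row_def)
  have "u < bp_width P \<and> v < bp_width P" if "(i, u, c, v) \<in> bp_edges P" for c
    using assms(4) that unfolding wf_bp_def by auto
  then have "nth_default (False, False) (nth_default [] (row i) u) v =
      ((i, u, False, v) \<in> bp_edges P, (i, u, True, v) \<in> bp_edges P)"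
    by (auto simp: nth_default_def row_def)
  moreover have "nth_default (0, []) (inst_table (inst_of P \<epsilon>)) i = (bp_label P i, row i)"
    if "i < bp_length P - 1"
    using that unfolding table by (simp add: nth_default_nth)
  ultimately show ?thesis
    unfolding party_entry_def Let_def inst_of_simps i_def[symmetric] u_def[symmetric] v_def[symmetric]
    by (simp add: table)
qed

lemma party_entry_sum:
  assumes wf: "wf_bp P" and "length x = bp_vars P"
  shows "of_bool (party_entry (inst_of P \<epsilon>) 0 True (alice_part P x) y) +
     of_bool (party_entry (inst_of P \<epsilon>) (bp_vars P div 2) False (bob_part P x) y) =
     (of_bool (entry_at P x y) :: int)"
proof -
  let ?K = "floorlog 2 (bp_length P)" and ?L = "floorlog 2 (bp_width P)"
  define i u v where "i = nat_of_bits (take ?K y)" and "u = nat_of_bits (take ?L (drop ?K y))"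
    and "v = nat_of_bits (take ?L (drop (?K + ?L) y))"
  have at: "entry_at P x y = entry P x i u v" by (simp add: entry_at_def Let_def i_def u_def v_def)
  note party = party_entry_inst_of[OF wf, of \<epsilon> _ _ _ y, folded i_def u_def v_def]
  show ?thesis
  proof (cases "i < bp_length P - 1")
    case True
    then have label: "bp_label P i < bp_vars P" using wf unfolding wf_bp_def by auto
    have "length (alice_part P x) = bp_vars P div 2"
      "length (bob_part P x) = bp_vars P - bp_vars P div 2"
      using assms(2) by (auto simp: alice_part_def bob_part_def)
    moreover have "nth_default False (alice_part P x) (bp_label P i) = x ! bp_label P i"
      if "bp_label P i < bp_vars P div 2"
      using that assms(2) by (simp add: alice_part_def nth_default_def)
    moreover have "nth_default False (bob_part P x) (bp_label P i - bp_vars P div 2) =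
        x ! bp_label P i"
      if "bp_vars P div 2 \<le> bp_label P i"
      using that assms(2) label by (auto simp: bob_part_def nth_default_def)
    ultimately show ?thesis
      unfolding at party entry_def using True label by (cases "bp_label P i < bp_vars P div 2") auto
  next
    case False
    have "u < 2 ^ length (take ?L (drop ?K y))" unfolding u_def by (rule nat_of_bits_less)
    also have "\<dots> \<le> pow2_above (bp_width P)" unfolding pow2_above_def
      by (rule power_increasing) simp_all
    finally show ?thesis unfolding at party entry_def using False by auto
  qed
qed

lemma reach_entry_iff_accepts:
  assumes wf: "wf_bp P"
  shows "reach (entry P x) 0 (pow2_above (bp_length P)) 0 0 \<longleftrightarrow> bp_accepts P x"
proof -
  let ?T = "bp_length P" and ?W = "pow2_above (bp_width P)"
  have idle: "reach (entry P x) i n u v \<longleftrightarrow> u = v" if "?T - 1 \<le> i" "u < ?W" for i n u v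
    using that by (induction n arbitrary: i) (auto simp: entry_def)
  have less: "v < ?W" if "reach (entry P x) i n 0 v" for i n v
    using reach_invariant[OF that, of "\<lambda>v. v < ?W"] entry_target_less[OF wf]
    by (auto simp: pow2_above_def)
  have "?T - 1 \<le> pow2_above ?T" using less_pow2_above[of ?T] by simp
  then obtain d where d: "pow2_above ?T = (?T - 1) + d" using le_Suc_ex by blast
  have "reach (entry P x) 0 (pow2_above ?T) 0 0 \<longleftrightarrow> reach (entry P x) 0 (?T - 1) 0 0"
    unfolding d reach_add using idle[of "?T - 1"] less by auto
  also have "\<dots> \<longleftrightarrow> bp_accepts P x"
    unfolding reach_iff_path bp_accepts_def using wf
    by (auto simp: entry_def less_diff_conv wf_bp_def)
  finally show ?thesis .
qed

lemma holds_body_ops_iff_accepts: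
  assumes wf: "wf_bp P"
  shows "holds (entry_at P x) (body_ops (inst_of P \<epsilon>)) (replicate (point_dim (inst_of P \<epsilon>)) False) \<longleftrightarrow>
      bp_accepts P x"
proof -
  let ?K = "floorlog 2 (bp_length P)" and ?L = "floorlog 2 (bp_width P)"
  have zeros: "replicate (point_dim (inst_of P \<epsilon>)) False =
      replicate ?K False @ replicate ?L False @ replicate ?L False @ replicate ?L False"
    by (simp add: point_dim_def replicate_add[symmetric])
  have "holds (entry_at P x) (body_ops (inst_of P \<epsilon>)) (replicate (point_dim (inst_of P \<epsilon>)) False) \<longleftrightarrow>
      holds (entry_at P x) (reach_ops ?K ?L ?K)
        (replicate ?K False @ replicate ?L False @ replicate ?L False @ replicate ?L False)"
    unfolding body_ops_def holds_linearize zeros by simp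
  also have "\<dots> \<longleftrightarrow> reach (entry P x)
      (nat_of_bits (replicate ?K False @ drop ?K (replicate ?K False))) (2 ^ ?K)
      (nat_of_bits (replicate ?L False)) (nat_of_bits (replicate ?L False))"
  proof (rule holds_reach_ops)
    show "v < 2 ^ ?L" if "entry P x i u v" for i u v
      using entry_target_less[OF wf that] by (simp add: pow2_above_def)
    show "entry_at P x (J @ s @ t @ w) = entry P x (nat_of_bits J) (nat_of_bits s) (nat_of_bits t)"
      if "length J = ?K" "length s = ?L" "length t = ?L" "length w = ?L" for J s t w
      using that by (simp add: entry_at_def Let_def)
  qed auto
  also have "\<dots> \<longleftrightarrow> bp_accepts P x"
    using reach_entry_iff_accepts[OF wf] by (simp add: nat_of_bits_replicate_False pow2_above_def)
  finally show ?thesis .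
qed

section \<open>Parameters of the protocol\<close>

lemma length_body_ops: "length (body_ops I) = num_ops I"
  by (simp add: body_ops_def num_ops_def length_linearize length_reach_ops)

lemma length_all_ops: "length (all_ops I) = repetitions I * (num_ops I + 1)"
proof -
  have "length (repeat_ops n os) = n * (length os + 1)" for n os by (induction n) auto
  then show ?thesis by (simp add: all_ops_def length_body_ops)
qed

lemma Check_notin_body_ops: "Check \<notin> set (body_ops I)"
  unfolding body_ops_def
  by (rule Check_notin_linearize)
    (use proper_op_reach_ops[of "index_bits I" "index_bits I" "node_bits I"] in fastforce)

lemma count_Check_all_ops: "length (filter (\<lambda>x. x = Check) (all_ops I)) = repetitions I"
proof -
  have "filter (\<lambda>x. x = Check) (body_ops I) = []"
    using Check_notin_body_ops[of I] by (auto simp: filter_empty_conv)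
  then have "length (filter (\<lambda>x. x = Check) (repeat_ops n (body_ops I))) = n" for n
    by (induction n) simp_all
  then show ?thesis by (simp add: all_ops_def)
qed

lemma low_degree_body_ops:
  assumes "\<And>i. affine_in (point_dim I) g i"
  shows "low_degree (point_dim I) g (body_ops I)"
  unfolding body_ops_def point_dim_def
  by (rule low_degree_linearize[OF _ proper_op_reach_ops])
    (use assms in \<open>simp_all add: point_dim_def\<close>)

lemma num_ops_ge_20:
  assumes "wf_bp P"
  shows "20 \<le> num_ops (inst_of P \<epsilon>)"
proof -
  let ?K = "floorlog 2 (bp_length P)" and ?L = "floorlog 2 (bp_width P)"
  have "1 \<le> ?K" "1 \<le> ?L"
    using assms less_floorlog_iff[of 0] by (auto simp: wf_bp_def Suc_le_eq)
  then have "1 * (3 * 1 + 1) * (1 + 3 * 1 + 1) \<le> ?K * (3 * ?L + 1) * (?K + 3 * ?L + 1)"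
    by (intro mult_mono add_mono) auto
  then show ?thesis by (simp add: num_ops_def point_dim_def)
qed

lemma modulus_bounds:
  assumes "0 < num_ops I"
  shows "prime (modulus I)" "2 ^ coin_bits I \<le> modulus I" "modulus I \<le> 2 ^ elem_bits I"
proof -
  define s where "s = pow2_above (2 * num_ops I)"
  have powers: "2 ^ coin_bits I = s\<^sup>2" "2 ^ elem_bits I = s ^ 5"
    unfolding s_def pow2_above_def coin_bits_def elem_bits_def gain_def
    by (simp_all only: mult.commute[of _ "floorlog 2 (2 * num_ops I)"] power_mult)
  have "3 \<le> s" using less_pow2_above[of "2 * num_ops I"] assms by (simp add: s_def)
  then have "3 * 3 \<le> s * s" by (intro mult_mono) auto
  then have "7 \<le> s\<^sup>2" by (simp add: power2_eq_square)
  then obtain q where q: "prime q" "s\<^sup>2 < q" "q \<le> 2 * (s\<^sup>2)\<^sup>2" using ex_prime_between_square by blast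
  note \<open>q \<le> 2 * (s\<^sup>2)\<^sup>2\<close>
  also have "2 * (s\<^sup>2)\<^sup>2 < s * (s\<^sup>2)\<^sup>2" using \<open>3 \<le> s\<close> by (intro mult_strict_right_mono) auto
  also have "s * (s\<^sup>2)\<^sup>2 = s ^ 5" by (simp add: eval_nat_numeral mult.assoc)
  finally have "q \<in> set (primes_between (Suc (s\<^sup>2)) (s ^ 5))" using q
    by (simp add: set_primes_between)
  then obtain p ps where ps: "primes_between (Suc (s\<^sup>2)) (s ^ 5) = p # ps"
    by (cases "primes_between (Suc (s\<^sup>2)) (s ^ 5)") auto
  then have "modulus I = p" by (simp add: modulus_def s_def[symmetric])
  moreover have "p \<in> set (primes_between (Suc (s\<^sup>2)) (s ^ 5))" by (simp add: ps)
  then have "prime p" "s\<^sup>2 < p" "p < s ^ 5" unfolding set_primes_between by simp_all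
  ultimately show "prime (modulus I)" "2 ^ coin_bits I \<le> modulus I" "modulus I \<le> 2 ^ elem_bits I"
    unfolding powers by simp_all
qed

definition extension :: "branching_program \<Rightarrow> bits \<Rightarrow> int list \<Rightarrow> int" where
  "extension P x = multilinear_ext (\<lambda>y. of_bool (entry_at P x y))"

lemma game_inst_of:
  fixes \<epsilon> :: real
  assumes wf: "wf_bp P" and x: "length x = bp_vars P"
  defines "I \<equiv> inst_of P \<epsilon>"
  shows "game (modulus I) (coin_bits I) (elem_bits I) (point_dim I) (extension P x)
    (joint_value I (alice_part P x) (bob_part P x))"
proof
  have "0 < num_ops I" using num_ops_ge_20[OF wf, of \<epsilon>] by (simp add: I_def)
  then show "prime (modulus I)" "2 ^ coin_bits I \<le> modulus I" "modulus I \<le> 2 ^ elem_bits I"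
    by (rule modulus_bounds)+
  show "respects_cong (int (modulus I)) (point_dim I) (extension P x)"
    unfolding extension_def by (rule respects_cong_multilinear_ext)
  show "joint_value I (alice_part P x) (bob_part P x) r < modulus I" for r
    by (simp add: joint_value_def modulus_pos)
  fix r assume r: "valid_point (modulus I) (point_dim I) r"
  let ?A = "party_entry I 0 True (alice_part P x)"
    and ?B = "party_entry I (inst_vars I div 2) False (bob_part P x)"
  have "[int (joint_value I (alice_part P x) (bob_part P x) r) =
      int (alice_value I (alice_part P x) r + bob_value I (bob_part P x) r)] (mod int (modulus I))"
    unfolding joint_value_def by (rule int_mod_cong)
  also have "[int (alice_value I (alice_part P x) r + bob_value I (bob_part P x) r) =
      multilinear_ext (\<lambda>y. of_bool (?A y)) (map int r) +
      multilinear_ext (\<lambda>y. of_bool (?B y)) (map int r)]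
      (mod int (modulus I))"
    unfolding of_nat_add by (intro cong_add int_party_value r)
  also have "multilinear_ext (\<lambda>y. of_bool (?A y)) (map int r) +
      multilinear_ext (\<lambda>y. of_bool (?B y)) (map int r) =
      extension P x (map int r)"
    unfolding multilinear_ext_add[symmetric] extension_def
    by (rule multilinear_ext_cong) (use party_entry_sum[OF wf x] in \<open>simp add: I_def\<close>)
  finally show "[int (joint_value I (alice_part P x) (bob_part P x) r) = extension P x (map int r)]
      (mod int (modulus I))" .
qed

lemma low_degree_body_ops_extension:
  "low_degree (point_dim I) (extension P x) (body_ops I)"
  unfolding extension_def by (intro low_degree_body_ops affine_in_multilinear_ext)

lemma claim_true_iff_accepts:
  fixes \<epsilon> :: real
  assumes wf: "wf_bp P"
  defines "I \<equiv> inst_of P \<epsilon>"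
  shows "claim_true (modulus I) (extension P x) 1 (replicate (point_dim I) 0) (body_ops I) \<longleftrightarrow>
      bp_accepts P x"
proof -
  let ?zeros = "replicate (point_dim I) False"
  have "arith (extension P x) (body_ops I) (map of_bool ?zeros) =
      of_bool (holds (entry_at P x) (body_ops I) ?zeros)"
    by (rule arith_of_bool[OF _ low_degree_op_below[OF low_degree_body_ops_extension]])
      (simp_all add: extension_def multilinear_ext_of_bool)
  also have "holds (entry_at P x) (body_ops I) ?zeros \<longleftrightarrow> bp_accepts P x"
    unfolding I_def by (rule holds_body_ops_iff_accepts[OF wf])
  finally show ?thesis
    using modulus_gt_1[of I] by (simp add: claim_true_def cong_def)
qed

section \<open>The protocol\<close>

definition merlin :: "branching_program \<Rightarrow> real \<Rightarrow> bits \<Rightarrow> strategy" where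
  "merlin P \<epsilon> x tr c a = (let I = inst_of P \<epsilon> in
     merlin_reply (modulus I) (elem_bits I) (extension P x) (all_ops I) (replicate (point_dim I) 0)
       (tl (map fst tr @ [c])))"

lemma response_merlin:
  "response (merlin P \<epsilon> x) [] c =
      merlin_reply (modulus (inst_of P \<epsilon>)) (elem_bits (inst_of P \<epsilon>)) (extension P x)
     (all_ops (inst_of P \<epsilon>)) (replicate (point_dim (inst_of P \<epsilon>)) 0)"
proof
  fix h
  let ?f = "merlin_reply (modulus (inst_of P \<epsilon>)) (elem_bits (inst_of P \<epsilon>)) (extension P x)
     (all_ops (inst_of P \<epsilon>)) (replicate (point_dim (inst_of P \<epsilon>)) 0)"
  have "merlin P \<epsilon> x = (\<lambda>tr c a. ?f (tl (map fst tr @ [c])))"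
    by (simp add: fun_eq_iff merlin_def Let_def)
  then show "response (merlin P \<epsilon> x) [] c h = ?f h" by (simp add: response_of_coins)
qed

definition protocol :: "branching_program \<Rightarrow> real \<Rightarrow> ip_protocol" where
  "protocol P \<epsilon> = \<lparr>ip_schedule = schedule (inst_of P \<epsilon>), ip_alice = (\<lambda>_ _ _. []),
     ip_bob = bob (inst_of P \<epsilon>), ip_verdict = verdict (inst_of P \<epsilon>), ip_merlin = merlin P \<epsilon>\<rparr>"

lemma protocol_simps [simp]:
  "ip_schedule (protocol P \<epsilon>) = schedule (inst_of P \<epsilon>)" "ip_alice (protocol P \<epsilon>) xa tr c = []"
  "ip_bob (protocol P \<epsilon>) = bob (inst_of P \<epsilon>)" "ip_verdict (protocol P \<epsilon>) = verdict (inst_of P \<epsilon>)"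
  "ip_merlin (protocol P \<epsilon>) = merlin P \<epsilon>"
  by (simp_all add: protocol_def)

lemma coin_space_protocol:
  "coin_space (protocol P \<epsilon>) =
    {cs. set cs \<subseteq> coins (coin_bits (inst_of P \<epsilon>)) \<and>
      length cs = Suc (length (all_ops (inst_of P \<epsilon>)))}"
proof -
  have "map length cs = replicate n k \<longleftrightarrow> set cs \<subseteq> coins k \<and> length cs = n" for cs n k
    by (induction cs arbitrary: n; case_tac n) (auto simp: coins_def)
  then show ?thesis unfolding coin_space_def by (simp add: schedule_def del: replicate_Suc)
qed

lemma strategies_protocol:
  "m \<in> strategies (protocol P \<epsilon>) \<longleftrightarrow> (\<forall>tr c a. length tr < Suc (length (all_ops (inst_of P \<epsilon>))) \<longrightarrow>
     length (m tr c a) = 3 * elem_bits (inst_of P \<epsilon>))"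
  unfolding strategies_def by (auto simp: schedule_def simp del: replicate_Suc)

subsection \<open>Efficiency\<close>

lemma poly_time_if_polytime:
  assumes "polytime f" "\<And>inp out. (inp, out) \<in> R \<Longrightarrow> \<exists>a. inp = code a \<and> out = code (f a)"
  shows "poly_time R"
proof -
  obtain c B where c: "computes c f B" "polybounded B" using assms(1) by (rule polytimeE)
  obtain d where d: "\<And>a. B a \<le> d * (size (code a) + 1) ^ d" using polyboundedE[OF c(2)] by blast
  have "\<exists>t. t \<le> d * (size (code a) + 1) ^ d \<and> runs c (code a) t (code (f a))" for a
  proof -
    have "runs_within c ((\<lambda>_. Atom)(0 := code a)) (B a) (\<lambda>s'. s' 0 = code (f a))"
      using c(1) by (simp add: computes_def)
    then obtain t s' where "exec c ((\<lambda>_. Atom)(0 := code a)) t s'" "t \<le> B a" "s' 0 = code (f a)"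
      by (rule runs_withinE)
    then show ?thesis
      using order_trans[OF _ d[of a]] unfolding runs_def by blast
  qed
  then show ?thesis unfolding poly_time_def using assms(2) by (intro exI[of _ c] exI[of _ d]) fast
qed

lemma code_bits_eq: "code_bits = code"
  by (simp add: code_eq_code_list code_eq_code_bool)

lemma code_transcript_eq: "code_transcript = code"
proof -
  have "(\<lambda>(c, a, w). Dot (code_bits c) (Dot (code_bits a) (code_bits w))) = code"
    by (auto simp: fun_eq_iff code_bits_eq)
  then show ?thesis by (simp add: code_transcript_def code_eq_code_list)
qed

lemma code_schedule_eq: "code_schedule = code"
proof -
  have "(\<lambda>(k, l). Dot (code_nat k) (code_nat l)) = code"
    by (auto simp: fun_eq_iff code_eq_code_nat)
  then show ?thesis by (simp add: code_schedule_def code_eq_code_list)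
qed

lemma efficient_protocol: "efficient protocol"
  unfolding efficient_def code_transcript_eq code_schedule_eq
  unfolding code_bits_eq code_eq_code_list[symmetric] code_inst_of[symmetric]
    code_eq_code_bool[symmetric]
    code_Pair[symmetric] protocol_simps
proof (intro conjI, goal_cases)
  case 1
  show ?case
    by (rule poly_time_if_polytime[OF polytime_schedule[OF polytime_ident]])
      (auto simp del: code_Pair split_paired_Ex)
next
  case 2
  show ?case
    by (rule poly_time_if_polytime[where f = "\<lambda>_ :: inst \<times> bits \<times> transcript \<times> bits. [] :: bits",
          OF polytime_const])
      (auto simp del: code_Pair split_paired_Ex)
next
  case 3
  have "polytime (\<lambda>z. verdict (fst z) (fst (snd z)) (fst (snd (snd z))) (snd (snd (snd z))))"
    by (intro polytime_intros)
  then show ?case by (rule poly_time_if_polytime) (auto simp del: code_Pair split_paired_Ex)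
next
  case 4
  have "polytime (\<lambda>z. bob (fst z) (fst (snd z)) (snd (snd z)))" by (intro polytime_intros)
  then show ?case by (rule poly_time_if_polytime) (auto simp del: code_Pair split_paired_Ex)
qed

subsection \<open>Completeness and soundness\<close>

lemma merlin_in_strategies: "merlin P \<epsilon> x \<in> strategies (protocol P \<epsilon>)"
  by (simp add: strategies_protocol merlin_def length_merlin_reply Let_def)

lemma alice_accepts_iff_run:
  fixes \<epsilon> :: real
  assumes "wf_bp P" "length cs = length (all_ops (inst_of P \<epsilon>))"
  defines "I \<equiv> inst_of P \<epsilon>"
  shows "alice_accepts (protocol P \<epsilon>) xa xb m (c0 # cs) \<longleftrightarrow>
    run (modulus I) (elem_bits I) (joint_value I xa xb) (response m [] c0)
      (True, 1, replicate (point_dim I) 0) (all_ops I) cs"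
proof -
  have "modulus I \<le> 2 ^ elem_bits I"
    unfolding I_def using num_ops_ge_20[OF assms(1), of \<epsilon>] by (intro modulus_bounds) simp
  then show ?thesis
    unfolding alice_accepts_def play_eq_replies[OF protocol_simps(2)] protocol_simps I_def[symmetric]
    using assms(2) by (intro verdict_eq_run) (simp_all add: I_def)
qed

lemma protocol_complete:
  assumes "wf_bp P" "length x = bp_vars P" "bp_accepts P x" "cs \<in> coin_space (protocol P \<epsilon>)"
  shows "alice_accepts (protocol P \<epsilon>) (alice_part P x) (bob_part P x) (merlin P \<epsilon> x) cs"
proof -
  define I where "I = inst_of P \<epsilon>"
  interpret game "modulus I" "coin_bits I" "elem_bits I" "point_dim I" "extension P x"
    "joint_value I (alice_part P x) (bob_part P x)"
    unfolding I_def by (rule game_inst_of[OF assms(1,2)])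
  obtain c0 cs' where cs: "cs = c0 # cs'" "length cs' = length (all_ops I)"
    using assms(4) unfolding coin_space_protocol I_def by (cases cs) auto
  have "honest (modulus I) (elem_bits I) (extension P x) (response (merlin P \<epsilon> x) [] c0)
      (all_ops I) zeros"
    unfolding response_merlin I_def[symmetric] all_ops_def
    by (intro honest_merlin_reply valid_point_zeros p_pos low_degree_repeat_ops
        low_degree_body_ops_extension Check_notin_body_ops)
  moreover have "true 1 zeros (body_ops I)"
    using claim_true_iff_accepts[OF assms(1), where x = x and \<epsilon> = \<epsilon>] assms(3) unfolding I_def
    by blast
  ultimately have "run (modulus I) (elem_bits I) (joint_value I (alice_part P x) (bob_part P x))
      (response (merlin P \<epsilon> x) [] c0) (True, 1, zeros) (all_ops I) cs'"
    using cs(2) unfolding all_ops_def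
    by (intro run_accepts_repeat_ops low_degree_body_ops_extension Check_notin_body_ops)
  then show ?thesis
    unfolding cs(1) using alice_accepts_iff_run[OF assms(1)] cs(2) by (simp add: I_def)
qed

lemma error_le:
  fixes \<epsilon> :: real
  assumes "wf_bp P" "\<epsilon> > 0"
  defines "I \<equiv> inst_of P \<epsilon>"
  shows "(real (num_ops I) * (2 / 2 ^ coin_bits I)) ^ repetitions I \<le> \<epsilon>"
proof -
  have "0 < gain I"
    using num_ops_ge_20[OF assms(1), of \<epsilon>] less_floorlog_iff[of 0 "2 * num_ops I"]
    by (simp add: gain_def I_def)
  have "real (2 * num_ops I) \<le> real (2 ^ gain I)"
    using less_pow2_above[of "2 * num_ops I"] unfolding gain_def pow2_above_def
    by (simp only: of_nat_le_iff less_imp_le)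
  then have "real (num_ops I) * (2 / 2 ^ coin_bits I) \<le> 2 ^ gain I / 2 ^ coin_bits I"
    by (simp add: divide_right_mono)
  also have "\<dots> = (1 / 2) ^ gain I" by (simp add: coin_bits_def mult_2 power_add power_divide)
  finally have "(real (num_ops I) * (2 / 2 ^ coin_bits I)) ^ repetitions I \<le>
      ((1 / 2) ^ gain I) ^ repetitions I"
    by (intro power_mono) auto
  also have "\<dots> = 2 powr (- real (gain I * repetitions I))"
    by (simp only: power_mult[symmetric] powr_minus powr_realpow zero_less_numeral)
      (simp add: power_one_over inverse_eq_divide)
  also have "\<dots> \<le> 2 powr (log 2 \<epsilon>)"
  proof -
    have "inst_precision I < gain I * repetitions I"
      using dividend_less_times_div[OF \<open>0 < gain I\<close>, of "inst_precision I"]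
      by (simp add: repetitions_def)
    moreover have "log 2 (1 / \<epsilon>) \<le> real (inst_precision I)" unfolding I_def inst_of_simps
      by linarith
    moreover have "log 2 (1 / \<epsilon>) = - log 2 \<epsilon>" using assms(2) by (simp add: log_divide)
    ultimately have "- log 2 \<epsilon> \<le> real (gain I * repetitions I)" by linarith
    then show ?thesis by (intro powr_mono) auto
  qed
  also have "\<dots> = \<epsilon>" using assms(2) by simp
  finally show ?thesis .
qed

lemma protocol_sound:
  assumes "wf_bp P" "length x = bp_vars P" "\<not> bp_accepts P x" "\<epsilon> > 0"
  shows "measure_pmf.prob (pmf_of_set (coin_space (protocol P \<epsilon>)))
    {cs. \<not> alice_accepts (protocol P \<epsilon>) (alice_part P x) (bob_part P x) m cs} \<ge> 1 - \<epsilon>"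
proof -
  define I where "I = inst_of P \<epsilon>"
  interpret game "modulus I" "coin_bits I" "elem_bits I" "point_dim I" "extension P x"
    "joint_value I (alice_part P x) (bob_part P x)"
    unfolding I_def by (rule game_inst_of[OF assms(1,2)])
  let ?acc = "alice_accepts (protocol P \<epsilon>) (alice_part P x) (bob_part P x) m"
  have "list_prob (coins (coin_bits I)) (Suc (length (all_ops I))) ?acc \<le>
      (real (num_ops I) * (2 / 2 ^ coin_bits I)) ^ repetitions I"
  proof (rule list_prob_Suc_le[OF finite_coins coins_nonempty])
    fix c0
    have "list_prob (coins (coin_bits I)) (length (all_ops I)) (\<lambda>cs. ?acc (c0 # cs)) =
        accept_prob (response m [] c0) (True, 1, zeros) (repeat_ops (repetitions I) (body_ops I))"
      unfolding accept_prob_def all_ops_def[symmetric]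
      by (rule list_prob_cong[OF finite_coins coins_nonempty])
        (use alice_accepts_iff_run[OF assms(1)] in \<open>simp add: I_def\<close>)
    also have "\<dots> \<le> (real (length (body_ops I)) * (2 / 2 ^ coin_bits I)) ^ repetitions I"
      using claim_true_iff_accepts[OF assms(1), where x = x and \<epsilon> = \<epsilon>] assms(3)
      by (intro accept_prob_repeat_ops_le low_degree_body_ops_extension Check_notin_body_ops)
        (simp add: I_def)
    finally show "list_prob (coins (coin_bits I)) (length (all_ops I)) (\<lambda>cs. ?acc (c0 # cs)) \<le>
        (real (num_ops I) * (2 / 2 ^ coin_bits I)) ^ repetitions I"
      unfolding length_body_ops .
  qed
  also have "\<dots> \<le> \<epsilon>" unfolding I_def by (rule error_le[OF assms(1,4)])
  finally have "measure_pmf.prob (pmf_of_set (coin_space (protocol P \<epsilon>))) {cs. ?acc cs} \<le> \<epsilon>"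
    unfolding list_prob_def coin_space_protocol I_def .
  then show ?thesis
    using measure_pmf.prob_compl[of "{cs. ?acc cs}" "pmf_of_set (coin_space (protocol P \<epsilon>))"]
    by (simp add: Compl_eq_Diff_UNIV[symmetric] Collect_neg_eq)
qed

subsection \<open>Costs\<close>

lemma lg_ge_1: "1 \<le> lg z"
  by (simp add: lg_def)

lemma floorlog_le_log: "1 \<le> n \<Longrightarrow> real (floorlog 2 n) \<le> log 2 (real n) + 1"
  by (simp add: floorlog_def)

lemma floorlog_le_lg: "1 \<le> n \<Longrightarrow> real (floorlog 2 n) \<le> 2 * lg (real n)"
  using floorlog_le_log[of n] by (simp add: lg_def)

lemma bob_bound_nonneg: "0 \<le> bob_bound W T \<epsilon>"
  using lg_ge_1[of "lg W"] lg_ge_1[of "lg T"] lg_ge_1[of "1 / \<epsilon>"] unfolding bob_bound_def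
  by linarith

lemma num_ops_le:
  assumes "wf_bp P"
  shows "real (num_ops (inst_of P \<epsilon>)) \<le> 320 * ((lg (bp_width P))\<^sup>2 * (lg (bp_length P))\<^sup>2)"
proof -
  let ?K = "floorlog 2 (bp_length P)" and ?L = "floorlog 2 (bp_width P)"
  have wf: "1 \<le> bp_length P" "1 \<le> bp_width P" using assms by (auto simp: wf_bp_def)
  have KL: "1 \<le> ?K" "1 \<le> ?L" using wf less_floorlog_iff[of 0] by (auto simp: Suc_le_eq)
  have "?K * 1 + 3 * (1 * ?L) + 1 * 1 \<le> ?K * ?L + 3 * (?K * ?L) + ?K * ?L"
    using KL by (intro add_mono mult_mono) auto
  then have "?K + 3 * ?L + 1 \<le> 5 * (?K * ?L)" by simp
  moreover have "3 * ?L + 1 \<le> 4 * ?L" using KL by simp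
  ultimately have "num_ops (inst_of P \<epsilon>) \<le> ?K * (4 * ?L) * (5 * (?K * ?L))"
    unfolding num_ops_def point_dim_def inst_of_simps by (intro mult_mono) auto
  then have "real (num_ops (inst_of P \<epsilon>)) \<le> real (?K * (4 * ?L) * (5 * (?K * ?L)))"
    by (simp only: of_nat_le_iff)
  also have "\<dots> = 20 * ((real ?L)\<^sup>2 * (real ?K)\<^sup>2)" by (simp add: power2_eq_square)
  also have "\<dots> \<le> 20 * ((2 * lg (bp_width P))\<^sup>2 * (2 * lg (bp_length P))\<^sup>2)"
    using floorlog_le_lg wf by (intro mult_left_mono mult_mono power_mono) auto
  also have "\<dots> = 320 * ((lg (bp_width P))\<^sup>2 * (lg (bp_length P))\<^sup>2)" by (simp add: power2_eq_square)
  finally show ?thesis .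
qed

lemma gain_le:
  assumes "wf_bp P"
  shows "real (gain (inst_of P \<epsilon>)) \<le> 6 * bob_bound (bp_width P) (bp_length P) \<epsilon>"
proof -
  let ?w = "lg (bp_width P)" and ?t = "lg (bp_length P)" and ?N = "num_ops (inst_of P \<epsilon>)"
  have N: "20 \<le> ?N" by (rule num_ops_ge_20[OF assms])
  have wt: "1 \<le> ?w" "1 \<le> ?t" by (rule lg_ge_1)+
  have "0 \<le> ?w\<^sup>2 * ?t\<^sup>2" by simp
  then have "2 * real ?N \<le> 1024 * (?w\<^sup>2 * ?t\<^sup>2)" using num_ops_le[OF assms, of \<epsilon>] by linarith
  then have "real (2 * ?N) \<le> 2 ^ 10 * (?w\<^sup>2 * ?t\<^sup>2)" by simp
  then have "log 2 (real (2 * ?N)) \<le> log 2 (2 ^ 10 * (?w\<^sup>2 * ?t\<^sup>2))"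
    using N by (intro log_mono) auto
  also have "\<dots> = 10 + 2 * log 2 ?w + 2 * log 2 ?t"
    using wt log_pow_cancel[of "2 :: real" 10]
    by (simp only: log_mult log_nat_power) (simp add: log_mult log_nat_power)
  also have "\<dots> \<le> 10 + 2 * lg ?w + 2 * lg ?t" by (simp add: lg_def)
  finally have "log 2 (real (2 * ?N)) \<le> 10 + 2 * lg ?w + 2 * lg ?t" .
  moreover have "real (gain (inst_of P \<epsilon>)) \<le> log 2 (real (2 * ?N)) + 1"
    unfolding gain_def by (rule floorlog_le_log) (use N in simp)
  ultimately have "real (gain (inst_of P \<epsilon>)) \<le> 11 + 2 * lg ?w + 2 * lg ?t" by simp
  moreover have "11 + 2 * a + 2 * b \<le> 6 * (a + b + c)" if "1 \<le> a" "1 \<le> b" "1 \<le> c" for a b c :: real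
    using that by simp
  ultimately show ?thesis
    unfolding bob_bound_def using lg_ge_1 by (blast intro: order_trans)
qed

lemma repetitions_times_gain_le:
  assumes "wf_bp P"
  shows "real (repetitions (inst_of P \<epsilon>) * gain (inst_of P \<epsilon>)) \<le>
      8 * bob_bound (bp_width P) (bp_length P) \<epsilon>"
proof -
  let ?I = "inst_of P \<epsilon>"
  have "repetitions ?I * gain ?I \<le> inst_precision ?I + gain ?I"
    by (simp add: repetitions_def)
  then have "real (repetitions ?I * gain ?I) \<le> real (inst_precision ?I + gain ?I)"
    by (rule of_nat_mono)
  moreover have "real (inst_precision ?I) \<le> 2 * lg (1 / \<epsilon>)"
    unfolding inst_of_simps lg_def by linarith
  moreover have "lg (1 / \<epsilon>) \<le> bob_bound (bp_width P) (bp_length P) \<epsilon>"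
    using lg_ge_1[of "lg (bp_width P)"] lg_ge_1[of "lg (bp_length P)"] unfolding bob_bound_def
    by linarith
  ultimately show ?thesis using gain_le[OF assms, of \<epsilon>] by simp
qed

lemma total_length_le:
  assumes "wf_bp P"
  shows "real (Suc (length (all_ops (inst_of P \<epsilon>))) * (3 * elem_bits (inst_of P \<epsilon>)))
    \<le> 76800 * alice_bound (bp_width P) (bp_length P) \<epsilon>"
proof -
  let ?I = "inst_of P \<epsilon>"
  have "Suc (repetitions ?I * (num_ops ?I + 1)) \<le>
      repetitions ?I * (num_ops ?I + 1) + repetitions ?I * 1"
    by (simp add: repetitions_def)
  also have "\<dots> = repetitions ?I * (num_ops ?I + 2)" by (simp add: algebra_simps)
  also have "\<dots> \<le> repetitions ?I * (2 * num_ops ?I)"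
    using num_ops_ge_20[OF assms, of \<epsilon>] by (intro mult_left_mono) auto
  finally have "Suc (length (all_ops ?I)) * (3 * elem_bits ?I) \<le>
      repetitions ?I * (2 * num_ops ?I) * (3 * elem_bits ?I)"
    unfolding length_all_ops by (rule mult_right_mono) simp
  then have "real (Suc (length (all_ops ?I)) * (3 * elem_bits ?I)) \<le>
      real (repetitions ?I * (2 * num_ops ?I) * (3 * elem_bits ?I))" by (rule of_nat_mono)
  also have "\<dots> = 30 * (real (num_ops ?I) * real (repetitions ?I * gain ?I))"
    by (simp add: elem_bits_def)
  also have "\<dots> \<le> 30 * (320 * ((lg (bp_width P))\<^sup>2 * (lg (bp_length P))\<^sup>2) *
      (8 * bob_bound (bp_width P) (bp_length P) \<epsilon>))"
    by (intro mult_left_mono mult_mono num_ops_le repetitions_times_gain_le assms) auto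
  also have "\<dots> = 76800 * alice_bound (bp_width P) (bp_length P) \<epsilon>" by (simp add: alice_bound_def)
  finally show ?thesis .
qed

lemma exchanged_bits_protocol_le:
  assumes "wf_bp P" "m \<in> strategies (protocol P \<epsilon>)" "cs \<in> coin_space (protocol P \<epsilon>)"
  shows "real (exchanged_bits (play (protocol P \<epsilon>) xa m cs)) \<le>
      76800 * alice_bound (bp_width P) (bp_length P) \<epsilon>"
proof -
  let ?I = "inst_of P \<epsilon>"
  have cs: "length cs = Suc (length (all_ops ?I))" using assms(3) unfolding coin_space_protocol
    by blast
  have "exchanged_bits (play (protocol P \<epsilon>) xa m cs) = length cs * (3 * elem_bits ?I)"
    unfolding play_eq_replies[OF protocol_simps(2)]
    by (rule exchanged_bits_replies[where n = "Suc (length (all_ops ?I))"])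
      (use assms(2) cs in \<open>auto simp: strategies_protocol\<close>)
  then show ?thesis using total_length_le[OF assms(1), of \<epsilon>] cs by simp
qed

lemma coin_count_protocol_le:
  assumes "wf_bp P"
  shows "real (coin_count (protocol P \<epsilon>)) \<le> 76800 * alice_bound (bp_width P) (bp_length P) \<epsilon>"
proof -
  let ?I = "inst_of P \<epsilon>"
  have "coin_count (protocol P \<epsilon>) = Suc (length (all_ops ?I)) * coin_bits ?I"
    unfolding coin_count_def protocol_simps schedule_def map_replicate sum_list_replicate by simp
  also have "\<dots> \<le> Suc (length (all_ops ?I)) * (3 * elem_bits ?I)"
    by (intro mult_left_mono) (simp_all add: coin_bits_def elem_bits_def)
  finally show ?thesis using total_length_le[OF assms, of \<epsilon>] by linarith
qed

lemma length_bob_protocol_le: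
  assumes "wf_bp P" "cs \<in> coin_space (protocol P \<epsilon>)"
  shows "real (length (ip_bob (protocol P \<epsilon>) xb cs)) \<le>
      76800 * bob_bound (bp_width P) (bp_length P) \<epsilon>"
proof -
  let ?I = "inst_of P \<epsilon>"
  have "length cs = Suc (length (all_ops ?I))" using assms(2) unfolding coin_space_protocol by blast
  then have "length (ip_bob (protocol P \<epsilon>) xb cs) = 5 * (repetitions ?I * gain ?I)"
    unfolding protocol_simps bob_eq_bob_messages
    by (subst length_bob_messages) (simp_all add: count_Check_all_ops elem_bits_def)
  then have "real (length (ip_bob (protocol P \<epsilon>) xb cs)) = 5 * real (repetitions ?I * gain ?I)"
    by (simp only: of_nat_mult of_nat_numeral)
  then show ?thesis
    using repetitions_times_gain_le[OF assms(1), of \<epsilon>]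
      bob_bound_nonneg[of "bp_width P" "bp_length P" \<epsilon>]
    by linarith
qed

theorem theorem5p5:
  shows "\<exists>(C::real) (F :: branching_program \<Rightarrow> real \<Rightarrow> ip_protocol).
    efficient F \<and>
    (\<forall>P \<epsilon> n T W \<pi>. wf_bp P \<and> bp_vars P = n \<and> bp_length P = T \<and> bp_width P = W \<and>
        \<epsilon> > 0 \<and> \<pi> = F P \<epsilon> \<longrightarrow>
      (\<forall>x m cs. length x = n \<and> m \<in> strategies \<pi> \<and> cs \<in> coin_space \<pi> \<longrightarrow>
         real (exchanged_bits (play \<pi> (alice_part P x) m cs)) \<le> C * alice_bound W T \<epsilon>) \<and>
      real (coin_count \<pi>) \<le> C * alice_bound W T \<epsilon> \<and>
      (\<forall>x cs. length x = n \<and> cs \<in> coin_space \<pi> \<longrightarrow>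
         real (length (ip_bob \<pi> (bob_part P x) cs)) \<le> C * bob_bound W T \<epsilon>) \<and>
      (\<forall>x. length x = n \<longrightarrow>
         ip_merlin \<pi> x \<in> strategies \<pi> \<and>
         (bp_accepts P x \<longrightarrow>
           (\<forall>cs \<in> coin_space \<pi>.
              alice_accepts \<pi> (alice_part P x) (bob_part P x) (ip_merlin \<pi> x) cs)) \<and>
         (\<not> bp_accepts P x \<longrightarrow>
           (\<forall>m \<in> strategies \<pi>.
              measure_pmf.prob (pmf_of_set (coin_space \<pi>))
                {cs. \<not> alice_accepts \<pi> (alice_part P x) (bob_part P x) m cs} \<ge> 1 - \<epsilon>))))"
proof (rule exI[of _ 76800], rule exI[of _ protocol], intro conjI allI impI; (elim conjE; hypsubst)?)
  show "efficient protocol" by (rule efficient_protocol)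
next
  fix P and \<epsilon> :: real
  assume wf: "wf_bp P" and \<epsilon>: "\<epsilon> > 0"
  let ?W = "bp_width P" and ?T = "bp_length P" and ?\<pi> = "protocol P \<epsilon>"
  show "real (coin_count ?\<pi>) \<le> 76800 * alice_bound ?W ?T \<epsilon>"
    by (rule coin_count_protocol_le[OF wf])
  show "real (exchanged_bits (play ?\<pi> (alice_part P x) m cs)) \<le> 76800 * alice_bound ?W ?T \<epsilon>"
    if "m \<in> strategies ?\<pi>" "cs \<in> coin_space ?\<pi>" for x m cs
    by (rule exchanged_bits_protocol_le[OF wf that])
  show "real (length (ip_bob ?\<pi> (bob_part P x) cs)) \<le> 76800 * bob_bound ?W ?T \<epsilon>"
    if "cs \<in> coin_space ?\<pi>" for x cs
    by (rule length_bob_protocol_le[OF wf that])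
  fix x :: bits assume "bp_vars P = length x"
  then have x: "length x = bp_vars P" ..
  show "ip_merlin ?\<pi> x \<in> strategies ?\<pi>"
    unfolding protocol_simps by (rule merlin_in_strategies)
  show "\<forall>cs \<in> coin_space ?\<pi>. alice_accepts ?\<pi> (alice_part P x) (bob_part P x) (ip_merlin ?\<pi> x) cs"
    if "bp_accepts P x"
    unfolding protocol_simps using protocol_complete[OF wf x that] by blast
  show "\<forall>m \<in> strategies ?\<pi>. measure_pmf.prob (pmf_of_set (coin_space ?\<pi>))
      {cs. \<not> alice_accepts ?\<pi> (alice_part P x) (bob_part P x) m cs} \<ge> 1 - \<epsilon>"
    if "\<not> bp_accepts P x"
    using protocol_sound[OF wf x that \<epsilon>] by blast
qed

end
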